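(* Let $w\in C^2([-2,2])$, $\eta>0$, $\mu>0$, $f\in L^2(-1,1)$ and $0<\beta\le\alpha\le2\beta$. Then the functional $$E_1(v)=\alpha\,\sharp(S_v)+\beta\,\sharp(S_{\dot v}\setminus S_v)+\int_{-1}^1\big(\eta|\ddot v|^2-fv\big)\,dx+\mu\int_{-1}^1|v-w|^2\,dx$$ achieves a finite minimum over the functions $v\in\mathbf{H}^2(-2,2)$ such that $v=w$ a.e. in $(-2,-1)\cup(1,2)$ and $v\ge w$ on $[-1,1]$.
   Context: $\mathbf{H}^2(-2,2)$ is the set of functions $v:(-2,2)\to\mathbb{R}$ that are piecewise $H^2$, i.e. made of finitely many $H^2$ pieces: there is a finite partition $-2=s_0<\dots<s_n=2$ with $v\in H^2(s_{i-1},s_i)$ for each $i$. $\dot v$ is the absolutely continuous part of the distributional derivative $v'$, $\ddot v$ is the absolutely continuous part of $(\dot v)'$; $S_v$ and $S_{\dot v}$ are the sets of discontinuity points of $v$ and $\dot v$ in $(-2,2)$ (possibly including the points $\pm1$); $\sharp$ is the counting measure. $v^+$, $v^-$ denote right and left limits. The constraint "$v\ge w$ on $[-1,1]$" means: $v(x)\ge w(x)$ for $x\in[-1,1]\setminus S_v$; $v^+(x)\ge w(x)$ for $x\in S_v\cup\{-1\}$; $v^-(x)\ge w(x)$ for $x\in S_v\cup\{1\}$. *)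

theory Defs
  imports "HOL-Analysis.Analysis"
begin

definition test_function :: "real \<Rightarrow> real \<Rightarrow> (real \<Rightarrow> real) \<Rightarrow> bool" where
  "test_function a b \<phi> \<longleftrightarrow>
     (\<forall>n. (deriv ^^ n) \<phi> differentiable_on UNIV) \<and>
     compact (closure {x. \<phi> x \<noteq> 0}) \<and> closure {x. \<phi> x \<noteq> 0} \<subseteq> {a<..<b}"

(* Elements of Lebesgue and Sobolev spaces on an interval, and v itself, are represented by
   total functions on the reals; only their a.e. class on the interval matters. *)

definition L2 :: "real \<Rightarrow> real \<Rightarrow> (real \<Rightarrow> real) set" where
  "L2 a b = {u \<in> borel_measurable (lebesgue_on {a<..<b}).
               integrable (lebesgue_on {a<..<b}) (\<lambda>x. (u x)\<^sup>2)}"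

definition weak_deriv :: "real \<Rightarrow> real \<Rightarrow> (real \<Rightarrow> real) \<Rightarrow> (real \<Rightarrow> real) \<Rightarrow> bool" where
  "weak_deriv a b u g \<longleftrightarrow>
     (\<forall>\<phi>. test_function a b \<phi> \<longrightarrow>
        (LINT x|lebesgue_on {a<..<b}. u x * deriv \<phi> x) =
        - (LINT x|lebesgue_on {a<..<b}. g x * \<phi> x))"

definition H2 :: "real \<Rightarrow> real \<Rightarrow> (real \<Rightarrow> real) set" where
  "H2 a b = {u \<in> L2 a b. \<exists>u1\<in>L2 a b. \<exists>u2\<in>L2 a b. weak_deriv a b u u1 \<and> weak_deriv a b u1 u2}"

definition piecewise_H2 :: "real \<Rightarrow> real \<Rightarrow> (real \<Rightarrow> real) set" where
  "piecewise_H2 a b = {v. \<exists>n s. s 0 = a \<and> s n = b \<and>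
     (\<forall>i<n. s i < s (Suc i) \<and> v \<in> H2 (s i) (s (Suc i)))}"

(* The distributional derivative of v on (a,b) is the finite signed measure g dx + P - N, with
   P and N carried by a Lebesgue-null set Z; thus g is the density of its absolutely continuous
   part. *)
definition is_ac_deriv :: "real \<Rightarrow> real \<Rightarrow> (real \<Rightarrow> real) \<Rightarrow> (real \<Rightarrow> real) \<Rightarrow> bool" where
  "is_ac_deriv a b v g \<longleftrightarrow>
     integrable (lebesgue_on {a<..<b}) v \<and> integrable (lebesgue_on {a<..<b}) g \<and>
     (\<exists>P N Z. finite_measure P \<and> finite_measure N \<and> sets P = sets borel \<and> sets N = sets borel \<and>
        Z \<in> null_sets lborel \<and> emeasure P (- Z) = 0 \<and> emeasure N (- Z) = 0 \<and>
        (\<forall>\<phi>. test_function a b \<phi> \<longrightarrow>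
           (LINT x|lebesgue_on {a<..<b}. v x * deriv \<phi> x) =
           - ((LINT x|lebesgue_on {a<..<b}. g x * \<phi> x) + (LINT x|P. \<phi> x) - (LINT x|N. \<phi> x))))"

(* g in is_ac_deriv is unique only a.e. on (a,b). The choice is harmless: the functional below
   depends on it only through integrals and the representative-independent jump_set. *)
definition ac_deriv :: "real \<Rightarrow> real \<Rightarrow> (real \<Rightarrow> real) \<Rightarrow> real \<Rightarrow> real" where
  "ac_deriv a b v = (SOME g. is_ac_deriv a b v g)"

definition representative :: "real \<Rightarrow> real \<Rightarrow> (real \<Rightarrow> real) \<Rightarrow> (real \<Rightarrow> real) \<Rightarrow> bool" where
  "representative a b v u \<longleftrightarrow> (AE x in lebesgue_on {a<..<b}. u x = v x)"

(* Discontinuity points, values and one-sided limits of an a.e. class: x is a continuity point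
   if some representative is continuous at x, and the value at x is then that of such a
   representative; one-sided limits are those of any representative that has one. All three are
   independent of the choice of representative. For a piecewise H^2 function they agree with the
   pointwise notions for the representative that is continuous wherever possible. *)
definition jump_set :: "real \<Rightarrow> real \<Rightarrow> (real \<Rightarrow> real) \<Rightarrow> real set" where
  "jump_set a b v = {x\<in>{a<..<b}. \<not> (\<exists>u. representative a b v u \<and> isCont u x)}"

definition point_value :: "real \<Rightarrow> real \<Rightarrow> (real \<Rightarrow> real) \<Rightarrow> real \<Rightarrow> real" where
  "point_value a b v x = (THE y. \<exists>u. representative a b v u \<and> isCont u x \<and> u x = y)"

definition right_lim :: "real \<Rightarrow> real \<Rightarrow> (real \<Rightarrow> real) \<Rightarrow> real \<Rightarrow> real" where
  "right_lim a b v x = (THE y. \<exists>u. representative a b v u \<and> (u \<longlongrightarrow> y) (at_right x))"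

definition left_lim :: "real \<Rightarrow> real \<Rightarrow> (real \<Rightarrow> real) \<Rightarrow> real \<Rightarrow> real" where
  "left_lim a b v x = (THE y. \<exists>u. representative a b v u \<and> (u \<longlongrightarrow> y) (at_left x))"

definition C2_on :: "real \<Rightarrow> real \<Rightarrow> (real \<Rightarrow> real) \<Rightarrow> bool" where
  "C2_on a b w \<longleftrightarrow> (\<exists>w1 w2.
     (\<forall>x\<in>{a..b}. (w has_real_derivative w1 x) (at x within {a..b})) \<and>
     (\<forall>x\<in>{a..b}. (w1 has_real_derivative w2 x) (at x within {a..b})) \<and>
     continuous_on {a..b} w2)"

definition above_obstacle :: "(real \<Rightarrow> real) \<Rightarrow> (real \<Rightarrow> real) \<Rightarrow> bool" where
  "above_obstacle w v \<longleftrightarrow>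
     (\<forall>x\<in>{-1..1} - jump_set (-2) 2 v. point_value (-2) 2 v x \<ge> w x) \<and>
     (\<forall>x\<in>jump_set (-2) 2 v \<union> {-1}. right_lim (-2) 2 v x \<ge> w x) \<and>
     (\<forall>x\<in>jump_set (-2) 2 v \<union> {1}. left_lim (-2) 2 v x \<ge> w x)"

definition admissible :: "(real \<Rightarrow> real) \<Rightarrow> (real \<Rightarrow> real) set" where
  "admissible w = {v \<in> piecewise_H2 (-2) 2.
     (AE x in lebesgue. x \<in> {-2<..<-1} \<union> {1<..<2} \<longrightarrow> v x = w x) \<and> above_obstacle w v}"

definition counting :: "real set \<Rightarrow> ereal" where
  "counting A = enn2ereal (emeasure (count_space UNIV) A)"

(* For f in L^2(-1,1), w continuous and v piecewise H^2, both integrands are integrable, so the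
   convention that the integral of a non-integrable function is 0 plays no role. *)
definition E1 :: "real \<Rightarrow> real \<Rightarrow> real \<Rightarrow> real \<Rightarrow> (real \<Rightarrow> real) \<Rightarrow> (real \<Rightarrow> real) \<Rightarrow>
    (real \<Rightarrow> real) \<Rightarrow> ereal" where
  "E1 \<alpha> \<beta> \<eta> \<mu> f w v =
     (let v1 = ac_deriv (-2) 2 v; v2 = ac_deriv (-2) 2 v1 in
        ereal \<alpha> * counting (jump_set (-2) 2 v) +
        ereal \<beta> * counting (jump_set (-2) 2 v1 - jump_set (-2) 2 v) +
        ereal (LINT x|lebesgue_on {-1<..<1}. \<eta> * \<bar>v2 x\<bar>\<^sup>2 - f x * v x) +
        ereal (\<mu> * (LINT x|lebesgue_on {-1<..<1}. \<bar>v x - w x\<bar>\<^sup>2)))"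

end

theory Submission
  imports Defs
begin

text \<open>The direct method, run on explicit data. A piecewise \<open>H\<^sup>2\<close> function is a twice integrated
  \<open>L\<^sup>2\<close> function plus a piecewise affine function with finitely many nodes, each carrying a jump
  of the value and a jump of the slope; its cost is \<open>\<alpha>\<close> or \<open>\<beta>\<close> per node. Completing the square in
  \<open>\<mu> (v - w)\<^sup>2 - f v\<close> makes the remaining part of the functional a sum of convex squares. Along a
  minimizing sequence the number of nodes is bounded, the nodes converge after passing to a
  subsequence, and the jumps of all nodes clustering at one limit point add up to sequences that
  are bounded because the functions are bounded in \<open>L\<^sup>2\<close>. A limit jump that comes from slope jumps
  only needs at least two of them, so \<open>\<beta> \<le> \<alpha> \<le> 2 \<beta>\<close> makes the cost lower semicontinuous. The
  affine parts converge pointwise and hence so do their convex combinations; replacing the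
  sequence by tail convex combinations whose second derivatives converge almost everywhere,
  Fatou's lemma and convexity give the minimality of the limit.\<close>

section \<open>Smooth test functions\<close>

text \<open>The functional is stated for almost-everywhere classes through distributional
  derivatives and choice operators, so a large part of the work is a dictionary: uniqueness of
  distributional densities and comparison of one-sided limits turn admissibility and energy into
  statements about explicit data. Because v = w on (-2,-1), value and slope at -2 are the same for
  all admissible functions; all freedom lies in the second derivative and in the jumps on [-1,1].

  The obstacle in the limit passage is that the cost of the nodes is not convex and cannot be
  carried through convex combinations. It is settled first, along a subsequence with a constant
  pattern of nodes; only the quadratic part is left for the convex combinations. The relation
  between \<alpha> and \<beta> answers to two degenerations. Two opposite slope jumps growing like
  the inverse of their distance merge into a value jump, whence \<alpha> \<le> 2 \<beta>. A value
  jump that shrinks to zero may leave a slope jump behind, whence \<beta> \<le> \<alpha>. The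
  obstacle bounds v only from below; the L2 bound comes from the fidelity term.\<close>

fun ndiff :: "nat \<Rightarrow> (real \<Rightarrow> real) \<Rightarrow> bool" where
  "ndiff 0 f = True"
| "ndiff (Suc n) f = (\<exists>f'. (\<forall>x. (f has_real_derivative f' x) (at x)) \<and> ndiff n f')"

lemma ndiff_mono: "ndiff (Suc n) f \<Longrightarrow> ndiff n f"
proof (induction n arbitrary: f)
  case (Suc n)
  then show ?case by (metis ndiff.simps(2))
qed simp

lemma ndiff_imp_deriv: "ndiff (n + Suc m) f \<Longrightarrow> ndiff (Suc m) ((deriv ^^ n) f)"
proof (induction n arbitrary: f)
  case (Suc n)
  then obtain f' where f': "\<And>x. (f has_real_derivative f' x) (at x)" "ndiff (n + Suc m) f'"
    by auto
  have "deriv f = f'" using f'(1) by (auto intro!: ext DERIV_imp_deriv)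
  then show ?case using Suc.IH[OF f'(2)] by (simp add: funpow_swap1)
qed simp

text \<open>Asking for some derivative \<open>f'\<close> instead of iterating \<open>deriv\<close>
  lets products and compositions be handled by induction with explicit derivatives; this equivalence
  carries the result back to the smoothness condition in \<open>test_function\<close>.\<close>

lemma ndiff_iff: "(\<forall>n. ndiff n f) \<longleftrightarrow> (\<forall>n. (deriv ^^ n) f differentiable_on UNIV)"
proof
  assume *: "\<forall>n. ndiff n f"
  show "\<forall>n. (deriv ^^ n) f differentiable_on UNIV"
  proof
    fix n
    have "ndiff (Suc 0) ((deriv ^^ n) f)" using * ndiff_imp_deriv by blast
    then show "(deriv ^^ n) f differentiable_on UNIV"
      by (auto simp: differentiable_on_def real_differentiable_def)
  qed
next
  assume *: "\<forall>n. (deriv ^^ n) f differentiable_on UNIV"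
  have "ndiff k ((deriv ^^ n) f)" for k n
  proof (induction k arbitrary: n)
    case (Suc k)
    have "((deriv ^^ n) f has_real_derivative (deriv ^^ Suc n) f x) (at x)" for x
      using * by (simp add: differentiable_on_def DERIV_deriv_iff_real_differentiable)
    then show ?case using Suc.IH[of "Suc n"] by (auto intro!: exI[of _ "(deriv ^^ Suc n) f"])
  qed simp
  from this[of _ 0] show "\<forall>n. ndiff n f" by simp
qed

lemma ndiff_const: "ndiff n (\<lambda>x. c)"
proof (induction n arbitrary: c)
  case (Suc n)
  then show ?case by (auto intro!: exI[of _ "\<lambda>x. 0"])
qed simp

lemma ndiff_id: "ndiff n (\<lambda>x. x)"
  by (cases n) (auto intro!: exI[of _ "\<lambda>x. 1"] ndiff_const)

lemma ndiff_add: "ndiff n f \<Longrightarrow> ndiff n g \<Longrightarrow> ndiff n (\<lambda>x. f x + g x)"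
proof (induction n arbitrary: f g)
  case (Suc n)
  then obtain f' g' where "\<And>x. (f has_real_derivative f' x) (at x)" "ndiff n f'"
    "\<And>x. (g has_real_derivative g' x) (at x)" "ndiff n g'" by auto
  then show ?case
    using Suc.IH by (auto intro!: exI[of _ "\<lambda>x. f' x + g' x"] derivative_eq_intros)
qed simp

lemma ndiff_mult: "ndiff n f \<Longrightarrow> ndiff n g \<Longrightarrow> ndiff n (\<lambda>x. f x * g x)"
proof (induction n arbitrary: f g)
  case (Suc n)
  then obtain f' g' where *: "\<And>x. (f has_real_derivative f' x) (at x)" "ndiff n f'"
    "\<And>x. (g has_real_derivative g' x) (at x)" "ndiff n g'" by auto
  have "ndiff n f" "ndiff n g" using Suc.prems ndiff_mono by blast+
  then have "ndiff n (\<lambda>x. f' x * g x + g' x * f x)"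
    by (intro ndiff_add Suc.IH *)
  then show ?case
    using * by (auto intro!: exI[of _ "\<lambda>x. f' x * g x + g' x * f x"] derivative_eq_intros)
qed simp

lemma ndiff_compose: "ndiff n f \<Longrightarrow> ndiff n g \<Longrightarrow> ndiff n (\<lambda>x. f (g x))"
proof (induction n arbitrary: f g)
  case (Suc n)
  then obtain f' g' where *: "\<And>x. (f has_real_derivative f' x) (at x)" "ndiff n f'"
    "\<And>x. (g has_real_derivative g' x) (at x)" "ndiff n g'" by auto
  have "ndiff n (\<lambda>x. f' (g x) * g' x)"
    by (rule ndiff_mult[OF Suc.IH[OF *(2) ndiff_mono[OF Suc.prems(2)]] *(4)])
  moreover have "\<forall>x. ((\<lambda>x. f (g x)) has_real_derivative f' (g x) * g' x) (at x)"
    using DERIV_chain2[OF *(1) *(3)] by blast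
  ultimately show ?case unfolding ndiff.simps by (intro exI[of _ "\<lambda>x. f' (g x) * g' x"] conjI)
qed simp

lemma ndiff_exp: "ndiff n exp"
proof (induction n)
  case (Suc n)
  have "\<forall>x::real. (exp has_real_derivative exp x) (at x)" by (simp add: DERIV_exp)
  then show ?case using Suc unfolding ndiff.simps by (intro exI[of _ exp] conjI)
qed simp

text \<open>Closed under differentiation up to linear combinations, which is what makes \<open>exp (- 1/x)\<close> smooth at 0.\<close>

definition flat :: "nat \<Rightarrow> real \<Rightarrow> real" where
  "flat k x = (if x > 0 then (1/x) ^ k * exp (- 1/x) else 0)"

lemma flat_tendsto_0: "(flat k \<longlongrightarrow> 0) (at_right 0)"
proof -
  have "((\<lambda>y::real. y ^ k / exp y) \<longlongrightarrow> 0) at_top" by (rule tendsto_power_div_exp_0)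
  then have "((\<lambda>x::real. (inverse x) ^ k / exp (inverse x)) \<longlongrightarrow> 0) (at_right 0)"
    by (rule filterlim_compose) (rule filterlim_inverse_at_top_right)
  then show ?thesis
    by (rule Lim_transform_eventually)
       (auto simp: eventually_at_filter flat_def exp_minus divide_inverse)
qed

lemma flat_deriv:
  "(flat k has_real_derivative (flat (k+2) x - of_nat k * flat (Suc k) x)) (at x)"
proof -
  consider "x > 0" | "x < 0" | "x = 0" by linarith
  then show ?thesis
  proof cases
    case 1
    have "((\<lambda>x. (1/x) ^ k * exp (- (1/x))) has_real_derivative
       (flat (k+2) x - of_nat k * flat (Suc k) x)) (at x)"
    proof -
      have 0: "((\<lambda>x. 1/x) has_real_derivative - ((1/x)^2)) (at x)"
        using 1 by (auto intro!: derivative_eq_intros simp: power2_eq_square)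
      have "((\<lambda>x. exp (- (1/x))) has_real_derivative exp (- (1/x)) * (1/x)^2) (at x)"
        by (rule derivative_eq_intros 0 refl)+ simp
      note prod_deriv = DERIV_mult[OF DERIV_power[OF 0, of k] this]
      show ?thesis
      proof (rule DERIV_cong[OF prod_deriv])
        have "real k * (- ((1/x)\<^sup>2) * (1/x) ^ (k - Suc 0)) = - (real k * (1/x) ^ Suc k)"
          by (cases k) (auto simp: power2_eq_square)
        then show "real k * (- ((1/x)\<^sup>2) * (1/x) ^ (k - Suc 0)) * exp (- (1/x)) + exp (- (1/x)) * (1/x)\<^sup>2 * (1/x) ^ k
          = flat (k + 2) x - real k * flat (Suc k) x"
          using 1 by (simp add: flat_def algebra_simps power_add power2_eq_square)
      qed
    qed
    then show ?thesis
      by (rule has_field_derivative_transform_within_open[of _ _ _ "{0<..}"])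
         (use 1 in \<open>auto simp: flat_def\<close>)
  next
    case 2
    have "((\<lambda>x. 0::real) has_real_derivative 0) (at x)" by simp
    then have "(flat k has_real_derivative 0) (at x)"
      by (rule has_field_derivative_transform_within_open[of _ _ _ "{..<0}"])
         (use 2 in \<open>auto simp: flat_def\<close>)
    then show ?thesis using 2 by (simp add: flat_def)
  next
    case 3
    \<comment> \<open>At 0 the difference quotient is 0 on the left and \<open>flat (Suc k)\<close>
      on the right, which tends to 0 because the exponential beats every power.\<close>
    have "((\<lambda>y. (flat k y - flat k 0) / (y - 0)) \<longlongrightarrow> 0) (at 0)"
    proof (rule filterlim_split_at)
      have "((\<lambda>y. 0::real) \<longlongrightarrow> 0) (at_left (0::real))" by simp
      then show "((\<lambda>y. (flat k y - flat k 0) / (y - 0)) \<longlongrightarrow> 0) (at_left 0)"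
        by (rule Lim_transform_eventually) (auto simp: eventually_at_filter flat_def)
      show "((\<lambda>y. (flat k y - flat k 0) / (y - 0)) \<longlongrightarrow> 0) (at_right 0)"
        by (rule Lim_transform_eventually[OF flat_tendsto_0[of "Suc k"]])
           (auto simp: eventually_at_filter flat_def)
    qed
    then have "(flat k has_real_derivative 0) (at 0)"
      by (simp add: has_field_derivative_iff)
    then show ?thesis using 3 by (simp add: flat_def)
  qed
qed

lemma ndiff_flat: "ndiff n (flat k)"
proof (induction n arbitrary: k)
  case (Suc n)
  have "ndiff n (\<lambda>x. flat (k+2) x + (- of_nat k) * flat (Suc k) x)"
    by (intro ndiff_add ndiff_mult ndiff_const Suc.IH)
  then show ?case using flat_deriv[of k]
    by (auto intro!: exI[of _ "\<lambda>x. flat (k+2) x + (- of_nat k) * flat (Suc k) x"])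
qed simp

definition bump :: "real \<Rightarrow> real \<Rightarrow> real \<Rightarrow> real" where
  "bump c d x = flat 0 (x - c) * flat 0 (d - x)"

lemma bump_pos: "c < x \<Longrightarrow> x < d \<Longrightarrow> 0 < bump c d x"
  and bump_zero: "x \<le> c \<or> d \<le> x \<Longrightarrow> bump c d x = 0"
  and bump_nonneg: "0 \<le> bump c d x"
  by (auto simp: bump_def flat_def)

lemma ndiff_bump: "ndiff n (bump c d)"
proof -
  have "ndiff n (\<lambda>x. flat 0 (x + (- c)) * flat 0 (d + (-1) * x))"
    by (intro ndiff_mult ndiff_compose[OF ndiff_flat] ndiff_add ndiff_const ndiff_id)
  then show ?thesis by (simp add: bump_def[abs_def])
qed

lemma test_functionI:
  assumes "\<And>n. ndiff n \<phi>" "\<And>x. x \<notin> {c..d} \<Longrightarrow> \<phi> x = 0" "a < c" "d < b"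
  shows "test_function a b \<phi>"
proof -
  have "{x. \<phi> x \<noteq> 0} \<subseteq> {c..d}" using assms(2) by blast
  then have "closure {x. \<phi> x \<noteq> 0} \<subseteq> {c..d}" by (rule closure_minimal) simp
  moreover then have "compact (closure {x. \<phi> x \<noteq> 0})"
    by (meson bounded_closed_interval bounded_subset closed_closure compact_eq_bounded_closed)
  moreover have "{c..d} \<subseteq> {a<..<b}" using assms(3,4) by auto
  ultimately show ?thesis
    using assms(1) ndiff_iff[of \<phi>] unfolding test_function_def by blast
qed

lemma test_functionE:
  assumes "test_function a b \<phi>" "a < b"
  obtains c d where "a < c" "c \<le> d" "d < b" "\<And>x. x \<notin> {c<..<d} \<Longrightarrow> \<phi> x = 0"
proof (cases "closure {x. \<phi> x \<noteq> 0} = {}")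
  case True
  then have "\<phi> x = 0" for x using closure_subset by fastforce
  then show ?thesis using assms(2) that[of "(a+b)/2" "(a+b)/2"] by simp
next
  case False
  let ?K = "closure {x. \<phi> x \<noteq> 0}"
  have K: "compact ?K" "?K \<subseteq> {a<..<b}" using assms(1) by (auto simp: test_function_def)
  obtain l where l: "l \<in> ?K" "\<And>x. x \<in> ?K \<Longrightarrow> l \<le> x" using compact_attains_inf[OF K(1) False] by blast
  obtain u where u: "u \<in> ?K" "\<And>x. x \<in> ?K \<Longrightarrow> x \<le> u" using compact_attains_sup[OF K(1) False] by blast
  \<comment> \<open>Moving halfway from the extreme points of the support to the ends of (a,b) makes
    \<phi> vanish at c and d themselves.\<close>
  have "\<phi> x = 0" if "x \<notin> {(a+l)/2<..<(u+b)/2}" for x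
  proof (rule ccontr)
    assume "\<phi> x \<noteq> 0"
    then have "x \<in> ?K" using closure_subset by fastforce
    then show False using l(2)[of x] u(2)[of x] l(1) u(1) K(2) that by (auto simp: field_simps)
  qed
  moreover have "a < l" "u < b" "l \<le> u" using l u K(2) by auto
  ultimately show ?thesis using that[of "(a+l)/2" "(u+b)/2"] by auto
qed

lemma test_function_smooth:
  assumes "test_function a b \<phi>"
  shows "ndiff n \<phi>"
  using assms ndiff_iff[of \<phi>] by (auto simp: test_function_def)

lemma test_function_DERIV:
  assumes "test_function a b \<phi>"
  shows "(\<phi> has_real_derivative deriv \<phi> x) (at x)" "continuous_on S \<phi>" "continuous_on S (deriv \<phi>)"
proof -
  obtain f' f'' where f: "\<And>x. (\<phi> has_real_derivative f' x) (at x)" "\<And>x. (f' has_real_derivative f'' x) (at x)"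
    using test_function_smooth[OF assms, of 2] by (auto simp: numeral_2_eq_2)
  have [simp]: "deriv \<phi> = f'" using f(1) by (auto intro!: ext DERIV_imp_deriv)
  show "(\<phi> has_real_derivative deriv \<phi> x) (at x)" using f by simp
  show "continuous_on S \<phi>" "continuous_on S (deriv \<phi>)"
    using DERIV_continuous_on[OF has_field_derivative_at_within[OF f(1)]]
      DERIV_continuous_on[OF has_field_derivative_at_within[OF f(2)]] by simp_all
qed

text \<open>Even at c and d themselves there is one side on which \<phi> vanishes identically, and
  the difference quotient may be evaluated along that side alone.\<close>

lemma deriv_zero_outside:
  fixes \<phi> :: "real \<Rightarrow> real"
  assumes "\<And>x. x \<notin> {c<..<d} \<Longrightarrow> \<phi> x = 0" "\<And>x. (\<phi> has_real_derivative \<phi>' x) (at x)" "x \<notin> {c<..<d}"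
    "c \<le> d"
  shows "\<phi>' x = 0"
proof -
  have "\<exists>F. F \<noteq> bot \<and> F \<le> at x \<and> (\<forall>\<^sub>F y in F. y \<notin> {c<..<d})"
  proof (cases "x \<le> c")
    case True
    then show ?thesis by (intro exI[of _ "at_left x"]) (auto simp: eventually_at_filter at_within_le_at)
  next
    case False
    then show ?thesis using assms(3) by (intro exI[of _ "at_right x"]) (auto simp: eventually_at_filter at_within_le_at)
  qed
  then obtain F where F: "F \<noteq> bot" "F \<le> at x" "\<forall>\<^sub>F y in F. y \<notin> {c<..<d}" by blast
  have "((\<lambda>y. (\<phi> y - \<phi> x) / (y - x)) \<longlongrightarrow> \<phi>' x) F"
    using assms(2)[of x] F(2) unfolding has_field_derivative_iff by (rule tendsto_mono[rotated])
  moreover have "((\<lambda>y. (\<phi> y - \<phi> x) / (y - x)) \<longlongrightarrow> 0) F"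
    by (rule tendsto_eventually) (use F(3) assms(1,3) in \<open>auto elim!: eventually_mono\<close>)
  ultimately show ?thesis using tendsto_unique[OF F(1)] by blast
qed

text \<open>Smooth functions with values in [0,1) that vanish outside (c,d) and increase with k to
  its indicator: test functions able to measure open intervals.\<close>

lemma test_function_approx:
  assumes "a < c" "d < b"
  shows "test_function a b (\<lambda>x. 1 - exp (- real k * bump c d x))"
proof (rule test_functionI[OF _ _ assms])
  fix n
  have "ndiff n (\<lambda>x. 1 + (-1) * exp (- real k * bump c d x))"
    by (intro ndiff_add ndiff_const ndiff_mult ndiff_compose[OF ndiff_exp] ndiff_bump)
  then show "ndiff n (\<lambda>x. 1 - exp (- real k * bump c d x))" by simp
next
  fix x assume "x \<notin> {c..d}"
  then show "1 - exp (- real k * bump c d x) = 0" by (auto simp: bump_zero)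
qed

lemma test_function_approx_tendsto:
  "(\<lambda>k. 1 - exp (- real k * bump c d x)) \<longlonglongrightarrow> indicator {c<..<d} x"
proof (cases "x \<in> {c<..<d}")
  case True
  then have "bump c d x > 0" by (auto intro: bump_pos)
  then have "(\<lambda>k. 1 - exp (- (bump c d x * real k))) \<longlonglongrightarrow> 1 - 0"
    by (intro tendsto_intros filterlim_compose[OF exp_at_bot]
          filterlim_compose[OF filterlim_uminus_at_bot_at_top] filterlim_tendsto_pos_mult_at_top[OF tendsto_const]
          filterlim_real_sequentially)
  then show ?thesis using True by (simp add: mult.commute)
next
  case False
  then have "bump c d x = 0" by (auto intro!: bump_zero)
  then show ?thesis using False by simp
qed

lemma test_function_bounded: "\<bar>1 - exp (- real k * bump c d x)\<bar> \<le> 1"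
proof -
  have "exp (- real k * bump c d x) \<le> 1" using bump_nonneg[of c d x] by simp
  then show ?thesis by (smt (verit) exp_gt_zero)
qed

section \<open>Primitives and integration by parts\<close>

abbreviation leb :: "real \<Rightarrow> real \<Rightarrow> real measure" where
  "leb a b \<equiv> lebesgue_on {a<..<b}"

lemmas LINT_cong = Bochner_Integration.integral_cong
lemmas HK_integral_cong = Henstock_Kurzweil_Integration.integral_cong

lemma finite_measure_leb [simp, intro!]: "finite_measure (leb a b)"
  by (rule finite_measure_lebesgue_on) (simp add: bounded_set_imp_lmeasurable)

lemma leb_integrable_iff: "integrable (leb a b) f \<longleftrightarrow> f absolutely_integrable_on {a<..<b}"
  for f :: "real \<Rightarrow> real"
  by (simp add: integrable_restrict_space set_integrable_def)

lemma leb_integrable_iff_UNIV: "integrable (leb a b) f \<longleftrightarrow> integrable lebesgue (\<lambda>x. indicator {a<..<b} x * f x)"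
  for f :: "real \<Rightarrow> real"
  by (simp add: integrable_restrict_space)

lemma leb_measurable_iff: "f \<in> borel_measurable (leb a b) \<longleftrightarrow> (\<lambda>x. indicator {a<..<b} x * f x) \<in> borel_measurable lebesgue"
  for f :: "real \<Rightarrow> real"
  by (simp add: borel_measurable_restrict_space_iff)

lemma leb_LINT_UNIV: "(LINT x|leb a b. f x) = (LINT x|lebesgue. indicator {a<..<b} x * f x)"
  for f :: "real \<Rightarrow> real"
  by (simp add: integral_restrict_space)

lemma leb_LINT: "integrable (leb a b) f \<Longrightarrow> (LINT x|leb a b. f x) = integral {a..b} f"
  for f :: "real \<Rightarrow> real"
  by (simp add: lebesgue_integral_eq_integral integral_open_interval_real)

lemma leb_measurable_subset:
  "f \<in> borel_measurable (leb a b) \<Longrightarrow> a \<le> c \<Longrightarrow> d \<le> b \<Longrightarrow> f \<in> borel_measurable (leb c d)"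
  for f :: "real \<Rightarrow> real"
  by (erule measurable_restrict_mono) auto

lemma leb_subset: "integrable (leb a b) f \<Longrightarrow> a \<le> c \<Longrightarrow> d \<le> b \<Longrightarrow> integrable (leb c d) f"
  for f :: "real \<Rightarrow> real"
  unfolding leb_integrable_iff by (erule set_integrable_subset) auto

lemma leb_integrable_on: "integrable (leb a b) f \<Longrightarrow> a \<le> c \<Longrightarrow> d \<le> b \<Longrightarrow> f integrable_on {c..d}"
  for f :: "real \<Rightarrow> real"
  by (drule (2) leb_subset) (auto simp: leb_integrable_iff integrable_on_open_interval_real dest!: set_lebesgue_integral_eq_integral(1))

lemma leb_continuous: "continuous_on {a..b} f \<Longrightarrow> integrable (leb a b) f"
  for f :: "real \<Rightarrow> real"
  unfolding leb_integrable_iff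
  by (drule absolutely_integrable_continuous_real) (erule set_integrable_subset, auto)

lemma leb_bounded:
  fixes f :: "real \<Rightarrow> real"
  assumes "f \<in> borel_measurable (leb a b)" "\<And>x. x \<in> {a<..<b} \<Longrightarrow> \<bar>f x\<bar> \<le> B"
  shows "integrable (leb a b) f"
  by (rule finite_measure.integrable_const_bound[where B = B])
     (use assms in \<open>auto simp: AE_restrict_space_iff\<close>)

lemma AE_leb: "(AE x in leb a b. P x) \<longleftrightarrow> (AE x in lebesgue. x \<in> {a<..<b} \<longrightarrow> P x)"
  by (simp add: AE_restrict_space_iff)

lemma AE_lebI: "(AE x in lborel. P x) \<Longrightarrow> AE x in leb a b. P x"
  unfolding AE_leb by (drule AE_completion) auto

lemma AE_leb_subset: "(AE x in leb a b. P x) \<Longrightarrow> a \<le> c \<Longrightarrow> d \<le> b \<Longrightarrow> AE x in leb c d. P x"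
  unfolding AE_leb by (erule AE_mp) auto

lemma AE_leb_glue: "(AE x in leb a b. P x) \<Longrightarrow> (AE x in leb b c. P x) \<Longrightarrow> AE x in leb a c. P x"
proof -
  assume "AE x in leb a b. P x" "AE x in leb b c. P x"
  moreover have "AE x in lebesgue. x \<noteq> b" by (intro AE_completion AE_lborel_singleton)
  ultimately show ?thesis unfolding AE_leb by eventually_elim auto
qed

lemma AE_leb_finite: "finite T \<Longrightarrow> AE x in leb a b. x \<notin> T"
  by (rule AE_lebI) (auto intro!: AE_not_in finite_imp_null_set_lborel)

lemma lebesgue_measurable_AE:
  fixes f g :: "real \<Rightarrow> real"
  assumes "AE x in lebesgue. f x = g x" "g \<in> borel_measurable lebesgue"
  shows "f \<in> borel_measurable lebesgue"
proof -
  obtain N where N: "N \<in> null_sets lebesgue" "\<And>x. x \<notin> N \<Longrightarrow> f x = g x"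
    using assms(1) by (rule AE_E3) auto
  have "g \<in> borel_measurable (lebesgue_on (- N))" using assms(2) by (rule measurable_restrict_space1)
  then have "f \<in> borel_measurable (lebesgue_on (- N))"
    by (rule measurable_cong[THEN iffD1, rotated]) (use N(2) in auto)
  then show ?thesis using lebesgue_measurable_diff_null[OF N(1)] by blast
qed

lemma integrable_leb_AE_cong:
  fixes f g :: "real \<Rightarrow> real"
  assumes "AE x in leb a b. f x = g x" "integrable (leb a b) g"
  shows "integrable (leb a b) f" "f \<in> borel_measurable (leb a b)"
proof -
  have g: "integrable lebesgue (\<lambda>x. indicator {a<..<b} x * g x)"
    using assms(2) by (simp add: leb_integrable_iff_UNIV)
  have ae: "AE x in lebesgue. indicator {a<..<b} x * f x = indicator {a<..<b} x * g x"
    using assms(1) unfolding AE_leb by eventually_elim (auto split: split_indicator)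
  have m: "(\<lambda>x. indicator {a<..<b} x * f x) \<in> borel_measurable lebesgue"
    by (rule lebesgue_measurable_AE[OF ae borel_measurable_integrable[OF g]])
  then show "f \<in> borel_measurable (leb a b)" by (simp add: leb_measurable_iff)
  show "integrable (leb a b) f"
    using g ae m unfolding leb_integrable_iff_UNIV
    by (subst integrable_cong_AE[where g = "\<lambda>x. indicator {a<..<b} x * g x"]) auto
qed

section \<open>Primitives of integrable functions\<close>

definition prim :: "real \<Rightarrow> (real \<Rightarrow> real) \<Rightarrow> real \<Rightarrow> real" where
  "prim a g x = integral {a..x} g"

lemma prim_LINT:
  assumes "integrable (leb a b) g" "x \<in> {a..b}"
  shows "prim a g x = (LINT y|leb a x. g y)" "prim a g x = (LINT y|leb a b. indicator {..<x} y * g y)"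
proof -
  have "integrable (leb a x) g" using assms leb_subset by auto
  then show 1: "prim a g x = (LINT y|leb a x. g y)" by (simp add: leb_LINT prim_def)
  show "prim a g x = (LINT y|leb a b. indicator {..<x} y * g y)"
    unfolding 1 leb_LINT_UNIV by (rule LINT_cong) (use assms(2) in \<open>auto simp: indicator_def\<close>)
qed

lemma continuous_prim: "integrable (leb a b) g \<Longrightarrow> continuous_on {a..b} (prim a g)"
  unfolding prim_def by (rule indefinite_integral_continuous_1) (auto intro: leb_integrable_on)

lemma integrable_prim: "integrable (leb a b) g \<Longrightarrow> integrable (leb a b) (prim a g)"
  by (rule leb_continuous) (rule continuous_prim)

lemma prim_combine:
  "integrable (leb a b) g \<Longrightarrow> a \<le> c \<Longrightarrow> c \<le> x \<Longrightarrow> x \<le> b \<Longrightarrow> prim a g x = prim a g c + prim c g x"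
  unfolding prim_def by (rule Henstock_Kurzweil_Integration.integral_combine[symmetric]) (auto intro: leb_integrable_on)

lemma prim_bound:
  assumes "integrable (leb a b) g" "x \<in> {a..b}"
  shows "\<bar>prim a g x\<bar> \<le> (LINT y|leb a b. \<bar>g y\<bar>)"
proof -
  have "\<bar>prim a g x\<bar> \<le> (LINT y|leb a b. \<bar>indicator {..<x} y * g y\<bar>)"
    unfolding prim_LINT(2)[OF assms] by (rule integral_abs_bound)
  also have "\<dots> \<le> (LINT y|leb a b. \<bar>g y\<bar>)"
    using assms by (intro integral_mono') (auto simp: indicator_def)
  finally show ?thesis .
qed

lemma prim_cong_AE:
  assumes "AE x in leb a b. f x = g x" "integrable (leb a b) g" "x \<in> {a..b}"
  shows "prim a f x = prim a g x"
proof -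
  have "AE y in leb a x. f y = g y" using AE_leb_subset[OF assms(1)] assms(3) by auto
  then show ?thesis
    using prim_LINT(1)[OF assms(2,3)] prim_LINT(1)[OF integrable_leb_AE_cong(1)[OF assms(1,2)] assms(3)]
      leb_measurable_subset[OF integrable_leb_AE_cong(2)[OF assms(1,2)], of a x]
      leb_measurable_subset[OF borel_measurable_integrable[OF assms(2)], of a x] assms(3)
    by (auto intro: integral_cong_AE)
qed

text \<open>Fubini and densities are used over \<open>lborel\<close>, so a Lebesgue-measurable
  integrand is first replaced by a Borel function equal to it almost everywhere and extended by
  0.\<close>

lemma borel_version:
  fixes g :: "real \<Rightarrow> real"
  assumes "integrable (leb a b) g"
  obtains h where "h \<in> borel_measurable borel" "integrable lborel h" "\<And>x. x \<notin> {a<..<b} \<Longrightarrow> h x = 0"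
    "AE x in leb a b. g x = h x"
proof -
  have i: "integrable lebesgue (\<lambda>x. indicator {a<..<b} x * g x)"
    using assms by (simp add: leb_integrable_iff_UNIV)
  then obtain g' where g': "g' \<in> borel_measurable lborel" "AE x in lborel. indicator {a<..<b} x * g x = g' x"
    using completion_ex_borel_measurable_real[of "\<lambda>x. indicator {a<..<b} x * g x" lborel] by auto
  define h where "h x = indicator {a<..<b} x * g' x" for x
  have h: "h \<in> borel_measurable lborel" unfolding h_def using g' by measurable
  have ae: "AE x in lborel. indicator {a<..<b} x * g x = h x"
    using g'(2) by eventually_elim (auto simp: h_def split: split_indicator split_indicator_asm)
  have "h \<in> borel_measurable lebesgue" using h by (rule measurable_completion)
  then have "integrable lebesgue h"
    using i ae[THEN AE_completion] by (subst integrable_cong_AE[where g = "\<lambda>x. indicator {a<..<b} x * g x"]) auto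
  then have "integrable lborel h" using h by (simp add: integrable_completion)
  moreover have "AE x in leb a b. g x = h x"
    using ae[THEN AE_completion] unfolding AE_leb by eventually_elim auto
  ultimately show ?thesis using that[of h] h by (auto simp: h_def)
qed

text \<open>Integrate \<open>deriv \<phi>\<close> from t to b, where \<phi> vanishes: the Heaviside
  step at t has the unit mass at t as distributional derivative.\<close>

lemma integral_indicator_test_deriv:
  assumes "test_function a b \<phi>" "a < b" "t \<in> {a..b}"
  shows "(LINT x|leb a b. indicator {t<..} x * deriv \<phi> x) = - \<phi> t"
    "integrable (leb a b) (\<lambda>x. indicator {t<..} x * deriv \<phi> x)"
proof -
  obtain c d where cd: "a < c" "c \<le> d" "d < b" "\<And>x. x \<notin> {c<..<d} \<Longrightarrow> \<phi> x = 0"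
    using test_functionE[OF assms(1,2)] by metis
  have i: "integrable (leb a b) (deriv \<phi>)"
    using test_function_DERIV(3)[OF assms(1)] by (rule leb_continuous)
  then have "integrable (leb t b) (deriv \<phi>)" using assms(3) by (auto intro: leb_subset)
  then have 1: "(LINT x|leb t b. deriv \<phi> x) = integral {t..b} (deriv \<phi>)" by (simp add: leb_LINT)
  have "(deriv \<phi> has_integral (\<phi> b - \<phi> t)) {t..b}"
    using assms(3) test_function_DERIV(1)[OF assms(1)]
    by (intro fundamental_theorem_of_calculus)
       (auto simp: has_real_derivative_iff_has_vector_derivative[symmetric] has_field_derivative_at_within)
  then have "integral {t..b} (deriv \<phi>) = - \<phi> t" using cd by (auto dest!: integral_unique)
  moreover have "(LINT x|leb t b. deriv \<phi> x) = (LINT x|leb a b. indicator {t<..} x * deriv \<phi> x)"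
    unfolding leb_LINT_UNIV by (rule LINT_cong) (use assms(3) in \<open>auto simp: indicator_def\<close>)
  ultimately show "(LINT x|leb a b. indicator {t<..} x * deriv \<phi> x) = - \<phi> t" using 1 by simp
  show "integrable (leb a b) (\<lambda>x. indicator {t<..} x * deriv \<phi> x)"
    using integrable_real_mult_indicator[of "{t<..}" lebesgue, OF _ i[unfolded leb_integrable_iff_UNIV]]
    unfolding leb_integrable_iff_UNIV by (simp add: mult_ac)
qed

lemma deriv_test_function_zero:
  assumes "test_function a b \<phi>" "a < b" "x \<notin> {a<..<b}"
  shows "deriv \<phi> x = 0" "\<phi> x = 0"
proof -
  obtain c d where cd: "a < c" "c \<le> d" "d < b" "\<And>x. x \<notin> {c<..<d} \<Longrightarrow> \<phi> x = 0"
    using test_functionE[OF assms(1,2)] by metis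
  show "deriv \<phi> x = 0"
    by (rule deriv_zero_outside[OF cd(4) test_function_DERIV(1)[OF assms(1)] _ cd(2)]) (use cd assms(3) in auto)
  show "\<phi> x = 0" using cd assms(3) by auto
qed

text \<open>For merely integrable g this is Fubini on the triangle y < x: integrating over x first
  turns \<open>deriv \<phi>\<close> on (y,b) into \<open>- \<phi> y\<close>.\<close>

lemma prim_by_parts:
  assumes g: "integrable (leb a b) g" and \<phi>: "test_function a b \<phi>" and "a < b"
  shows "(LINT x|leb a b. prim a g x * deriv \<phi> x) = - (LINT x|leb a b. g x * \<phi> x)"
proof -
  obtain h where h: "h \<in> borel_measurable borel" "integrable lborel h" "\<And>x. x \<notin> {a<..<b} \<Longrightarrow> h x = 0"
    "AE x in leb a b. g x = h x"
    using borel_version[OF g] by blast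
  have "AE x in leb a b. h x = g x" using h(4) by eventually_elim simp
  then have hi: "integrable (leb a b) h" using g by (rule integrable_leb_AE_cong)
  \<comment> \<open>Equal to \<open>deriv \<phi>\<close>, but written with the indicator so that
    integrability over the whole line is inherited from (a,b).\<close>
  define \<psi> where "\<psi> x = indicator {a<..<b} x * deriv \<phi> x" for x
  have \<psi>_eq: "\<psi> = deriv \<phi>" using deriv_test_function_zero(1)[OF \<phi> \<open>a < b\<close>] by (intro ext) (auto simp: \<psi>_def split: split_indicator)
  have \<psi>m: "\<psi> \<in> borel_measurable borel"
    unfolding \<psi>_eq by (rule borel_measurable_continuous_onI) (rule test_function_DERIV(3)[OF \<phi>])
  have "integrable lebesgue \<psi>"
    using leb_continuous[OF test_function_DERIV(3)[OF \<phi>], of a b] by (simp add: leb_integrable_iff_UNIV \<psi>_def[abs_def])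
  then have \<psi>i: "integrable lborel \<psi>" using \<psi>m by (simp add: integrable_completion)
  note [measurable] = h(1) \<psi>m
  define F where "F x y = (if y < x then h y else 0) * \<psi> x" for x y :: real
  have Fm[measurable]: "case_prod F \<in> borel_measurable (lborel \<Otimes>\<^sub>M lborel)" unfolding F_def[abs_def] by measurable
  have "integrable (lborel \<Otimes>\<^sub>M lborel) (\<lambda>(x, y). h y * \<psi> x)"
  proof (rule lborel_pair.Fubini_integrable)
    have "integrable lborel (\<lambda>x. (LINT y|lborel. \<bar>h y\<bar>) * \<bar>\<psi> x\<bar>)"
      using \<psi>i by auto
    then show "integrable lborel (\<lambda>x. LINT y|lborel. norm (case (x, y) of (x, y) \<Rightarrow> h y * \<psi> x))"
      by (simp add: abs_mult)
  qed (use h in auto)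
  then have Fi: "integrable (lborel \<Otimes>\<^sub>M lborel) (case_prod F)"
    by (rule Bochner_Integration.integrable_bound) (auto simp: F_def)
  have eq1: "prim a g x * deriv \<phi> x = (LINT y|lborel. F x y)" if "x \<in> {a<..<b}" for x
  proof -
    have "prim a g x = prim a h x"
      by (rule prim_cong_AE[OF h(4) hi]) (use that in auto)
    also have "\<dots> = (LINT y|lebesgue. (if y < x then h y else 0))"
      using that h(3) unfolding leb_LINT_UNIV
      by (subst prim_LINT(2)[OF hi]) (auto simp: leb_LINT_UNIV indicator_def intro!: LINT_cong)
    also have "\<dots> = (LINT y|lborel. (if y < x then h y else 0))"
      by (rule integral_completion) measurable
    finally show ?thesis by (simp add: F_def \<psi>_eq)
  qed
  have eq2: "(LINT y|lborel. F x y) = 0" if "x \<notin> {a<..<b}" for x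
    using that by (simp add: F_def \<psi>_def)
  have "(LINT x|leb a b. prim a g x * deriv \<phi> x) = (LINT x|lebesgue. LINT y|lborel. F x y)"
    unfolding leb_LINT_UNIV
    by (rule LINT_cong) (auto simp: eq1 eq2 split: split_indicator)
  also have "\<dots> = (LINT x|lborel. LINT y|lborel. F x y)"
    by (rule integral_completion) measurable
  also have "\<dots> = (LINT y|lborel. LINT x|lborel. F x y)"
    using lborel_pair.Fubini_integral[OF Fi] by simp
  also have "\<dots> = (LINT y|lborel. - (h y * \<phi> y))"
  proof (rule LINT_cong[OF refl])
    fix y
    show "(LINT x|lborel. F x y) = - (h y * \<phi> y)"
    proof (cases "y \<in> {a<..<b}")
      case True
      have "(LINT x|lborel. F x y) = (LINT x|lborel. h y * (indicator {y<..} x * \<psi> x))"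
        by (rule LINT_cong) (auto simp: F_def)
      also have "\<dots> = h y * (LINT x|lborel. indicator {y<..} x * \<psi> x)" by simp
      also have "(LINT x|lborel. indicator {y<..} x * \<psi> x) = (LINT x|lebesgue. indicator {y<..} x * \<psi> x)"
        by (rule integral_completion[symmetric]) measurable
      also have "\<dots> = (LINT x|leb a b. indicator {y<..} x * deriv \<phi> x)"
        unfolding leb_LINT_UNIV by (rule LINT_cong) (auto simp: \<psi>_def)
      also have "\<dots> = - \<phi> y" using True by (intro integral_indicator_test_deriv(1)[OF \<phi> \<open>a < b\<close>]) auto
      finally show ?thesis by simp
    next
      case False
      then have "h y = 0" by (rule h(3))
      then have "F x y = 0" for x by (simp add: F_def)
      then show ?thesis using \<open>h y = 0\<close> by simp
    qed
  qed
  also have "\<dots> = - (LINT y|lborel. h y * \<phi> y)" by simp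
  also have "(LINT y|lborel. h y * \<phi> y) = (LINT y|lebesgue. h y * \<phi> y)"
    using borel_measurable_continuous_onI[OF test_function_DERIV(2)[OF \<phi>]]
    by (intro integral_completion[symmetric]) simp
  also have "\<dots> = (LINT x|leb a b. h x * \<phi> x)"
    unfolding leb_LINT_UNIV using h(3) by (intro LINT_cong) (auto split: split_indicator)
  also have "\<dots> = (LINT x|leb a b. g x * \<phi> x)"
  proof (rule integral_cong_AE)
    have "\<phi> \<in> borel_measurable (leb a b)"
      using leb_continuous[OF test_function_DERIV(2)[OF \<phi>]] by (rule borel_measurable_integrable)
    then show "(\<lambda>x. h x * \<phi> x) \<in> borel_measurable (leb a b)" "(\<lambda>x. g x * \<phi> x) \<in> borel_measurable (leb a b)"
      using g hi by (auto intro!: borel_measurable_times)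
    show "AE x in leb a b. h x * \<phi> x = g x * \<phi> x" using h(4) by eventually_elim simp
  qed
  finally show ?thesis .
qed

lemma integrable_mult_continuous:
  fixes g :: "real \<Rightarrow> real"
  assumes "integrable (leb a b) g" "continuous_on {a..b} \<psi>"
  shows "integrable (leb a b) (\<lambda>x. g x * \<psi> x)"
proof -
  obtain B where B: "\<forall>x\<in>{a..b}. \<bar>\<psi> x\<bar> \<le> B"
    using compact_imp_bounded[OF compact_continuous_image[OF assms(2)]]
    by (auto simp: bounded_real)
  have "integrable (leb a b) (\<lambda>x. B * g x)" using assms(1) by simp
  then show ?thesis
  proof (rule Bochner_Integration.integrable_bound)
    show "(\<lambda>x. g x * \<psi> x) \<in> borel_measurable (leb a b)"
      using assms(1) leb_continuous[OF assms(2)] by auto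
    show "AE x in leb a b. norm (g x * \<psi> x) \<le> norm (B * g x)"
    proof (rule AE_I2)
      fix x assume "x \<in> space (leb a b)"
      then have "\<bar>\<psi> x\<bar> \<le> \<bar>B\<bar>" using bspec[OF B, of x] by auto
      then show "norm (g x * \<psi> x) \<le> norm (B * g x)" by (simp add: abs_mult mult.commute mult_right_mono)
    qed
  qed
qed

text \<open>Used with nodes for the singular measures in \<open>is_ac_deriv\<close>, and with
  \<open>T = {}\<close> for the weak derivatives of single pieces.\<close>

lemma integral_prim_step_test_deriv:
  assumes g: "integrable (leb a b) g" and \<phi>: "test_function a b \<phi>" and "a < b"
    and T: "finite T" "T \<subseteq> {a<..<b}"
  shows "(LINT x|leb a b. (c + prim a g x + (\<Sum>t\<in>T. A t * indicator {t<..} x)) * deriv \<phi> x)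
     = - ((LINT x|leb a b. g x * \<phi> x) + (\<Sum>t\<in>T. A t * \<phi> t))"
proof -
  have c: "continuous_on {a..b} (deriv \<phi>)" using test_function_DERIV(3)[OF \<phi>] .
  have i1: "integrable (leb a b) (\<lambda>x. c * deriv \<phi> x)"
    by (intro integrable_mult_right leb_continuous c)
  have i2: "integrable (leb a b) (\<lambda>x. prim a g x * deriv \<phi> x)"
    using integrable_mult_continuous[OF integrable_prim[OF g] c] .
  have i3: "integrable (leb a b) (\<lambda>x. A t * (indicator {t<..} x * deriv \<phi> x))" if "t \<in> T" for t
    by (intro integrable_mult_right integral_indicator_test_deriv[OF \<phi> \<open>a < b\<close>]) (use that T in auto)
  have i4: "(LINT x|leb a b. A t * (indicator {t<..} x * deriv \<phi> x)) = - (A t * \<phi> t)" if "t \<in> T" for t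
    using integral_indicator_test_deriv(1)[OF \<phi> \<open>a < b\<close>, of t] that T by auto
  have "(LINT x|leb a b. deriv \<phi> x) = (LINT x|leb a b. indicator {a<..} x * deriv \<phi> x)"
    by (rule LINT_cong) auto
  also have "\<dots> = 0"
    using integral_indicator_test_deriv(1)[OF \<phi> \<open>a < b\<close>, of a] deriv_test_function_zero[OF \<phi> \<open>a < b\<close>, of a] \<open>a<b\<close>
    by simp
  finally have i0: "(LINT x|leb a b. deriv \<phi> x) = 0" .
  have "(LINT x|leb a b. (c + prim a g x + (\<Sum>t\<in>T. A t * indicator {t<..} x)) * deriv \<phi> x)
    = (LINT x|leb a b. c * deriv \<phi> x + prim a g x * deriv \<phi> x + (\<Sum>t\<in>T. A t * (indicator {t<..} x * deriv \<phi> x)))"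
    by (rule LINT_cong) (auto simp: algebra_simps sum_distrib_left)
  also have "\<dots> = c * (LINT x|leb a b. deriv \<phi> x) + (LINT x|leb a b. prim a g x * deriv \<phi> x)
      + (\<Sum>t\<in>T. - (A t * \<phi> t))"
    using i1 i2 i3 i4 by simp
  finally show ?thesis
    using prim_by_parts[OF g \<phi> \<open>a < b\<close>] i0 by (simp add: sum_negf)
qed

section \<open>Uniqueness of distributional densities\<close>

lemma sets_borel_intervals: "sets borel = sigma_sets UNIV (range (\<lambda>(p, q). {p<..<q::real}))"
proof -
  have "sets borel = sets (sigma UNIV (range (\<lambda>(p, q). {p<..<q::real})))"
    unfolding borel_eq_box by (simp add: case_prod_unfold box_real)
  then show ?thesis by simp
qed

text \<open>Indicators of open intervals are dominated limits of test functions, and the vanishing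
  spreads from intervals to Borel sets by induction over an intersection-stable generator. The
  window (c0,d0) stays strictly inside (a,b) because test functions do not see mass at the ends or
  beyond. A finite family with coefficients stands for a signed measure.\<close>

lemma signed_measure_zero:
  fixes M :: "nat \<Rightarrow> real measure" and c :: "nat \<Rightarrow> real"
  assumes fin: "\<And>i. i < n \<Longrightarrow> finite_measure (M i)" and M: "\<And>i. i < n \<Longrightarrow> sets (M i) = sets borel"
    and test: "\<And>\<phi>. test_function a b \<phi> \<Longrightarrow> (\<Sum>i<n. c i * (LINT x|M i. \<phi> x)) = 0"
    and cd: "a < c0" "d0 < b" and A: "A \<in> sets borel"
  shows "(\<Sum>i<n. c i * measure (M i) (A \<inter> {c0<..<d0})) = 0"
proof -
  have interval: "(\<Sum>i<n. c i * measure (M i) {p<..<q}) = 0" if "a < p" "q < b" for p q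
  proof -
    have "(\<lambda>k. \<Sum>i<n. c i * (LINT x|M i. 1 - exp (- real k * bump p q x)))
        \<longlonglongrightarrow> (\<Sum>i<n. c i * (LINT x|M i. indicator {p<..<q} x))"
    proof (intro tendsto_sum tendsto_mult tendsto_const)
      fix i assume "i \<in> {..<n}"
      then interpret finite_measure "M i" using fin by auto
      have s: "sets (M i) = sets borel" using M \<open>i \<in> _\<close> by auto
      have meas: "(\<lambda>x. 1 - exp (- real k * bump p q x)) \<in> borel_measurable (M i)" for k
        using borel_measurable_continuous_onI[OF test_function_DERIV(2)[OF test_function_approx[OF that, of k]]]
        by (simp cong: measurable_cong_sets add: s)
      show "(\<lambda>k. LINT x|M i. 1 - exp (- real k * bump p q x)) \<longlonglongrightarrow> (LINT x|M i. indicator {p<..<q} x)"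
      proof (rule integral_dominated_convergence[where w = "\<lambda>_. 1"])
        show "indicat_real {p<..<q} \<in> borel_measurable (M i)" using s by auto
        show "AE x in M i. (\<lambda>k. 1 - exp (- real k * bump p q x)) \<longlonglongrightarrow> indicat_real {p<..<q} x"
          using test_function_approx_tendsto by auto
        show "\<And>k. AE x in M i. norm (1 - exp (- real k * bump p q x)) \<le> 1"
          using test_function_bounded by auto
      qed (use meas in auto)
    qed
    then have "(\<lambda>k. 0) \<longlonglongrightarrow> (\<Sum>i<n. c i * (LINT x|M i. indicator {p<..<q} x))"
      using test[OF test_function_approx[OF that]] by simp
    then have "(\<Sum>i<n. c i * (LINT x|M i. indicator {p<..<q} x)) = 0"
      using LIMSEQ_unique tendsto_const by blast
    moreover have "(LINT x|M i. indicator {p<..<q} x) = measure (M i) {p<..<q}" if "i < n" for i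
      using M[OF that] sets_eq_imp_space_eq[OF M[OF that]] by simp
    ultimately show ?thesis by simp
  qed
  let ?G = "range (\<lambda>(p, q). {p<..<q::real})"
  have "Int_stable ?G"
    by (auto simp: Int_stable_def image_iff)
  moreover have "?G \<subseteq> Pow UNIV" by simp
  moreover have "A \<in> sigma_sets UNIV ?G"
    using A by (simp add: sets_borel_intervals)
  ultimately show ?thesis
  proof (induction rule: sigma_sets_induct_disjoint)
    case (basic A)
    then obtain p q where "A = {p<..<q}" by auto
    then show ?case using interval[of "max p c0" "min q d0"] cd by (simp add: Int_greaterThanLessThan)
  next
    case empty
    then show ?case by simp
  next
    case (compl A)
    have A: "A \<in> sets borel"
      using compl by (simp add: sets_borel_intervals)
    have "measure (M i) ((UNIV - A) \<inter> {c0<..<d0}) = measure (M i) {c0<..<d0} - measure (M i) (A \<inter> {c0<..<d0})"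
      if "i < n" for i
    proof -
      interpret finite_measure "M i" using fin[OF that] .
      have "(UNIV - A) \<inter> {c0<..<d0} = {c0<..<d0} - A \<inter> {c0<..<d0}" by auto
      then show ?thesis using M[OF that] A by (subst finite_measure_Diff[symmetric]) auto
    qed
    then show ?case using compl interval[OF cd] by (simp add: right_diff_distrib sum_subtractf)
  next
    case (union A)
    have A: "A j \<in> sets borel" for j
      using union by (auto simp: sets_borel_intervals)
    have "(\<lambda>j. \<Sum>i<n. c i * measure (M i) (A j \<inter> {c0<..<d0})) sums
        (\<Sum>i<n. c i * measure (M i) (\<Union>j. A j \<inter> {c0<..<d0}))"
    proof (intro sums_sum sums_mult)
      fix i assume "i \<in> {..<n}"
      then interpret finite_measure "M i" using fin by auto
      show "(\<lambda>j. measure (M i) (A j \<inter> {c0<..<d0})) sums measure (M i) (\<Union>j. A j \<inter> {c0<..<d0})"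
      proof (rule finite_measure_UNION)
        show "disjoint_family (\<lambda>j. A j \<inter> {c0<..<d0})"
          using union(1) unfolding disjoint_family_on_def by blast
      qed (use \<open>i \<in> _\<close> M A in auto)
    qed
    then have "(\<Sum>i<n. c i * measure (M i) (\<Union>j. A j \<inter> {c0<..<d0})) = 0"
      using union(3) sums_unique2[OF _ sums_zero] by simp
    then show ?case by (simp add: Int_UN_distrib2 inf_commute UN_simps)
  qed
qed

text \<open>The positive and negative parts of the density join the family as two further measures.
  On the part of \<open>h > 0\<close> outside the null set Z all measures but the positive part
  vanish, so the positive part vanishes there too.\<close>

lemma distribution_zero_le:
  fixes M :: "nat \<Rightarrow> real measure" and c :: "nat \<Rightarrow> real"
  assumes fin: "\<And>i. i < n \<Longrightarrow> finite_measure (M i)" and M: "\<And>i. i < n \<Longrightarrow> sets (M i) = sets borel"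
    and Z: "Z \<in> null_sets lborel" "\<And>i. i < n \<Longrightarrow> emeasure (M i) (- Z) = 0"
    and g: "integrable (leb a b) g"
    and test: "\<And>\<phi>. test_function a b \<phi> \<Longrightarrow>
       (LINT x|leb a b. g x * \<phi> x) + (\<Sum>i<n. c i * (LINT x|M i. \<phi> x)) = 0"
  shows "AE x in leb a b. g x \<le> 0"
proof -
  obtain h where h: "h \<in> borel_measurable borel" "integrable lborel h" "\<And>x. x \<notin> {a<..<b} \<Longrightarrow> h x = 0"
    "AE x in leb a b. g x = h x"
    using borel_version[OF g] by blast
  note [measurable] = h(1)
  define Dp where "Dp = density lborel (\<lambda>x. ennreal (max 0 (h x)))"
  define Dn where "Dn = density lborel (\<lambda>x. ennreal (max 0 (- h x)))"
  define M' where "M' = case_nat Dp (case_nat Dn M)"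
  define c' where "c' = case_nat 1 (case_nat (-1) c)"
  have hp: "integrable lborel (\<lambda>x. max 0 (h x))" "integrable lborel (\<lambda>x. max 0 (- h x))"
    using h(2) by auto
  have "finite_measure Dp" "finite_measure Dn"
    using hp unfolding Dp_def Dn_def
    by (auto intro!: finite_measureI simp: emeasure_density nn_integral_eq_integral)
  then have fin': "finite_measure (M' i)" if "i < n + 2" for i
    using that fin by (auto simp: M'_def split: nat.split)
  have sets': "sets (M' i) = sets borel" if "i < n + 2" for i
    using that M by (auto simp: M'_def Dp_def Dn_def split: nat.split)
  have sum': "(\<Sum>i<n+2. c' i * f (M' i)) = f Dp - f Dn + (\<Sum>i<n. c i * f (M i))" for f
    unfolding add_2_eq_Suc' by (simp add: sum.lessThan_Suc_shift M'_def c'_def del: sum.lessThan_Suc)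
  have test': "(\<Sum>i<n+2. c' i * (LINT x|M' i. \<phi> x)) = 0" if \<phi>: "test_function a b \<phi>" for \<phi>
  proof -
    have \<phi>m[measurable]: "\<phi> \<in> borel_measurable borel"
      using borel_measurable_continuous_onI[OF test_function_DERIV(2)[OF \<phi>]] .
    have \<phi>i: "integrable lborel (\<lambda>x. h x * \<phi> x)"
    proof -
      have "integrable (leb a b) (\<lambda>x. g x * \<phi> x)"
        using g test_function_DERIV(2)[OF \<phi>] by (rule integrable_mult_continuous)
      then have "integrable (leb a b) (\<lambda>x. h x * \<phi> x)"
        by (rule integrable_leb_AE_cong(1)[rotated]) (use h(4) in \<open>eventually_elim, simp\<close>)
      then have "integrable lebesgue (\<lambda>x. indicator {a<..<b} x * (h x * \<phi> x))" by (simp add: leb_integrable_iff_UNIV)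
      also have "(\<lambda>x. indicator {a<..<b} x * (h x * \<phi> x)) = (\<lambda>x. h x * \<phi> x)"
        using h(3) by (intro ext) (auto split: split_indicator)
      finally show ?thesis by (subst (asm) integrable_completion) auto
    qed
    have "integrable lborel (\<lambda>x. max 0 (h x) * \<phi> x)" "integrable lborel (\<lambda>x. max 0 (- h x) * \<phi> x)"
      by (auto intro!: Bochner_Integration.integrable_bound[OF \<phi>i] simp: abs_mult mult_right_mono)
    then have "(LINT x|Dp. \<phi> x) - (LINT x|Dn. \<phi> x) = (LINT x|lborel. max 0 (h x) * \<phi> x - max 0 (- h x) * \<phi> x)"
      unfolding Dp_def Dn_def by (simp add: integral_density)
    also have "\<dots> = (LINT x|lborel. h x * \<phi> x)"
      by (rule LINT_cong) (auto simp: max_def algebra_simps)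
    also have "\<dots> = (LINT x|lebesgue. h x * \<phi> x)"
      by (rule integral_completion[symmetric]) measurable
    also have "\<dots> = (LINT x|leb a b. h x * \<phi> x)"
      unfolding leb_LINT_UNIV using h(3) by (intro LINT_cong) (auto split: split_indicator)
    also have "\<dots> = (LINT x|leb a b. g x * \<phi> x)"
    proof (rule integral_cong_AE)
      show "AE x in leb a b. h x * \<phi> x = g x * \<phi> x" using h(4) by eventually_elim simp
      show "(\<lambda>x. g x * \<phi> x) \<in> borel_measurable (leb a b)"
        using integrable_mult_continuous[OF g test_function_DERIV(2)[OF \<phi>]] by simp
      show "(\<lambda>x. h x * \<phi> x) \<in> borel_measurable (leb a b)"
        by (rule measurable_restrict_space1, rule measurable_completion) simp
    qed
    finally show ?thesis using test[OF \<phi>] by (subst sum'[of "\<lambda>M. LINT x|M. \<phi> x"]) simp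
  qed
  have "AE x in leb c0 d0. g x \<le> 0" if "a < c0" "d0 < b" for c0 d0
  proof -
    define A where "A = {x. h x > 0} - Z"
    have Z': "Z \<in> sets borel" using Z(1) by (auto simp: null_sets_def)
    have A: "A \<in> sets borel" unfolding A_def using Z' by measurable
    have "(\<Sum>i<n+2. c' i * measure (M' i) (A \<inter> {c0<..<d0})) = 0"
      by (rule signed_measure_zero[OF fin' sets' test' that A])
    moreover have "measure (M i) (A \<inter> {c0<..<d0}) = 0" if "i < n" for i
    proof -
      have "emeasure (M i) (A \<inter> {c0<..<d0}) \<le> emeasure (M i) (- Z)"
        using Z' M[OF that] by (intro emeasure_mono) (auto simp: A_def)
      then show ?thesis using Z(2)[OF that] by (simp add: measure_def)
    qed
    moreover have "emeasure Dn (A \<inter> {c0<..<d0}) = 0"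
    proof -
      have "(\<lambda>x. ennreal (max 0 (- h x)) * indicator (A \<inter> {c0<..<d0}) x) = (\<lambda>x. 0)"
        by (auto simp: A_def max_def split: split_indicator)
      then show ?thesis using A unfolding Dn_def by (subst emeasure_density) simp_all
    qed
    ultimately have "measure Dp (A \<inter> {c0<..<d0}) = 0"
      using sum'[of "\<lambda>M. measure M (A \<inter> {c0<..<d0})"] by (simp add: measure_def)
    then have "emeasure Dp (A \<inter> {c0<..<d0}) = 0"
      by (simp add: finite_measure.emeasure_eq_measure[OF \<open>finite_measure Dp\<close>])
    then have "AE x in lborel. \<not> x \<in> A \<inter> {c0<..<d0} \<or> h x \<le> 0"
      using A by (auto simp: Dp_def emeasure_density nn_integral_0_iff_AE indicator_def max_def elim!: eventually_mono split: if_splits)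
    moreover have "AE x in lborel. x \<notin> Z" using Z(1) by (rule AE_not_in)
    ultimately have "AE x in lborel. x \<in> {c0<..<d0} \<longrightarrow> h x \<le> 0"
      by eventually_elim (auto simp: A_def)
    then have "AE x in leb c0 d0. h x \<le> 0" unfolding AE_leb by (rule AE_completion)
    moreover have "AE x in leb c0 d0. g x = h x" using h(4) by (rule AE_leb_subset) (use that in auto)
    ultimately show ?thesis by eventually_elim simp
  qed
  \<comment> \<open>The measures were compared only strictly inside (a,b); countably many such
    windows exhaust the interval.\<close>
  then have "AE x in lebesgue. x \<in> {a + 1 / Suc k<..<b - 1 / Suc k} \<longrightarrow> g x \<le> 0" for k
    by (simp add: AE_leb)
  then have "AE x in lebesgue. \<forall>k. x \<in> {a + 1 / Suc k<..<b - 1 / Suc k} \<longrightarrow> g x \<le> 0"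
    unfolding AE_all_countable by blast
  then show ?thesis unfolding AE_leb
  proof eventually_elim
    case (elim x)
    show ?case
    proof
      assume "x \<in> {a<..<b}"
      then have "0 < min (x - a) (b - x)" by auto
      then obtain k where "1 / real (Suc k) < min (x - a) (b - x)" using nat_approx_posE by metis
      then have "x \<in> {a + 1 / real (Suc k)<..<b - 1 / real (Suc k)}" by auto
      then show "g x \<le> 0" using elim by blast
    qed
  qed
qed

lemma distribution_zero:
  fixes M :: "nat \<Rightarrow> real measure" and c :: "nat \<Rightarrow> real"
  assumes fin: "\<And>i. i < n \<Longrightarrow> finite_measure (M i)" and M: "\<And>i. i < n \<Longrightarrow> sets (M i) = sets borel"
    and Z: "Z \<in> null_sets lborel" "\<And>i. i < n \<Longrightarrow> emeasure (M i) (- Z) = 0"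
    and g: "integrable (leb a b) g"
    and test: "\<And>\<phi>. test_function a b \<phi> \<Longrightarrow>
       (LINT x|leb a b. g x * \<phi> x) + (\<Sum>i<n. c i * (LINT x|M i. \<phi> x)) = 0"
  shows "AE x in leb a b. g x = 0"
proof -
  have "AE x in leb a b. g x \<le> 0"
    by (rule distribution_zero_le[OF fin M Z g test])
  moreover have "AE x in leb a b. - g x \<le> 0"
  proof (rule distribution_zero_le[OF fin M Z, where c = "\<lambda>i. - c i"])
    fix \<phi> assume "test_function a b \<phi>"
    from test[OF this] show "(LINT x|leb a b. - g x * \<phi> x) + (\<Sum>i<n. - c i * (LINT x|M i. \<phi> x)) = 0"
      by (simp add: sum_negf)
  qed (use g in auto)
  ultimately show ?thesis by eventually_elim simp
qed

section \<open>The du Bois-Reymond lemma: functions with a given weak derivative\<close>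

lemma test_function_antiderivative:
  assumes "test_function a b \<psi>" "a < b" "(LINT x|leb a b. \<psi> x) = 0"
  obtains \<phi> where "test_function a b \<phi>" "deriv \<phi> = \<psi>"
proof -
  obtain c d where cd: "a < c" "c \<le> d" "d < b" "\<And>x. x \<notin> {c<..<d} \<Longrightarrow> \<psi> x = 0"
    using test_functionE[OF assms(1,2)] by metis
  have cont: "continuous_on S \<psi>" for S by (rule test_function_DERIV(2)[OF assms(1)])
  have int: "\<psi> integrable_on {p..q}" for p q by (intro integrable_continuous_interval cont)
  have "\<exists>F. \<forall>x. (F has_real_derivative \<psi> x) (at x)"
  proof (rule exI, rule allI)
    fix x :: real
    \<comment> \<open>An integral over \<open>{x..c}\<close> with c < x is 0, so this difference is
      the oriented integral from c to x on both sides of c.\<close>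
    show "((\<lambda>x. integral {c..x} \<psi> - integral {x..c} \<psi>) has_real_derivative \<psi> x) (at x)"
    proof -
      define p q where "p = min c x - 1" and "q = x + 1"
      have "((\<lambda>u. integral {p..u} \<psi>) has_real_derivative \<psi> x) (at x within {p..q})"
        by (rule integral_has_real_derivative) (use cont in \<open>auto simp: p_def q_def\<close>)
      then have "((\<lambda>u. integral {p..u} \<psi>) has_real_derivative \<psi> x) (at x)"
        by (subst (asm) at_within_interior) (auto simp: p_def q_def)
      then have "((\<lambda>u. integral {p..u} \<psi> - integral {p..c} \<psi>) has_real_derivative \<psi> x) (at x)"
        by (auto intro!: derivative_eq_intros)
      then show ?thesis
      proof (rule has_field_derivative_transform_within_open[where S = "{p<..}"])
        fix u assume u: "u \<in> {p<..}"
        show "integral {p..u} \<psi> - integral {p..c} \<psi> = integral {c..u} \<psi> - integral {u..c} \<psi>"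
        proof (cases "c \<le> u")
          case True
          then have "integral {p..c} \<psi> + integral {c..u} \<psi> = integral {p..u} \<psi>"
            using int by (intro Henstock_Kurzweil_Integration.integral_combine) (auto simp: p_def)
          moreover have "integral {u..c} \<psi> = 0" using True by (cases "u = c") auto
          ultimately show ?thesis by simp
        next
          case False
          then have "integral {p..u} \<psi> + integral {u..c} \<psi> = integral {p..c} \<psi>"
            using int u by (intro Henstock_Kurzweil_Integration.integral_combine) auto
          then show ?thesis using False by simp
        qed
      qed (auto simp: p_def)
    qed
  qed
  then obtain F where F: "\<And>x. (F has_real_derivative \<psi> x) (at x)" by blast
  define \<phi> where "\<phi> x = F x - F c" for x
  have D: "(\<phi> has_real_derivative \<psi> x) (at x)" for x
    unfolding \<phi>_def using F by (auto intro!: derivative_eq_intros)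
  have FTC: "integral {p..q} \<psi> = \<phi> q - \<phi> p" if "p \<le> q" for p q
    using D that by (intro integral_unique fundamental_theorem_of_calculus)
      (auto simp: has_real_derivative_iff_has_vector_derivative[symmetric] has_field_derivative_at_within)
  have zero: "integral {p..q} \<psi> = 0" if "q \<le> c \<or> d \<le> p" for p q
  proof -
    have "integral {p..q} \<psi> = integral {p..q} (\<lambda>_. 0)"
      using that cd(4) by (intro HK_integral_cong) auto
    then show ?thesis by simp
  qed
  have left: "\<phi> x = 0" if "x \<le> c" for x
    using FTC[OF that] zero[of c x] by (simp add: \<phi>_def)
  have "integral {a..b} \<psi> = 0" using assms(3) leb_LINT[OF leb_continuous[OF cont]] by simp
  then have "\<phi> b = 0" using FTC[of a b] left[of a] assms(2) cd by simp
  then have d: "\<phi> d = 0" using FTC[of d b] zero[of b d] cd by simp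
  have right: "\<phi> x = 0" if "d \<le> x" for x
    using FTC[OF that] zero[of x d] d by simp
  have "test_function a b \<phi>"
  proof (rule test_functionI[of _ c d])
    show "ndiff n \<phi>" for n
    proof (cases n)
      case (Suc m)
      then show ?thesis using D test_function_smooth[OF assms(1)] by (auto intro!: exI[of _ \<psi>])
    qed simp
  qed (use left right cd in auto)
  moreover have "deriv \<phi> = \<psi>" using D by (auto intro!: ext DERIV_imp_deriv)
  ultimately show ?thesis using that by blast
qed

text \<open>Subtracting the primitive leaves a function U with weak derivative zero. Every test
  function minus the right multiple of a fixed bump has mean zero, hence is the derivative of a test
  function; so U tests like a constant.\<close>

lemma weak_deriv_imp_prim:
  assumes "a < b" "integrable (leb a b) u" "integrable (leb a b) g" "weak_deriv a b u g"
  obtains c where "AE x in leb a b. u x = c + prim a g x"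
proof -
  define U where "U x = u x - prim a g x" for x
  have U: "integrable (leb a b) U" unfolding U_def
    using assms integrable_prim by auto
  have U0: "(LINT x|leb a b. U x * deriv \<phi> x) = 0" if \<phi>: "test_function a b \<phi>" for \<phi>
  proof -
    have "(LINT x|leb a b. U x * deriv \<phi> x) = (LINT x|leb a b. u x * deriv \<phi> x - prim a g x * deriv \<phi> x)"
      by (simp add: U_def left_diff_distrib)
    also have "\<dots> = (LINT x|leb a b. u x * deriv \<phi> x) - (LINT x|leb a b. prim a g x * deriv \<phi> x)"
      using assms integrable_prim[OF assms(3)] test_function_DERIV(3)[OF \<phi>]
      by (intro Bochner_Integration.integral_diff integrable_mult_continuous)
    also have "\<dots> = 0"
      using assms(4) \<phi> prim_by_parts[OF assms(3) \<phi> assms(1)] unfolding weak_deriv_def by simp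
    finally show ?thesis .
  qed
  \<comment> \<open>The thirds only provide an interval strictly inside (a,b) as support of the
    reference bump.\<close>
  define p q where "p = (2 * a + b) / 3" and "q = (a + 2 * b) / 3"
  have pq: "a < p" "p < q" "q < b" using assms(1) by (auto simp: p_def q_def)
  have t0: "test_function a b (bump p q)"
    by (rule test_functionI[of _ p q]) (use pq ndiff_bump in \<open>auto simp: bump_zero\<close>)
  define I where "I = (LINT x|leb a b. bump p q x)"
  have "I > 0"
  proof -
    have c: "continuous_on S (bump p q)" for S by (rule test_function_DERIV(2)[OF t0])
    have "I \<noteq> 0"
    proof
      assume "I = 0"
      then have "AE x in leb a b. bump p q x = 0"
        unfolding I_def using leb_continuous[OF c] bump_nonneg by (subst (asm) integral_nonneg_eq_0_iff_AE) auto
      then have "AE x in lebesgue. x \<notin> {p<..<q}"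
        unfolding AE_leb by eventually_elim (use bump_pos[of p _ q] pq in force)
      then have "{p<..<q} \<in> null_sets lebesgue" by (subst AE_iff_null_sets) auto
      then have "emeasure lebesgue {p<..<q} = 0" by (rule null_setsD1)
      then show False using pq by simp
    qed
    moreover have "I \<ge> 0" unfolding I_def using bump_nonneg by (intro Bochner_Integration.integral_nonneg) auto
    ultimately show ?thesis by simp
  qed
  \<comment> \<open>The only candidate for the constant: the mean of U weighted by the bump.\<close>
  define c where "c = (LINT x|leb a b. U x * bump p q x) / I"
  \<comment> \<open>With \<open>n = 0\<close> there are no singular measures, and only the density
    is tested.\<close>
  have "AE x in leb a b. U x - c = 0"
  proof (rule distribution_zero[where n = 0 and Z = "{}"])
    show "integrable (leb a b) (\<lambda>x. U x - c)"
      by (intro Bochner_Integration.integrable_diff U finite_measure.integrable_const finite_measure_leb)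
    fix \<psi> assume \<psi>: "test_function a b \<psi>"
    define k where "k = (LINT x|leb a b. \<psi> x) / I"
    define \<theta> where "\<theta> x = \<psi> x - k * bump p q x" for x
    have "test_function a b \<theta>"
    proof -
      obtain r s where rs: "a < r" "r \<le> s" "s < b" "\<And>x. x \<notin> {r<..<s} \<Longrightarrow> \<psi> x = 0"
        using test_functionE[OF \<psi> assms(1)] by metis
      have n: "ndiff n (\<lambda>x. \<psi> x + (- k) * bump p q x)" for n
        by (intro ndiff_add ndiff_mult ndiff_const ndiff_bump test_function_smooth[OF \<psi>])
      have out: "\<psi> x = k * bump p q x" if "x \<notin> {min r p..max s q}" for x
      proof -
        have "\<psi> x = 0" using that by (intro rs(4)) auto
        moreover have "bump p q x = 0" using that by (intro bump_zero) auto
        ultimately show ?thesis by simp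
      qed
      show ?thesis
        by (rule test_functionI[of _ "min r p" "max s q"]) (use n rs(1,3) pq out in \<open>auto simp: \<theta>_def[abs_def]\<close>)
    qed
    have i: "integrable (leb a b) \<psi>" "integrable (leb a b) (bump p q)"
      "integrable (leb a b) (\<lambda>x. U x * \<psi> x)" "integrable (leb a b) (\<lambda>x. U x * bump p q x)"
      by (rule leb_continuous integrable_mult_continuous[OF U] test_function_DERIV(2)[OF \<psi>] test_function_DERIV(2)[OF t0])+
    have "(LINT x|leb a b. \<theta> x) = (LINT x|leb a b. \<psi> x) - k * I"
      unfolding \<theta>_def I_def using i by simp
    then have "(LINT x|leb a b. \<theta> x) = 0" using \<open>I > 0\<close> by (simp add: k_def)
    then obtain \<phi> where "test_function a b \<phi>" "deriv \<phi> = \<theta>"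
      using test_function_antiderivative \<open>test_function a b \<theta>\<close> assms(1) by metis
    then have "0 = (LINT x|leb a b. U x * \<theta> x)" using U0[of \<phi>] by simp
    also have "\<dots> = (LINT x|leb a b. U x * \<psi> x - k * (U x * bump p q x))"
      by (rule LINT_cong) (auto simp: \<theta>_def algebra_simps)
    also have "\<dots> = (LINT x|leb a b. U x * \<psi> x) - k * (c * I)"
      using i \<open>I > 0\<close> by (simp add: c_def)
    also have "\<dots> = (LINT x|leb a b. U x * \<psi> x) - (LINT x|leb a b. c * \<psi> x)"
      using \<open>I > 0\<close> by (simp add: k_def)
    also have "\<dots> = (LINT x|leb a b. (U x - c) * \<psi> x)"
      using i by (subst Bochner_Integration.integral_diff[symmetric]) (auto simp: left_diff_distrib)
    finally show "(LINT x|leb a b. (U x - c) * \<psi> x) + (\<Sum>i<0. (\<lambda>_. 0) i * (LINT x|(\<lambda>_. lborel) i. \<psi> x)) = 0" by simp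
  qed auto
  then have "AE x in leb a b. u x = c + prim a g x" by eventually_elim (simp add: U_def)
  then show ?thesis using that by blast
qed

section \<open>Jumps, one-sided limits and absolutely continuous parts\<close>

text \<open>Left-continuous by the choice of \<open>{t<..}\<close>: the jump at t is not yet counted
  at t, so the value at a node is the left limit.\<close>

abbreviation step :: "real set \<Rightarrow> (real \<Rightarrow> real) \<Rightarrow> real \<Rightarrow> real" where
  "step T A x \<equiv> \<Sum>t\<in>T. A t * indicator {t<..} x"

lemma step_measurable: "step T A \<in> borel_measurable borel"
  by (intro borel_measurable_sum borel_measurable_times borel_measurable_const borel_measurable_indicator) auto

lemma step_measurable_leb: "step T A \<in> borel_measurable (leb a b)"
  by (rule measurable_restrict_space1, rule measurable_completion) (use step_measurable in simp)

lemma step_bound: "\<bar>step T A x\<bar> \<le> (\<Sum>t\<in>T. \<bar>A t\<bar>)"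
proof -
  have "\<bar>step T A x\<bar> \<le> (\<Sum>t\<in>T. \<bar>A t * indicator {t<..} x\<bar>)" by (rule sum_abs)
  also have "\<dots> \<le> (\<Sum>t\<in>T. \<bar>A t\<bar>)" by (rule sum_mono) (auto simp: abs_mult split: split_indicator)
  finally show ?thesis .
qed

lemma integrable_step: "integrable (leb a b) (step T A)"
  by (rule leb_bounded[OF step_measurable_leb step_bound])

text \<open>A \<open>point_measure\<close> on T knows only the subsets of T; pushing it forward to
  the Borel sets gives the kind of measure that \<open>is_ac_deriv\<close> asks for.\<close>

definition point_masses :: "real set \<Rightarrow> (real \<Rightarrow> real) \<Rightarrow> real measure" where
  "point_masses T p = distr (point_measure T (\<lambda>t. ennreal (p t))) borel (\<lambda>x. x)"

lemma point_masses:
  assumes "finite T" "\<And>t. 0 \<le> p t"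
  shows "finite_measure (point_masses T p)" "sets (point_masses T p) = sets borel"
    "emeasure (point_masses T p) (- T) = 0"
    "\<phi> \<in> borel_measurable borel \<Longrightarrow> (LINT x|point_masses T p. \<phi> x) = (\<Sum>t\<in>T. p t * \<phi> t)"
proof -
  have m: "(\<lambda>x. x) \<in> measurable (point_measure T (\<lambda>t. ennreal (p t))) borel"
    by (simp add: measurable_def space_point_measure sets_point_measure)
  show "sets (point_masses T p) = sets borel" by (simp add: point_masses_def)
  have T: "T \<in> sets borel" using assms(1) by (simp add: finite_imp_closed borel_closed)
  then show "emeasure (point_masses T p) (- T) = 0"
    unfolding point_masses_def by (subst emeasure_distr[OF m]) (auto simp: space_point_measure)
  have "emeasure (point_masses T p) (space (point_masses T p)) = (\<Sum>t\<in>T. ennreal (p t))"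
    unfolding point_masses_def using assms(1)
    by (subst emeasure_distr[OF m]) (auto simp: space_point_measure emeasure_point_measure_finite)
  then show "finite_measure (point_masses T p)" using assms by (intro finite_measureI) (simp add: sum_ennreal)
  show "(LINT x|point_masses T p. \<phi> x) = (\<Sum>t\<in>T. p t * \<phi> t)" if "\<phi> \<in> borel_measurable borel"
    unfolding point_masses_def using that assms
    by (subst integral_distr[OF m]) (auto simp: lebesgue_integral_point_measure_finite)
qed

text \<open>The upward and the downward jumps become two nonnegative sums of point masses, and the
  finite set T is their Lebesgue-null carrier.\<close>

lemma is_ac_deriv_prim_step:
  assumes g: "integrable (leb a b) g" and "a < b" and T: "finite T" "T \<subseteq> {a<..<b}"
    and v: "AE x in leb a b. v x = c + prim a g x + step T A x"
  shows "is_ac_deriv a b v g"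
proof -
  have V: "integrable (leb a b) (\<lambda>x. c + prim a g x + step T A x)"
    by (intro Bochner_Integration.integrable_add integrable_prim g integrable_step
        finite_measure.integrable_const finite_measure_leb)
  define P N where "P = point_masses T (\<lambda>t. max 0 (A t))" and "N = point_masses T (\<lambda>t. max 0 (- A t))"
  note pm = point_masses[OF T(1), of "\<lambda>t. max 0 (A t)"] point_masses[OF T(1), of "\<lambda>t. max 0 (- A t)"]
  have test: "(LINT x|leb a b. v x * deriv \<phi> x) =
           - ((LINT x|leb a b. g x * \<phi> x) + (LINT x|P. \<phi> x) - (LINT x|N. \<phi> x))"
    if \<phi>: "test_function a b \<phi>" for \<phi>
  proof -
    have m: "\<phi> \<in> borel_measurable borel"
      using borel_measurable_continuous_onI[OF test_function_DERIV(2)[OF \<phi>]] .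
    have "(LINT x|leb a b. v x * deriv \<phi> x) = (LINT x|leb a b. (c + prim a g x + step T A x) * deriv \<phi> x)"
    proof (rule integral_cong_AE)
      show "AE x in leb a b. v x * deriv \<phi> x = (c + prim a g x + step T A x) * deriv \<phi> x"
        using v by eventually_elim simp
    qed (use integrable_leb_AE_cong(2)[OF v V] borel_measurable_integrable[OF V]
          borel_measurable_integrable[OF leb_continuous[OF test_function_DERIV(3)[OF \<phi>]]] in auto)
    also have "\<dots> = - ((LINT x|leb a b. g x * \<phi> x) + (\<Sum>t\<in>T. A t * \<phi> t))"
      by (rule integral_prim_step_test_deriv[OF g \<phi> \<open>a < b\<close> T])
    also have "(\<Sum>t\<in>T. A t * \<phi> t) = (LINT x|P. \<phi> x) - (LINT x|N. \<phi> x)"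
      unfolding P_def N_def pm(4)[OF _ m, simplified] pm(8)[OF _ m, simplified] sum_subtractf[symmetric]
      by (rule sum.cong) (auto simp: max_def)
    finally show ?thesis by (simp add: algebra_simps)
  qed
  show ?thesis
    unfolding is_ac_deriv_def
    using integrable_leb_AE_cong(1)[OF v V] g pm(1-3,5-7) test finite_imp_null_set_lborel[OF T(1)]
    by (intro conjI exI[of _ P] exI[of _ N] exI[of _ T]) (simp_all add: P_def N_def)
qed

text \<open>Subtracting two decompositions leaves a density plus four measures carried by the union
  of the two null sets, to which \<open>distribution_zero\<close> applies. This resolves the
  \<open>SOME\<close> in \<open>ac_deriv\<close> up to null sets.\<close>

lemma is_ac_deriv_unique:
  assumes "is_ac_deriv a b v g1" "is_ac_deriv a b v g2"
  shows "AE x in leb a b. g1 x = g2 x"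
proof -
  obtain P1 N1 Z1 where 1: "integrable (leb a b) g1" "finite_measure P1" "finite_measure N1" "sets P1 = sets borel"
    "sets N1 = sets borel" "Z1 \<in> null_sets lborel" "emeasure P1 (- Z1) = 0" "emeasure N1 (- Z1) = 0"
    "\<And>\<phi>. test_function a b \<phi> \<Longrightarrow> (LINT x|leb a b. v x * deriv \<phi> x) =
           - ((LINT x|leb a b. g1 x * \<phi> x) + (LINT x|P1. \<phi> x) - (LINT x|N1. \<phi> x))"
    using assms(1) unfolding is_ac_deriv_def by blast
  obtain P2 N2 Z2 where 2: "integrable (leb a b) g2" "finite_measure P2" "finite_measure N2" "sets P2 = sets borel"
    "sets N2 = sets borel" "Z2 \<in> null_sets lborel" "emeasure P2 (- Z2) = 0" "emeasure N2 (- Z2) = 0"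
    "\<And>\<phi>. test_function a b \<phi> \<Longrightarrow> (LINT x|leb a b. v x * deriv \<phi> x) =
           - ((LINT x|leb a b. g2 x * \<phi> x) + (LINT x|P2. \<phi> x) - (LINT x|N2. \<phi> x))"
    using assms(2) unfolding is_ac_deriv_def by blast
  have split4: "i = 0 \<or> i = 1 \<or> i = 2 \<or> i = 3" if "i < 4" for i :: nat using that by linarith
  have Zsub: "emeasure M (- (Z1 \<union> Z2)) = 0" if "sets M = sets borel" "emeasure M (- Z1) = 0 \<or> emeasure M (- Z2) = 0" for M
  proof -
    have s: "- Z1 \<in> sets M" "- Z2 \<in> sets M"
      using borel_comp[of Z1] borel_comp[of Z2] null_setsD2[OF 1(6)] null_setsD2[OF 2(6)] that(1) by simp_all
    from that(2) show ?thesis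
    proof
      assume "emeasure M (- Z1) = 0"
      moreover have "emeasure M (- (Z1 \<union> Z2)) \<le> emeasure M (- Z1)" using s by (intro emeasure_mono) auto
      ultimately show ?thesis by simp
    next
      assume "emeasure M (- Z2) = 0"
      moreover have "emeasure M (- (Z1 \<union> Z2)) \<le> emeasure M (- Z2)" using s by (intro emeasure_mono) auto
      ultimately show ?thesis by simp
    qed
  qed
  have "AE x in leb a b. g1 x - g2 x = 0"
  proof (rule distribution_zero[where n = 4 and M = "(!) [P1, N1, P2, N2]" and c = "(!) [1, -1, -1, 1]" and Z = "Z1 \<union> Z2"])
    fix i :: nat assume "i < 4"
    then have i: "i = 0 \<or> i = 1 \<or> i = 2 \<or> i = 3" by (rule split4)
    then show "finite_measure ([P1, N1, P2, N2] ! i)"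
      using 1(2,3) 2(2,3) by (elim disjE) simp_all
    show "sets ([P1, N1, P2, N2] ! i) = sets borel"
      using i 1(4,5) 2(4,5) by (elim disjE) simp_all
    show "emeasure ([P1, N1, P2, N2] ! i) (- (Z1 \<union> Z2)) = 0"
      using i Zsub[OF 1(4)] Zsub[OF 1(5)] Zsub[OF 2(4)] Zsub[OF 2(5)] 1(7,8) 2(7,8) by (elim disjE) simp_all
  next
    show "Z1 \<union> Z2 \<in> null_sets lborel" using 1(6) 2(6) by auto
    show "integrable (leb a b) (\<lambda>x. g1 x - g2 x)" using 1(1) 2(1) by auto
    fix \<phi> assume \<phi>: "test_function a b \<phi>"
    have "(LINT x|leb a b. (g1 x - g2 x) * \<phi> x) = (LINT x|leb a b. g1 x * \<phi> x) - (LINT x|leb a b. g2 x * \<phi> x)"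
      unfolding left_diff_distrib
      by (intro Bochner_Integration.integral_diff integrable_mult_continuous 1 2 test_function_DERIV(2)[OF \<phi>])
    moreover have "(\<Sum>i<4. [1, -1, -1, 1::real] ! i * f ([P1, N1, P2, N2] ! i)) = f P1 - f N1 - f P2 + f N2" for f
      by (simp add: numeral_eq_Suc lessThan_Suc)
    note this[of "\<lambda>M. LINT x|M. \<phi> x"]
    ultimately show "(LINT x|leb a b. (g1 x - g2 x) * \<phi> x) + (\<Sum>i<4. [1, -1, -1, 1] ! i * (LINT x|([P1, N1, P2, N2] ! i). \<phi> x)) = 0"
      using 1(9)[OF \<phi>] 2(9)[OF \<phi>] by simp
  qed
  then show ?thesis by eventually_elim simp
qed

lemma ac_deriv_AE:
  assumes "integrable (leb a b) g" "a < b" "finite T" "T \<subseteq> {a<..<b}"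
    "AE x in leb a b. v x = c + prim a g x + step T A x"
  shows "AE x in leb a b. ac_deriv a b v x = g x"
proof -
  have "is_ac_deriv a b v g" by (rule is_ac_deriv_prim_step[OF assms])
  moreover from this have "is_ac_deriv a b v (ac_deriv a b v)"
    unfolding ac_deriv_def by (rule someI[of "is_ac_deriv a b v"])
  ultimately show ?thesis by (intro is_ac_deriv_unique)
qed

text \<open>Every right neighbourhood of x contains an interval of positive measure, so P cannot
  fail throughout it. An almost-everywhere property need not hold eventually, so limits are compared
  along points where it holds frequently.\<close>

lemma AE_frequently_at_right:
  assumes "AE y in leb a b. P y" "a \<le> x" "x < b"
  shows "\<exists>\<^sub>F y in at_right x. P y"
  unfolding frequently_def
proof
  assume "\<forall>\<^sub>F y in at_right x. \<not> P y"
  then obtain e where e: "e > x" "\<And>y. x < y \<Longrightarrow> y < e \<Longrightarrow> \<not> P y"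
    unfolding eventually_at_right_field by blast
  have "AE y in lebesgue. y \<notin> {x<..<min e b}"
    using assms(1) unfolding AE_leb by eventually_elim (use e assms(2) in auto)
  then have "{x<..<min e b} \<in> null_sets lebesgue" by (subst AE_iff_null_sets) auto
  then have "emeasure lebesgue {x<..<min e b} = 0" by (rule null_setsD1)
  then show False using e assms(3) by (simp split: if_splits)
qed

lemma AE_frequently_at_left:
  assumes "AE y in leb a b. P y" "a < x" "x \<le> b"
  shows "\<exists>\<^sub>F y in at_left x. P y"
  unfolding frequently_def
proof
  assume "\<forall>\<^sub>F y in at_left x. \<not> P y"
  then obtain e where e: "e < x" "\<And>y. e < y \<Longrightarrow> y < x \<Longrightarrow> \<not> P y"
    unfolding eventually_at_left_field by blast
  have "AE y in lebesgue. y \<notin> {max e a<..<x}"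
    using assms(1) unfolding AE_leb by eventually_elim (use e assms(3) in auto)
  then have "{max e a<..<x} \<in> null_sets lebesgue" by (subst AE_iff_null_sets) auto
  then have "emeasure lebesgue {max e a<..<x} = 0" by (rule null_setsD1)
  then show False using e assms(2) by (simp split: if_splits)
qed

lemma tendsto_le_frequently:
  fixes u v :: "real \<Rightarrow> real"
  assumes "(u \<longlongrightarrow> l) F" "(v \<longlongrightarrow> m) F" "\<exists>\<^sub>F y in F. u y \<le> v y"
  shows "l \<le> m"
proof (rule ccontr)
  assume "\<not> l \<le> m"
  then have "((\<lambda>y. u y - v y) \<longlongrightarrow> l - m) F" "l - m > 0" using assms by (auto intro: tendsto_diff)
  then have "\<forall>\<^sub>F y in F. u y - v y > 0" by (rule order_tendstoD(1))
  then have "\<forall>\<^sub>F y in F. \<not> u y \<le> v y" by eventually_elim simp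
  then show False using assms(3) by (simp add: frequently_def)
qed

lemma tendsto_eq_frequently:
  fixes u v :: "real \<Rightarrow> real"
  assumes "(u \<longlongrightarrow> l) F" "(v \<longlongrightarrow> m) F" "\<exists>\<^sub>F y in F. u y = v y"
  shows "l = m"
  using tendsto_le_frequently[OF assms(1,2) frequently_elim1[OF assms(3)]]
    tendsto_le_frequently[OF assms(2,1) frequently_elim1[OF assms(3)]] by fastforce

lemma continuous_on_at_right:
  fixes C :: "real \<Rightarrow> real"
  assumes "continuous_on {a..b} C" "a \<le> x" "x < b" shows "(C \<longlongrightarrow> C x) (at_right x)"
proof -
  have "(C \<longlongrightarrow> C x) (at x within {x..b})"
    by (rule tendsto_within_subset[where S = "{a..b}"]) (use assms in \<open>auto simp: continuous_on_def\<close>)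
  then show ?thesis using assms(3) by (simp add: at_within_Icc_at_right)
qed

lemma continuous_on_at_left:
  fixes C :: "real \<Rightarrow> real"
  assumes "continuous_on {a..b} C" "a < x" "x \<le> b" shows "(C \<longlongrightarrow> C x) (at_left x)"
proof -
  have "(C \<longlongrightarrow> C x) (at x within {a..x})"
    by (rule tendsto_within_subset[where S = "{a..b}"]) (use assms in \<open>auto simp: continuous_on_def\<close>)
  then show ?thesis using assms(2) by (simp add: at_within_Icc_at_left)
qed

lemma step_at_right:
  assumes "continuous_on {a..b} C" "a \<le> x" "x < b"
  shows "((\<lambda>y. C y + step T A y) \<longlongrightarrow> C x + (\<Sum>t\<in>T. A t * indicator {t..} x)) (at_right x)"
proof (intro tendsto_add continuous_on_at_right[OF assms] tendsto_sum tendsto_mult tendsto_const)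
  fix t
  have "\<forall>\<^sub>F y in at_right x. indicat_real {t<..} y = indicator {t..} x"
  proof (cases "t \<le> x")
    case True
    then show ?thesis by (auto simp: eventually_at_filter indicator_def)
  next
    case False
    then have "\<forall>\<^sub>F y in at_right x. y < t" by (intro eventually_at_right_less[THEN eventually_mono] order_tendstoD(2)[OF tendsto_ident_at]) auto
    then show ?thesis by eventually_elim (use False in auto)
  qed
  then show "(indicat_real {t<..} \<longlongrightarrow> indicator {t..} x) (at_right x)" by (rule tendsto_eventually)
qed

lemma step_at_left:
  assumes "continuous_on {a..b} C" "a < x" "x \<le> b"
  shows "((\<lambda>y. C y + step T A y) \<longlongrightarrow> C x + step T A x) (at_left x)"
proof (intro tendsto_add continuous_on_at_left[OF assms] tendsto_sum tendsto_mult tendsto_const)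
  fix t
  have "\<forall>\<^sub>F y in at_left x. indicat_real {t<..} y = indicator {t<..} x"
  proof (cases "t < x")
    case True
    then have "\<forall>\<^sub>F y in at_left x. t < y" by (intro order_tendstoD(1)[OF tendsto_ident_at])
    then show ?thesis by eventually_elim (use True in auto)
  next
    case False
    then show ?thesis by (auto simp: eventually_at_filter indicator_def)
  qed
  then show "(indicat_real {t<..} \<longlongrightarrow> indicator {t<..} x) (at_left x)" by (rule tendsto_eventually)
qed

lemma step_right_minus_left:
  "finite T \<Longrightarrow> (\<Sum>t\<in>T. A t * indicator {t..} x) = step T A x + (if x \<in> T then A x else 0)"
proof -
  assume "finite T"
  have "(\<Sum>t\<in>T. A t * indicator {t..} x) = (\<Sum>t\<in>T. A t * indicator {t<..} x + (if t = x then A x else 0))"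
    by (rule sum.cong) (auto split: split_indicator)
  also have "\<dots> = step T A x + (if x \<in> T then A x else 0)"
    using \<open>finite T\<close> by (simp add: sum.distrib)
  finally show ?thesis .
qed

section \<open>Jumps and one-sided limits of a continuous function plus a step function\<close>

context
  fixes a b :: real and C A v :: "real \<Rightarrow> real" and T :: "real set"
  assumes C: "continuous_on {a..b} C" and T: "finite T" "T \<subseteq> {a<..<b}"
    and v: "AE x in leb a b. v x = C x + step T A x"
begin

lemma representative_step: "representative a b v (\<lambda>x. C x + step T A x)"
  using v unfolding representative_def by eventually_elim simp

lemma isCont_step:
  assumes "x \<in> {a<..<b}" "x \<notin> {t \<in> T. A t \<noteq> 0}"
  shows "isCont (\<lambda>x. C x + step T A x) x"
proof -
  have "(\<Sum>t\<in>T. A t * indicator {t..} x) = step T A x"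
    using step_right_minus_left[OF T(1), of A x] assms(2) by auto
  then show ?thesis
    using step_at_right[OF C, where x = x and T = T and A = A] step_at_left[OF C, where x = x and T = T and A = A] assms(1)
    unfolding isCont_def by (intro filterlim_split_at) auto
qed

text \<open>A representative continuous at a node with nonzero jump would agree with the step
  representative at points arbitrarily close on both sides, forcing the two different one-sided
  limits to coincide.\<close>

lemma jump_set_step: "jump_set a b v = {t \<in> T. A t \<noteq> 0}"
proof -
  have "\<not> isCont u x" if u: "representative a b v u" and x: "x \<in> T" "A x \<noteq> 0" for u x
  proof
    assume c: "isCont u x"
    have xab: "a < x" "x < b" using x T by auto
    have ae: "AE y in leb a b. u y = C y + step T A y"
      using u v unfolding representative_def by eventually_elim simp
    have "u x = C x + (\<Sum>t\<in>T. A t * indicator {t..} x)"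
      using c xab AE_frequently_at_right[OF ae, of x] unfolding isCont_def
      by (intro tendsto_eq_frequently[OF _ step_at_right[OF C]]) (auto intro: tendsto_mono[OF at_le[OF subset_UNIV]])
    moreover have "u x = C x + step T A x"
      using c xab AE_frequently_at_left[OF ae, of x] unfolding isCont_def
      by (intro tendsto_eq_frequently[OF _ step_at_left[OF C]]) (auto intro: tendsto_mono[OF at_le[OF subset_UNIV]])
    ultimately show False using x step_right_minus_left[OF T(1), of A x] by simp
  qed
  then show ?thesis
    using isCont_step representative_step T(2) unfolding jump_set_def by blast
qed

text \<open>The \<open>THE\<close> is well defined because any two representatives agree frequently
  to the right of x.\<close>

lemma right_lim_step:
  assumes "a \<le> x" "x < b"
  shows "right_lim a b v x = C x + (\<Sum>t\<in>T. A t * indicator {t..} x)"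
  unfolding right_lim_def
proof (rule the_equality)
  show "\<exists>u. representative a b v u \<and> (u \<longlongrightarrow> C x + (\<Sum>t\<in>T. A t * indicator {t..} x)) (at_right x)"
    using representative_step step_at_right[OF C assms] by blast
  fix y assume "\<exists>u. representative a b v u \<and> (u \<longlongrightarrow> y) (at_right x)"
  then obtain u where u: "representative a b v u" "(u \<longlongrightarrow> y) (at_right x)" by blast
  have ae: "AE y in leb a b. u y = C y + step T A y"
    using u(1) v unfolding representative_def by eventually_elim simp
  show "y = C x + (\<Sum>t\<in>T. A t * indicator {t..} x)"
    by (rule tendsto_eq_frequently[OF u(2) step_at_right[OF C assms] AE_frequently_at_right[OF ae assms]])
qed

lemma left_lim_step:
  assumes "a < x" "x \<le> b"
  shows "left_lim a b v x = C x + step T A x"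
  unfolding left_lim_def
proof (rule the_equality)
  show "\<exists>u. representative a b v u \<and> (u \<longlongrightarrow> C x + step T A x) (at_left x)"
    using representative_step step_at_left[OF C assms] by blast
  fix y assume "\<exists>u. representative a b v u \<and> (u \<longlongrightarrow> y) (at_left x)"
  then obtain u where u: "representative a b v u" "(u \<longlongrightarrow> y) (at_left x)" by blast
  have ae: "AE y in leb a b. u y = C y + step T A y"
    using u(1) v unfolding representative_def by eventually_elim simp
  show "y = C x + step T A x"
    by (rule tendsto_eq_frequently[OF u(2) step_at_left[OF C assms] AE_frequently_at_left[OF ae assms]])
qed

lemma point_value_step:
  assumes "x \<in> {a<..<b}" "x \<notin> jump_set a b v"
  shows "point_value a b v x = C x + step T A x"
  unfolding point_value_def
proof (rule the_equality)
  show "\<exists>u. representative a b v u \<and> isCont u x \<and> u x = C x + step T A x"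
    using representative_step isCont_step assms unfolding jump_set_step by blast
  fix y assume "\<exists>u. representative a b v u \<and> isCont u x \<and> u x = y"
  then obtain u where u: "representative a b v u" "isCont u x" "u x = y" by blast
  have ae: "AE y in leb a b. u y = C y + step T A y"
    using u(1) v unfolding representative_def by eventually_elim simp
  have "(u \<longlongrightarrow> y) (at_left x)"
    using u(2,3) unfolding isCont_def by (auto intro: tendsto_mono[OF at_le[OF subset_UNIV]])
  then show "y = C x + step T A x"
    by (rule tendsto_eq_frequently[OF _ step_at_left[OF C] AE_frequently_at_left[OF ae]]) (use assms in auto)
qed

end

text \<open>An almost-everywhere inequality survives convex combinations and pointwise limits,
  unlike a condition tied to the jump points of each function. The finitely many nodes form a null
  set and are left out.\<close>

lemma above_obstacle_imp_AE:
  assumes "continuous_on {-2..2} C" "finite T" "T \<subseteq> {-2<..<2}"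
    "AE x in leb (-2) 2. v x = C x + step T A x" "above_obstacle w v"
  shows "AE x in leb (-1) 1. w x \<le> v x"
proof -
  have "AE x in leb (-1) 1. x \<notin> T" by (rule AE_leb_finite[OF assms(2)])
  moreover have "AE x in leb (-1) 1. v x = C x + step T A x"
    using assms(4) by (rule AE_leb_subset) auto
  moreover have pt: "w x \<le> C x + step T A x" if "x \<in> {-1<..<1}" "x \<notin> T" for x
  proof -
    have j: "x \<notin> jump_set (-2) 2 v" using that(2) jump_set_step[OF assms(1-4)] by blast
    then have "w x \<le> point_value (-2) 2 v x" using assms(5) that(1) unfolding above_obstacle_def by auto
    then show ?thesis using point_value_step[OF assms(1-4) _ j] that(1) by auto
  qed
  ultimately show ?thesis unfolding AE_leb by eventually_elim (use pt in auto)
qed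

text \<open>All point values and one-sided limits are limits along points where the inequality
  holds. It is required on the whole of (-2,2) because, if -1 or 1 is a jump point, the left limit
  at -1 or the right limit at 1 is taken from outside [-1,1].\<close>

lemma AE_imp_above_obstacle:
  assumes C: "continuous_on {-2..2} C" and T: "finite T" "T \<subseteq> {-2<..<2}"
    and v: "AE x in leb (-2) 2. v x = C x + step T A x"
    and w: "continuous_on {-2..2} w" "AE x in leb (-2) 2. w x \<le> v x"
  shows "above_obstacle w v"
proof -
  note step = C T v
  have ae: "AE x in leb (-2) 2. w x \<le> C x + step T A x"
    using v w(2) by eventually_elim simp
  have right: "w x \<le> C x + (\<Sum>t\<in>T. A t * indicator {t..} x)" if "-2 \<le> x" "x < 2" for x
    by (rule tendsto_le_frequently[OF continuous_on_at_right[OF w(1) that] step_at_right[OF C that]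
          AE_frequently_at_right[OF ae that]])
  have left: "w x \<le> C x + step T A x" if "-2 < x" "x \<le> 2" for x
    by (rule tendsto_le_frequently[OF continuous_on_at_left[OF w(1) that] step_at_left[OF C that]
          AE_frequently_at_left[OF ae that]])
  have J: "jump_set (-2) 2 v \<subseteq> {-2<..<2}" by (auto simp: jump_set_def)
  show ?thesis
    unfolding above_obstacle_def
  proof (intro conjI ballI)
    fix x :: real assume "x \<in> {-1..1} - jump_set (-2) 2 v"
    then show "w x \<le> point_value (-2) 2 v x" using point_value_step[OF step, of x] left[of x] by auto
  next
    fix x assume "x \<in> jump_set (-2) 2 v \<union> {-1}"
    then have "-2 \<le> x" "x < 2" using J by auto
    then show "w x \<le> right_lim (-2) 2 v x" using right_lim_step[OF step, of x] right[of x] by simp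
  next
    fix x assume "x \<in> jump_set (-2) 2 v \<union> {1}"
    then have "-2 < x" "x \<le> 2" using J by auto
    then show "w x \<le> left_lim (-2) 2 v x" using left_lim_step[OF step, of x] left[of x] by simp
  qed
qed

section \<open>Functions with prescribed second derivative and nodes\<close>

lemma L2_iff: "u \<in> L2 a b \<longleftrightarrow> u \<in> borel_measurable (leb a b) \<and> integrable (leb a b) (\<lambda>x. (u x)\<^sup>2)"
  by (simp add: L2_def)

lemma leb_integrable_const [simp]: "integrable (leb a b) (\<lambda>x. c :: real)"
  by (intro finite_measure.integrable_const finite_measure_leb)

lemma L2_integrable_mult:
  assumes "u \<in> L2 a b" "v \<in> L2 a b"
  shows "integrable (leb a b) (\<lambda>x. u x * v x)"
proof (rule Bochner_Integration.integrable_bound)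
  show "integrable (leb a b) (\<lambda>x. (u x)\<^sup>2 + (v x)\<^sup>2)" using assms by (simp add: L2_iff)
  show "(\<lambda>x. u x * v x) \<in> borel_measurable (leb a b)" using assms by (auto simp: L2_iff)
  show "AE x in leb a b. norm (u x * v x) \<le> norm ((u x)\<^sup>2 + (v x)\<^sup>2)"
  proof (rule AE_I2)
    fix x
    have "2 * \<bar>u x\<bar> * \<bar>v x\<bar> \<le> (u x)\<^sup>2 + (v x)\<^sup>2"
      using sum_squares_bound[of "\<bar>u x\<bar>" "\<bar>v x\<bar>"] by simp
    moreover have "0 \<le> \<bar>u x\<bar> * \<bar>v x\<bar>" by simp
    ultimately have "\<bar>u x\<bar> * \<bar>v x\<bar> \<le> (u x)\<^sup>2 + (v x)\<^sup>2" by (simp only: mult.assoc)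
    then show "norm (u x * v x) \<le> norm ((u x)\<^sup>2 + (v x)\<^sup>2)" by (simp add: abs_mult)
  qed
qed

lemma L2_const: "(\<lambda>x. c) \<in> L2 a b" by (simp add: L2_iff)

lemma L2_integrable: "u \<in> L2 a b \<Longrightarrow> integrable (leb a b) u"
  using L2_integrable_mult[OF L2_const[of 1], of u] by simp

lemma L2_cmult: "u \<in> L2 a b \<Longrightarrow> (\<lambda>x. c * u x) \<in> L2 a b"
  by (auto simp: L2_iff power_mult_distrib)

lemma L2_add: "u \<in> L2 a b \<Longrightarrow> v \<in> L2 a b \<Longrightarrow> (\<lambda>x. u x + v x) \<in> L2 a b"
  using L2_integrable_mult[of u _ _ v] by (auto simp: L2_iff power2_sum mult.assoc)

lemma L2_diff: "u \<in> L2 a b \<Longrightarrow> v \<in> L2 a b \<Longrightarrow> (\<lambda>x. u x - v x) \<in> L2 a b"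
  using L2_add[OF _ L2_cmult[of v a b "-1"], of u] by simp

lemma L2_sum: "(\<And>i. i \<in> I \<Longrightarrow> u i \<in> L2 a b) \<Longrightarrow> (\<lambda>x. \<Sum>i\<in>I. u i x) \<in> L2 a b"
  by (induction I rule: infinite_finite_induct) (auto intro: L2_add simp: L2_const)

lemma L2_subset: "u \<in> L2 a b \<Longrightarrow> a \<le> c \<Longrightarrow> d \<le> b \<Longrightarrow> u \<in> L2 c d"
  unfolding L2_iff using leb_subset[of a b "\<lambda>x. (u x)\<^sup>2"] leb_measurable_subset by blast

lemma L2_AE_cong: "(AE x in leb a b. u x = v x) \<Longrightarrow> v \<in> L2 a b \<Longrightarrow> u \<in> L2 a b"
proof -
  assume *: "AE x in leb a b. u x = v x" "v \<in> L2 a b"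
  have "AE x in leb a b. (u x)\<^sup>2 = (v x)\<^sup>2" using *(1) by eventually_elim simp
  then show ?thesis
    using integrable_leb_AE_cong(1)[of "\<lambda>x. (u x)\<^sup>2"] integrable_leb_AE_cong(2)[OF *(1) L2_integrable[OF *(2)]] *(2)
    by (auto simp: L2_iff)
qed

lemma L2_continuous: "continuous_on {a..b} u \<Longrightarrow> u \<in> L2 a b"
  unfolding L2_iff
  by (intro conjI leb_continuous borel_measurable_integrable[OF leb_continuous] continuous_on_power)

lemma L2_bounded:
  assumes "u \<in> borel_measurable (leb a b)" "\<And>x. x \<in> {a<..<b} \<Longrightarrow> \<bar>u x\<bar> \<le> K"
  shows "u \<in> L2 a b"
  unfolding L2_iff
proof
  show "integrable (leb a b) (\<lambda>x. (u x)\<^sup>2)"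
  proof (rule leb_bounded)
    show "(\<lambda>x. (u x)\<^sup>2) \<in> borel_measurable (leb a b)" using assms(1) by measurable
    fix x assume "x \<in> {a<..<b}"
    then show "\<bar>(u x)\<^sup>2\<bar> \<le> K\<^sup>2" using power_mono[OF assms(2), of x 2] by simp
  qed
qed (rule assms(1))

text \<open>The solution of \<open>v'' = g\<close> with initial data \<open>c\<close>, \<open>d\<close> at \<open>a\<close>, plus jumps \<open>A t\<close> of the value
  and \<open>B t\<close> of the slope at the nodes \<open>t\<close>.\<close>

definition pw :: "real \<Rightarrow> real \<Rightarrow> real \<Rightarrow> (real \<Rightarrow> real) \<Rightarrow> real set \<Rightarrow> (real \<Rightarrow> real) \<Rightarrow> (real \<Rightarrow> real) \<Rightarrow> real \<Rightarrow> real" where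
  "pw a c d g T A B x = c + d * (x - a) + prim a (prim a g) x +
     (\<Sum>t\<in>T. if t < x then A t + B t * (x - t) else 0)"

lemma integral_indicator_Ioi:
  fixes t :: real
  assumes "a \<le> t" "a \<le> x"
  shows "(indicator {t<..} has_integral (if t < x then x - t else 0)) {a..x}"
proof (cases "t < x")
  case True
  have "((\<lambda>y. 1::real) has_integral (x - t)) {t..x}"
    using has_integral_const_real[of "1::real" t x] True by simp
  then have 1: "(indicat_real {t<..} has_integral (x - t)) {t..x}"
    by (rule has_integral_spike_finite[where S = "{t}", rotated -1]) auto
  have 2: "(indicat_real {t<..} has_integral 0) {a..t}"
    by (rule has_integral_is_0) auto
  show ?thesis using has_integral_combine[OF assms(1) _ 2 1] True by simp
next
  case False
  then have "(indicat_real {t<..} has_integral 0) {a..x}" by (intro has_integral_is_0) auto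
  then show ?thesis using False by simp
qed

lemma prim_step:
  assumes g: "integrable (leb a b) g" and T: "finite T" "T \<subseteq> {a..}" and x: "a \<le> x" "x \<le> b"
  shows "prim a (\<lambda>y. d + prim a g y + step T B y) x
    = d * (x - a) + prim a (prim a g) x + (\<Sum>t\<in>T. if t < x then B t * (x - t) else 0)"
proof -
  have "(prim a g has_integral prim a (prim a g) x) {a..x}"
    unfolding prim_def[of a "prim a g"] using leb_integrable_on[OF integrable_prim[OF g]] x
    by (intro integrable_integral) auto
  moreover have "((\<lambda>y. d) has_integral d * (x - a)) {a..x}"
    using has_integral_const_real[of d a x] x by (simp add: mult.commute)
  moreover have "(step T B has_integral (\<Sum>t\<in>T. B t * (if t < x then x - t else 0))) {a..x}"
    using T x by (intro has_integral_sum has_integral_mult_right integral_indicator_Ioi) auto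
  ultimately have "((\<lambda>y. d + prim a g y + step T B y) has_integral
      d * (x - a) + prim a (prim a g) x + (\<Sum>t\<in>T. B t * (if t < x then x - t else 0))) {a..x}"
    by (intro has_integral_add)
  moreover have "(\<Sum>t\<in>T. B t * (if t < x then x - t else 0)) = (\<Sum>t\<in>T. if t < x then B t * (x - t) else 0)"
    by (rule sum.cong) auto
  ultimately show ?thesis unfolding prim_def[of a "\<lambda>y. d + prim a g y + step T B y"]
    by (simp add: integral_unique)
qed

text \<open>Ramps are primitives of steps, so \<open>pw\<close> becomes a continuous function plus a
  step function, the shape for which jumps and one-sided limits have been computed.\<close>

lemma pw_eq:
  assumes g: "integrable (leb a b) g" and T: "finite T" "T \<subseteq> {a..}" and x: "a \<le> x" "x \<le> b"
  shows "pw a c d g T A B x = c + prim a (\<lambda>y. d + prim a g y + step T B y) x + step T A x"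
proof -
  have "(\<Sum>t\<in>T. if t < x then A t + B t * (x - t) else 0)
      = (\<Sum>t\<in>T. if t < x then B t * (x - t) else 0) + step T A x"
    unfolding sum.distrib[symmetric] by (rule sum.cong) auto
  then show ?thesis using prim_step[OF assms, of d B] by (simp add: pw_def)
qed

text \<open>A void node, with p = q = 0, costs nothing; limits of nodes may therefore stay in the
  node set even when their jumps disappear.\<close>

definition node_cost :: "real \<Rightarrow> real \<Rightarrow> real \<Rightarrow> real \<Rightarrow> real" where
  "node_cost \<alpha> \<beta> p q = (if p \<noteq> 0 then \<alpha> else if q \<noteq> 0 then \<beta> else 0)"

section \<open>Derivatives, jumps and energy read off the data\<close>

context
  fixes a b c d :: real and g A B v :: "real \<Rightarrow> real" and T :: "real set"
  assumes ab: "a < b" and g: "g \<in> L2 a b" and T: "finite T" "T \<subseteq> {a<..<b}"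
    and v: "AE x in leb a b. v x = pw a c d g T A B x"
begin

abbreviation (input) "dv \<equiv> \<lambda>y. d + prim a g y + step T B y"

lemma nodes_ge: "T \<subseteq> {a..}" using T by auto

lemma integrable_pw_deriv: "integrable (leb a b) dv"
  by (intro Bochner_Integration.integrable_add leb_integrable_const integrable_prim integrable_step L2_integrable[OF g])

lemma continuous_pw: "continuous_on {a..b} (\<lambda>x. c + prim a dv x)"
  by (intro continuous_intros continuous_prim integrable_pw_deriv)

lemma pw_AE_step: "AE x in leb a b. v x = c + prim a dv x + step T A x"
  using v unfolding AE_leb
  by eventually_elim (use pw_eq[OF L2_integrable[OF g] T(1) nodes_ge, where c = c and d = d and A = A and B = B] in auto)

lemma ac_deriv_pw: "AE x in leb a b. ac_deriv a b v x = d + prim a g x + step T B x"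
  by (rule ac_deriv_AE[OF integrable_pw_deriv ab T pw_AE_step])

lemma ac_deriv2_pw: "AE x in leb a b. ac_deriv a b (ac_deriv a b v) x = g x"
  by (rule ac_deriv_AE[OF L2_integrable[OF g] ab T ac_deriv_pw])

lemma jump_set_pw: "jump_set a b v = {t \<in> T. A t \<noteq> 0}"
  by (rule jump_set_step[OF continuous_pw T pw_AE_step])

lemma jump_set_ac_deriv_pw: "jump_set a b (ac_deriv a b v) = {t \<in> T. B t \<noteq> 0}"
proof (rule jump_set_step[OF _ T ac_deriv_pw])
  show "continuous_on {a..b} (\<lambda>x. d + prim a g x)"
    by (intro continuous_intros continuous_prim L2_integrable[OF g])
qed

lemma pw_in_L2: "integrable (leb a b) v" "v \<in> borel_measurable (leb a b)" "v \<in> L2 a b"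
proof -
  have i: "integrable (leb a b) (\<lambda>x. c + prim a dv x + step T A x)"
    by (intro Bochner_Integration.integrable_add leb_continuous[OF continuous_pw] integrable_step)
  show "integrable (leb a b) v" "v \<in> borel_measurable (leb a b)"
    using integrable_leb_AE_cong[OF pw_AE_step i] by auto
  have "step T A \<in> L2 a b" by (rule L2_bounded[OF step_measurable_leb step_bound])
  from L2_add[OF L2_continuous[OF continuous_pw] this] show "v \<in> L2 a b"
    by (rule L2_AE_cong[OF pw_AE_step])
qed

end

text \<open>The second \<open>ac_deriv\<close> is known only almost everywhere, which suffices under
  the integral. The two jump sets are read off A and B, and counting them node by node gives
  \<open>node_cost\<close>.\<close>

lemma E1_pw:
  assumes g: "g \<in> L2 (-2) 2" and T: "finite T" "T \<subseteq> {-2<..<2}"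
    and v: "AE x in leb (-2) 2. v x = pw (-2) c d g T A B x"
    and f: "f \<in> L2 (-1) 1"
  shows "E1 \<alpha> \<beta> \<eta> \<mu> f w v = ereal ((\<Sum>t\<in>T. node_cost \<alpha> \<beta> (A t) (B t)) +
      (LINT x|leb (-1) 1. \<eta> * (g x)\<^sup>2 - f x * v x) + \<mu> * (LINT x|leb (-1) 1. (v x - w x)\<^sup>2))"
proof -
  note pw = g T v
  have two: "(-2::real) < 2" by simp
  let ?v2 = "ac_deriv (-2) 2 (ac_deriv (-2) 2 v)"
  have "(LINT x|leb (-1) 1. \<eta> * \<bar>?v2 x\<bar>\<^sup>2 - f x * v x) = (LINT x|leb (-1) 1. \<eta> * (g x)\<^sup>2 - f x * v x)"
  proof (rule integral_cong_AE)
    have ae: "AE x in leb (-2) 2. ?v2 x = g x" by (rule ac_deriv2_pw[OF two pw])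
    have [measurable]: "?v2 \<in> borel_measurable (leb (-1) 1)"
      using integrable_leb_AE_cong(2)[OF ae L2_integrable[OF g]] by (rule leb_measurable_subset) auto
    have [measurable]: "g \<in> borel_measurable (leb (-1) 1)" "v \<in> borel_measurable (leb (-1) 1)"
      using g pw_in_L2(2)[OF two pw] by (auto simp: L2_iff intro: leb_measurable_subset)
    have [measurable]: "f \<in> borel_measurable (leb (-1) 1)" using f by (simp add: L2_iff)
    show "(\<lambda>x. \<eta> * \<bar>?v2 x\<bar>\<^sup>2 - f x * v x) \<in> borel_measurable (leb (-1) 1)"
      "(\<lambda>x. \<eta> * (g x)\<^sup>2 - f x * v x) \<in> borel_measurable (leb (-1) 1)"
      by measurable
    have "AE x in leb (-1) 1. ?v2 x = g x" using ae by (rule AE_leb_subset) auto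
    then show "AE x in leb (-1) 1. \<eta> * \<bar>?v2 x\<bar>\<^sup>2 - f x * v x = \<eta> * (g x)\<^sup>2 - f x * v x"
      by eventually_elim simp
  qed
  moreover have "counting {t \<in> T. A t \<noteq> 0} = ereal (real (card {t \<in> T. A t \<noteq> 0}))"
    "counting ({t \<in> T. B t \<noteq> 0} - {t \<in> T. A t \<noteq> 0}) = ereal (real (card ({t \<in> T. B t \<noteq> 0} - {t \<in> T. A t \<noteq> 0})))"
    using T(1) by (simp_all add: counting_def ereal_of_enat_def[symmetric] ennreal_of_nat_eq_real_of_nat)
  moreover have "(\<Sum>t\<in>T. node_cost \<alpha> \<beta> (A t) (B t)) = \<alpha> * real (card {t \<in> T. A t \<noteq> 0}) + \<beta> * real (card ({t \<in> T. B t \<noteq> 0} - {t \<in> T. A t \<noteq> 0}))"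
  proof -
    have "(\<Sum>t\<in>T. node_cost \<alpha> \<beta> (A t) (B t)) = (\<Sum>t\<in>T. (if A t \<noteq> 0 then \<alpha> else 0) + (if B t \<noteq> 0 \<and> A t = 0 then \<beta> else 0))"
      by (rule sum.cong) (auto simp: node_cost_def)
    also have "\<dots> = (\<Sum>t\<in>{t \<in> T. A t \<noteq> 0}. \<alpha>) + (\<Sum>t\<in>{t \<in> T. B t \<noteq> 0 \<and> A t = 0}. \<beta>)"
      using T(1) unfolding sum.distrib by (simp only: sum.inter_filter)
    also have "{t \<in> T. B t \<noteq> 0 \<and> A t = 0} = {t \<in> T. B t \<noteq> 0} - {t \<in> T. A t \<noteq> 0}" by auto
    finally show ?thesis by (simp add: mult.commute)
  qed
  ultimately show ?thesis
    unfolding E1_def Let_def jump_set_pw[OF two pw] jump_set_ac_deriv_pw[OF two pw] by simp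
qed

text \<open>The du Bois-Reymond lemma applied twice, to the weak first derivative and to v
  itself.\<close>

lemma H2_imp_pw:
  assumes "v \<in> H2 p q" "p < q"
  obtains c d g where "g \<in> L2 p q" "AE x in leb p q. v x = c + d * (x - p) + prim p (prim p g) x"
proof -
  obtain u1 u2 where u: "v \<in> L2 p q" "u1 \<in> L2 p q" "u2 \<in> L2 p q" "weak_deriv p q v u1" "weak_deriv p q u1 u2"
    using assms(1) unfolding H2_def by blast
  obtain d where d: "AE x in leb p q. u1 x = d + prim p u2 x"
    using weak_deriv_imp_prim[OF assms(2) L2_integrable[OF u(2)] L2_integrable[OF u(3)] u(5)] by blast
  obtain c where c: "AE x in leb p q. v x = c + prim p u1 x"
    using weak_deriv_imp_prim[OF assms(2) L2_integrable[OF u(1)] L2_integrable[OF u(2)] u(4)] by blast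
  have "AE x in leb p q. v x = c + d * (x - p) + prim p (prim p u2) x"
    using c unfolding AE_leb
  proof eventually_elim
    case (elim x)
    show ?case
    proof
      assume x: "x \<in> {p<..<q}"
      have "prim p u1 x = prim p (\<lambda>y. d + prim p u2 y) x"
        by (rule prim_cong_AE[OF d]) (use x integrable_prim[OF L2_integrable[OF u(3)]] in auto)
      also have "\<dots> = d * (x - p) + prim p (prim p u2) x"
        using prim_step[OF L2_integrable[OF u(3)], of "{}" x d] x by simp
      finally show "v x = c + d * (x - p) + prim p (prim p u2) x" using elim x by simp
    qed
  qed
  then show ?thesis using u(3) that by blast
qed

lemma pw_in_H2:
  assumes ab: "a < b" and g: "g \<in> L2 a b" and T: "finite T" "T \<subseteq> {a<..<b}"
    and v: "AE x in leb a b. v x = pw a c d g T A B x"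
    and pq: "a \<le> p" "p < q" "q \<le> b" "T \<inter> {p<..<q} = {}"
  shows "v \<in> H2 p q"
proof -
  let ?dv = "\<lambda>y. d + prim a g y + step T B y"
  have gi: "integrable (leb a b) g" using g by (rule L2_integrable)
  \<comment> \<open>With no node inside (p,q) the step is constant there. The constant is its value
    at q and not at p, since the left-continuous step at p would miss a node sitting at p.\<close>
  have step_const: "step T X x = step T X q" if "x \<in> {p<..<q}" for X x
    by (rule sum.cong) (use that pq(4) in \<open>auto simp: indicator_def\<close>)
  have dv: "?dv x = (d + prim a g p + step T B q) + prim p g x" if "x \<in> {p<..<q}" for x
    using prim_combine[OF gi, of p x] step_const[OF that] that pq by auto
  have dvi: "integrable (leb a b) ?dv" by (rule integrable_pw_deriv[OF ab g T v])
  have vp: "AE x in leb p q. v x = (c + prim a ?dv p + step T A q) + prim p ?dv x"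
    using AE_leb_subset[OF pw_AE_step[OF ab g T v] pq(1,3)] unfolding AE_leb
  proof eventually_elim
    case (elim x)
    show ?case
    proof
      assume x: "x \<in> {p<..<q}"
      have "prim a ?dv x = prim a ?dv p + prim p ?dv x"
        by (rule prim_combine[OF dvi]) (use x pq in auto)
      then show "v x = (c + prim a ?dv p + step T A q) + prim p ?dv x"
        using elim x step_const[OF x, of A] by simp
    qed
  qed
  have dvi': "integrable (leb p q) ?dv" using dvi pq by (auto intro: leb_subset)
  have gi': "integrable (leb p q) g" using gi pq by (auto intro: leb_subset)
  have wd: "weak_deriv p q u k" if "AE x in leb p q. u x = e + prim p k x" "integrable (leb p q) k" for u k e
    unfolding weak_deriv_def
  proof (intro allI impI)
    fix \<phi> assume \<phi>: "test_function p q \<phi>"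
    have i: "integrable (leb p q) (\<lambda>x. e + prim p k x)"
      by (intro Bochner_Integration.integrable_add leb_integrable_const integrable_prim that)
    have "(LINT x|leb p q. u x * deriv \<phi> x) = (LINT x|leb p q. (e + prim p k x + step {} B x) * deriv \<phi> x)"
    proof (rule integral_cong_AE)
      show "AE x in leb p q. u x * deriv \<phi> x = (e + prim p k x + step {} B x) * deriv \<phi> x"
        using that(1) by eventually_elim simp
    qed (use integrable_leb_AE_cong(2)[OF that(1) i] borel_measurable_integrable[OF i]
          borel_measurable_integrable[OF leb_continuous[OF test_function_DERIV(3)[OF \<phi>]]] in auto)
    also have "\<dots> = - (LINT x|leb p q. k x * \<phi> x)"
      using integral_prim_step_test_deriv[OF that(2) \<phi> pq(2), of "{}" e B] by simp
    finally show "(LINT x|leb p q. u x * deriv \<phi> x) = - (LINT x|leb p q. k x * \<phi> x)" .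
  qed
  have dvp: "AE x in leb p q. ?dv x = (d + prim a g p + step T B q) + prim p g x"
    unfolding AE_leb using dv by auto
  have "v \<in> L2 p q"
    by (rule L2_AE_cong[OF vp]) (intro L2_continuous continuous_intros continuous_prim dvi')
  moreover have "?dv \<in> L2 p q"
    by (rule L2_AE_cong[OF dvp]) (intro L2_continuous continuous_intros continuous_prim gi')
  moreover have "g \<in> L2 p q" using g pq by (auto intro: L2_subset)
  moreover have "weak_deriv p q v ?dv" by (rule wd[OF vp dvi'])
  moreover have "weak_deriv p q ?dv g" by (rule wd[OF dvp gi'])
  ultimately show ?thesis unfolding H2_def by blast
qed

lemma pw_in_piecewise_H2:
  assumes ab: "a < b" and g: "g \<in> L2 a b" and T: "finite T" "T \<subseteq> {a<..<b}"
    and v: "AE x in leb a b. v x = pw a c d g T A B x"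
  shows "v \<in> piecewise_H2 a b"
proof -
  \<comment> \<open>The endpoints and the nodes, in increasing order, form the partition.\<close>
  define S where "S = insert a (insert b T)"
  define xs where "xs = sorted_list_of_set S"
  have S: "finite S" "S \<subseteq> {a..b}" "a \<in> S" "b \<in> S" using T ab by (auto simp: S_def)
  have xs: "set xs = S" "sorted xs" "distinct xs" using S(1) by (auto simp: xs_def)
  define n where "n = length xs - 1"
  have len: "length xs = Suc n" using xs(1) S(3) by (cases xs) (auto simp: n_def)
  have mono: "xs ! i < xs ! j" if "i < j" "j \<le> n" for i j
    using sorted_nth_mono[OF xs(2), of i j] nth_eq_iff_index_eq[OF xs(3), of i j] that len by fastforce
  have in_S: "xs ! i \<in> S" if "i \<le> n" for i using that len xs(1) nth_mem by fastforce
  obtain i where i: "i \<le> n" "xs ! i = a" using S(3) xs(1) len by (metis in_set_conv_nth less_Suc_eq_le)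
  obtain j where j: "j \<le> n" "xs ! j = b" using S(4) xs(1) len by (metis in_set_conv_nth less_Suc_eq_le)
  have "xs ! 0 = a"
  proof (cases "i = 0")
    case False
    then show ?thesis using mono[of 0 i] i in_S[of 0] S(2) by force
  qed (use i in simp)
  moreover have "xs ! n = b"
  proof (cases "j = n")
    case False
    then show ?thesis using mono[of j n] j in_S[of n] S(2) by force
  qed (use j in simp)
  moreover have "xs ! k < xs ! Suc k \<and> v \<in> H2 (xs ! k) (xs ! Suc k)" if k: "k < n" for k
  proof
    show lt: "xs ! k < xs ! Suc k" using mono k by auto
    show "v \<in> H2 (xs ! k) (xs ! Suc k)"
    proof (rule pw_in_H2[OF ab g T v _ lt])
      show "a \<le> xs ! k" "xs ! Suc k \<le> b" using in_S[of k] in_S[of "Suc k"] S(2) k by auto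
      show "T \<inter> {xs ! k<..<xs ! Suc k} = {}"
      proof (rule ccontr)
        assume "T \<inter> {xs ! k<..<xs ! Suc k} \<noteq> {}"
        then obtain t where t: "t \<in> T" "xs ! k < t" "t < xs ! Suc k" by auto
        then have "t \<in> S" by (simp add: S_def)
        then obtain l where l: "l \<le> n" "t = xs ! l" using xs(1) len by (metis in_set_conv_nth less_Suc_eq_le)
        have "\<not> l \<le> k"
          using l t(2) k mono[of l k] by (cases "l = k") auto
        moreover have "\<not> Suc k \<le> l"
          using l t(3) k mono[of "Suc k" l] by (cases "l = Suc k") auto
        ultimately show False by simp
      qed
    qed
  qed
  ultimately show ?thesis unfolding piecewise_H2_def by (auto intro!: exI[of _ n] exI[of _ "(!) xs"])
qed

section \<open>Structure of admissible functions\<close>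

text \<open>Taylor expansion with integral remainder. The base point is arbitrary because it is used
  at -2, for the initial data, and at 1, for the piece on the right.\<close>

lemma C2_on_expansion:
  assumes "C2_on a b w"
  shows "\<exists>w1 w2. continuous_on {a..b} w \<and> continuous_on {a..b} w2 \<and>
    (\<forall>p x. a \<le> p \<longrightarrow> p \<le> x \<longrightarrow> x \<le> b \<longrightarrow> w x = w p + w1 p * (x - p) + prim p (prim p w2) x)"
proof -
  obtain w1 w2 where w: "\<And>x. x \<in> {a..b} \<Longrightarrow> (w has_real_derivative w1 x) (at x within {a..b})"
    "\<And>x. x \<in> {a..b} \<Longrightarrow> (w1 has_real_derivative w2 x) (at x within {a..b})" "continuous_on {a..b} w2"
    using assms unfolding C2_on_def by blast
  have FTC: "(k' has_integral k x - k p) {p..x}"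
    if "\<And>x. x \<in> {a..b} \<Longrightarrow> (k has_real_derivative k' x) (at x within {a..b})" "a \<le> p" "p \<le> x" "x \<le> b" for k k' p x
  proof (rule fundamental_theorem_of_calculus[OF that(3)])
    fix y assume y: "y \<in> {p..x}"
    have "(k has_real_derivative k' y) (at y within {p..x})"
      by (rule DERIV_subset[OF that(1)]) (use y that in auto)
    then show "(k has_vector_derivative k' y) (at y within {p..x})"
      by (simp add: has_real_derivative_iff_has_vector_derivative)
  qed
  have "w x = w p + w1 p * (x - p) + prim p (prim p w2) x" if px: "a \<le> p" "p \<le> x" "x \<le> b" for p x
  proof -
    have i: "integrable (leb p b) w2"
      using px by (intro leb_continuous continuous_on_subset[OF w(3)]) auto
    have 1: "w1 y = w1 p + prim p w2 y" if "y \<in> {p..x}" for y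
      using integral_unique[OF FTC[OF w(2), of p y]] px that by (simp add: prim_def)
    have "w x = w p + prim p w1 x"
      using integral_unique[OF FTC[OF w(1), of p x]] px by (simp add: prim_def)
    also have "prim p w1 x = prim p (\<lambda>y. w1 p + prim p w2 y + step {} w y) x"
      unfolding prim_def[of p w1] prim_def[of p "\<lambda>y. w1 p + prim p w2 y + step {} w y"]
      by (rule HK_integral_cong) (drule 1, simp)
    also have "\<dots> = w1 p * (x - p) + prim p (prim p w2) x"
      by (subst prim_step[OF i]) (use px in auto)
    finally show ?thesis by simp
  qed
  moreover have "continuous_on {a..b} w" using w(1) by (rule DERIV_continuous_on)
  ultimately show ?thesis using w(3) by blast
qed

lemma L2_extend_zero:
  assumes "k \<in> L2 p q" "a \<le> p" "q \<le> b"
  shows "(\<lambda>x. indicator {p<..<q} x * k x) \<in> L2 a b"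
proof -
  have eq: "(\<lambda>x. indicator {a<..<b} x * (indicator {p<..<q} x * k x)) = (\<lambda>x. indicator {p<..<q} x * k x)"
    "(\<lambda>x. indicator {a<..<b} x * (indicator {p<..<q} x * k x)\<^sup>2) = (\<lambda>x. indicator {p<..<q} x * (k x)\<^sup>2)"
    using assms(2,3) by (auto intro!: ext split: split_indicator)
  show ?thesis
    using assms(1) unfolding L2_iff leb_measurable_iff leb_integrable_iff_UNIV eq by blast
qed

lemma L2_glue:
  assumes "g \<in> L2 a b" "g' \<in> L2 b e" "a \<le> b" "b \<le> e"
  shows "(\<lambda>x. if x < b then g x else g' x) \<in> L2 a e"
proof (rule L2_AE_cong)
  show "(\<lambda>x. indicator {a<..<b} x * g x + indicator {b<..<e} x * g' x) \<in> L2 a e"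
    using assms by (intro L2_add L2_extend_zero) auto
  have "AE x in leb a e. x \<notin> {b}" by (rule AE_leb_finite) simp
  then show "AE x in leb a e. (if x < b then g x else g' x) = indicator {a<..<b} x * g x + indicator {b<..<e} x * g' x"
    unfolding AE_leb by eventually_elim (auto split: split_indicator)
qed

text \<open>A new piece is attached by declaring its left end a node; the second derivatives are
  pasted together, and the mismatch of value and slope becomes the jump data there.\<close>

lemma pw_glue:
  assumes ab: "a < b" "b < e" and g: "g \<in> L2 a b" "g' \<in> L2 b e" and T: "finite T" "T \<subseteq> {a..<b}"
    and u: "AE x in leb a b. u x = pw a c d g T A B x"
      "AE x in leb b e. u x = c' + d' * (x - b) + prim b (prim b g') x"
  obtains A' B' where "AE x in leb a e. u x = pw a c d (\<lambda>x. if x < b then g x else g' x) (insert b T) A' B' x"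
proof -
  define G where "G x = (if x < b then g x else g' x)" for x
  have "G \<in> L2 a e" unfolding G_def using g ab by (intro L2_glue) auto
  then have G: "integrable (leb a e) G" by (rule L2_integrable)
  have gi: "integrable (leb a b) g" "integrable (leb b e) g'" using g by (auto intro: L2_integrable)
  have left: "prim a G x = prim a g x" if "x \<in> {a..b}" for x
    by (rule prim_cong_AE[OF _ gi(1) that]) (auto simp: AE_leb G_def)
  have right: "prim a G x = prim a g b + prim b g' x" if "x \<in> {b..e}" for x
  proof -
    have "prim a G x = prim a G b + prim b G x" by (rule prim_combine[OF G]) (use that ab in auto)
    moreover have "prim b G x = prim b g' x"
      by (rule prim_cong_AE[OF _ gi(2) that]) (auto simp: AE_leb G_def)
    ultimately show ?thesis using left[of b] ab by simp
  qed
  have left2: "prim a (prim a G) x = prim a (prim a g) x" if "x \<in> {a..b}" for x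
    unfolding prim_def[of a "prim a G"] prim_def[of a "prim a g"]
    by (rule HK_integral_cong) (use left that in auto)
  have right2: "prim a (prim a G) x = prim a (prim a g) b + prim a g b * (x - b) + prim b (prim b g') x"
    if "x \<in> {b..e}" for x
  proof -
    have "prim a (prim a G) x = prim a (prim a G) b + prim b (prim a G) x"
      by (rule prim_combine[OF integrable_prim[OF G]]) (use that ab in auto)
    also have "prim b (prim a G) x = prim b (\<lambda>y. prim a g b + prim b g' y + step {} g y) x"
      unfolding prim_def[of b "prim a G"] prim_def[of b "\<lambda>y. prim a g b + prim b g' y + step {} g y"]
      by (rule HK_integral_cong) (use right that in auto)
    also have "\<dots> = prim a g b * (x - b) + prim b (prim b g') x"
      by (subst prim_step[OF gi(2)]) (use that in auto)
    finally show ?thesis using left2[of b] ab by simp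
  qed
  \<comment> \<open>The new slope minus the slope with which the left part arrives at b; the next
    line does the same for the value.\<close>
  define B' where "B' = B(b := d' - (d + prim a g b + (\<Sum>t\<in>T. B t)))"
  define A' where "A' = A(b := c' - (c + d * (b - a) + prim a (prim a g) b + (\<Sum>t\<in>T. A t + B t * (b - t))))"
  have bT: "b \<notin> T" using T(2) by auto
  have sumT: "(\<Sum>t\<in>T. if t < x then A' t + B' t * (x - t) else 0) = (\<Sum>t\<in>T. if t < x then A t + B t * (x - t) else 0)" for x
    by (rule sum.cong) (use bT in \<open>auto simp: A'_def B'_def\<close>)
  have "AE x in leb a b. u x = pw a c d G (insert b T) A' B' x"
    using u(1) unfolding AE_leb
    by eventually_elim (use T(1) bT sumT left2 in \<open>auto simp: pw_def\<close>)
  moreover have "AE x in leb b e. u x = pw a c d G (insert b T) A' B' x"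
    using u(2) unfolding AE_leb
  proof eventually_elim
    case (elim x)
    show ?case
    proof
      assume x: "x \<in> {b<..<e}"
      have "(\<Sum>t\<in>T. if t < x then A t + B t * (x - t) else 0) = (\<Sum>t\<in>T. A t + B t * (x - t))"
        by (rule sum.cong) (use T(2) x in auto)
      also have "\<dots> = (\<Sum>t\<in>T. (A t + B t * (b - t)) + B t * (x - b))"
        by (rule sum.cong) (auto simp: algebra_simps)
      also have "\<dots> = (\<Sum>t\<in>T. A t + B t * (b - t)) + (\<Sum>t\<in>T. B t) * (x - b)"
        by (simp add: sum.distrib sum_distrib_right)
      finally have "pw a c d G (insert b T) A' B' x = c + d * (x - a) + (prim a (prim a g) b + prim a g b * (x - b) + prim b (prim b g') x)
          + (A' b + B' b * (x - b) + ((\<Sum>t\<in>T. A t + B t * (b - t)) + (\<Sum>t\<in>T. B t) * (x - b)))"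
        using T(1) bT sumT right2 x by (simp add: pw_def)
      then show "u x = pw a c d G (insert b T) A' B' x"
        using elim x by (simp add: A'_def B'_def algebra_simps)
    qed
  qed
  ultimately have "AE x in leb a e. u x = pw a c d G (insert b T) A' B' x" by (rule AE_leb_glue)
  then show ?thesis using that by (simp add: G_def[abs_def])
qed

lemma H2_subset:
  assumes "v \<in> H2 a b" "a \<le> p" "p < q" "q \<le> b" shows "v \<in> H2 p q"
proof -
  have "a < b" using assms by simp
  obtain c d g where g: "g \<in> L2 a b" "AE x in leb a b. v x = c + d * (x - a) + prim a (prim a g) x"
    by (rule H2_imp_pw[OF assms(1) \<open>a < b\<close>])
  have "AE x in leb a b. v x = pw a c d g {} g g x" using g(2) by (simp add: pw_def)
  then show ?thesis using assms by (intro pw_in_H2[OF _ g(1), of "{}"]) auto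
qed

text \<open>Once void nodes are dropped, every node costs at least \<beta>, which bounds the number
  of nodes along a minimizing sequence.\<close>

lemma pw_remove_zeros:
  assumes "finite T"
  shows "pw a c d g {t \<in> T. A t \<noteq> 0 \<or> B t \<noteq> 0} A B x = pw a c d g T A B x"
  unfolding pw_def using assms by (intro arg_cong2[where f = "(+)"] refl sum.mono_neutral_left) auto

text \<open>On (-2,-1) the function is w, which fixes the initial data at -2; together with v = w on
  (1,2) it confines the nodes to [-1,1] and makes the second derivative outside that of w. The
  pieces in between are attached one after another from the left.\<close>

lemma admissible_imp_pw:
  assumes v: "v \<in> admissible w"
    and w2: "continuous_on {-2..2} w2"
    and w: "\<And>p x. -2 \<le> p \<Longrightarrow> p \<le> x \<Longrightarrow> x \<le> 2 \<Longrightarrow> w x = w p + w1 p * (x - p) + prim p (prim p w2) x"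
  shows "\<exists>g T A B. g \<in> L2 (-2) 2 \<and> finite T \<and> T \<subseteq> {-1..1} \<and> (\<forall>t\<in>T. A t \<noteq> 0 \<or> B t \<noteq> 0) \<and>
    (\<forall>x. x < -1 \<or> 1 < x \<longrightarrow> g x = w2 x) \<and>
    (AE x in leb (-2) 2. v x = pw (-2) (w (-2)) (w1 (-2)) g T A B x)"
proof -
  let ?c = "w (-2)" and ?d = "w1 (-2)"
  obtain n s where s: "s 0 = -2" "s n = 2" "\<And>i. i < n \<Longrightarrow> s i < s (Suc i)" "\<And>i. i < n \<Longrightarrow> v \<in> H2 (s i) (s (Suc i))"
    using v unfolding admissible_def piecewise_H2_def by blast
  have w2L: "w2 \<in> L2 p q" if "-2 \<le> p" "q \<le> 2" for p q
    using L2_subset[OF L2_continuous[OF w2] that] .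
  have vw: "AE x in lebesgue. x \<in> {-2<..<-1} \<union> {1<..<2} \<longrightarrow> v x = w x" using v by (simp add: admissible_def)
  \<comment> \<open>The given partition is clamped to [-1,1]: it may lack -1 and 1 as partition
    points, and outside [-1,1] the expansion of w takes the place of its pieces.\<close>
  define z where "z i = max (-1) (min 1 (s i))" for i
  have claim: "i \<le> n \<Longrightarrow> \<exists>g T A B. g \<in> L2 (-2) (z i) \<and> finite T \<and> T \<subseteq> {-1..<z i} \<and> (\<forall>x. x < -1 \<longrightarrow> g x = w2 x) \<and>
    (AE x in leb (-2) (z i). v x = pw (-2) ?c ?d g T A B x)" for i
  proof (induction i)
    case 0
    have z0: "z 0 = -1" by (simp add: z_def s(1))
    have "AE x in leb (-2) (-1). v x = pw (-2) ?c ?d w2 {} w w x"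
      using vw unfolding AE_leb
    proof eventually_elim
      case (elim x)
      show ?case using elim w[of "-2" x] by (auto simp: pw_def)
    qed
    then show ?case using w2L[of "-2" "-1"] unfolding z0
      by (intro exI[of _ w2] exI[of _ "{}"] exI[of _ w]) auto
  next
    case (Suc i)
    then obtain g T A B where IH: "g \<in> L2 (-2) (z i)" "finite T" "T \<subseteq> {-1..<z i}" "\<forall>x. x < -1 \<longrightarrow> g x = w2 x"
      "AE x in leb (-2) (z i). v x = pw (-2) ?c ?d g T A B x"
      by auto
    have lt: "s i < s (Suc i)" "v \<in> H2 (s i) (s (Suc i))" using s Suc.prems by auto
    then have le: "z i \<le> z (Suc i)" by (auto simp: z_def)
    show ?case
    \<comment> \<open>A piece that does not meet (-1,1) is clamped to a point and adds
      nothing.\<close>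
    proof (cases "z i = z (Suc i)")
      case True
      then show ?thesis using IH unfolding True by blast
    next
      case False
      then have zlt: "z i < z (Suc i)" using le by simp
      then have "s i \<le> z i" "z (Suc i) \<le> s (Suc i)" by (auto simp: z_def min_def max_def split: if_splits)
      then have "v \<in> H2 (z i) (z (Suc i))" using H2_subset[OF lt(2) _ zlt] by simp
      then obtain c' d' g' where g': "g' \<in> L2 (z i) (z (Suc i))"
        "AE x in leb (z i) (z (Suc i)). v x = c' + d' * (x - z i) + prim (z i) (prim (z i) g') x"
        using H2_imp_pw[OF _ zlt] by metis
      have zi: "-2 < z i" "-1 \<le> z i" by (auto simp: z_def)
      have T': "T \<subseteq> {-2..<z i}" using IH(3) by auto
      obtain A' B' where "AE x in leb (-2) (z (Suc i)). v x
          = pw (-2) ?c ?d (\<lambda>x. if x < z i then g x else g' x) (insert (z i) T) A' B' x"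
        using pw_glue[OF zi(1) zlt IH(1) g'(1) IH(2) T' IH(5) g'(2)] by metis
      moreover have "(\<lambda>x. if x < z i then g x else g' x) \<in> L2 (-2) (z (Suc i))"
        using zi zlt by (intro L2_glue IH g') auto
      ultimately show ?thesis
        using IH zi zlt
        by (intro exI[of _ "\<lambda>x. if x < z i then g x else g' x"] exI[of _ "insert (z i) T"] exI[of _ A'] exI[of _ B']) auto
    qed
  qed
  have zn: "z n = 1" by (simp add: z_def s(2))
  obtain g T A B where g: "g \<in> L2 (-2) 1" "finite T" "T \<subseteq> {-1..<1}" "\<And>x. x < -1 \<Longrightarrow> g x = w2 x"
    "AE x in leb (-2) 1. v x = pw (-2) ?c ?d g T A B x"
    using claim[OF order_refl] unfolding zn by blast
  \<comment> \<open>The last piece is w itself on (1,2), expanded at 1 and attached there as a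
    node.\<close>
  have "AE x in leb 1 2. v x = w 1 + w1 1 * (x - 1) + prim 1 (prim 1 w2) x"
    using vw unfolding AE_leb
  proof eventually_elim
    case (elim x)
    show ?case using elim w[of 1 x] by auto
  qed
  moreover have "T \<subseteq> {-2..<1}" using g(3) by auto
  ultimately obtain A' B' where AB: "AE x in leb (-2) 2. v x = pw (-2) ?c ?d (\<lambda>x. if x < 1 then g x else w2 x) (insert 1 T) A' B' x"
    using pw_glue[of "-2" 1 2 g w2 T v ?c ?d A B "w 1" "w1 1"] g w2L[of 1 2] by auto
  let ?T = "{t \<in> insert 1 T. A' t \<noteq> 0 \<or> B' t \<noteq> 0}" and ?g = "\<lambda>x. if x < 1 then g x else w2 x"
  have "?g \<in> L2 (-2) 2" using g(1) w2L[of 1 2] by (intro L2_glue) auto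
  moreover have "finite (insert 1 T)" using g(2) by simp
  note AB[folded pw_remove_zeros[OF this]]
  ultimately show ?thesis using g(2-4) by (intro exI[of _ ?g] exI[of _ ?T] exI[of _ A'] exI[of _ B']) auto
qed

lemma pw_admissible:
  assumes g: "g \<in> L2 (-2) 2" and T: "finite T" "T \<subseteq> {-1..1}"
    and v: "AE x in leb (-2) 2. v x = pw (-2) c d g T A B x"
    and w: "continuous_on {-2..2} w"
    and out: "AE x in leb (-2) (-1). v x = w x" "AE x in leb 1 2. v x = w x"
    and ob: "AE x in leb (-1) 1. w x \<le> v x"
  shows "v \<in> admissible w"
proof -
  have two: "(-2::real) < 2" by simp
  have T2: "T \<subseteq> {-2<..<2}" using T(2) by auto
  note pw = two g T(1) T2 v
  have "AE x in leb (-2) (-1). w x \<le> v x" using out(1) by eventually_elim simp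
  moreover have "AE x in leb 1 2. w x \<le> v x" using out(2) by eventually_elim simp
  ultimately have "AE x in leb (-2) 2. w x \<le> v x" using AE_leb_glue[OF AE_leb_glue[OF _ ob]] by blast
  then have "above_obstacle w v"
    by (rule AE_imp_above_obstacle[OF continuous_pw[OF pw] T(1) T2 pw_AE_step[OF pw] w])
  moreover have "AE x in lebesgue. x \<in> {-2<..<-1} \<union> {1<..<2} \<longrightarrow> v x = w x"
    using out unfolding AE_leb by eventually_elim auto
  ultimately show ?thesis using pw_in_piecewise_H2[OF pw] by (simp add: admissible_def)
qed

lemma admissible_above:
  assumes v: "v \<in> admissible w" and g: "g \<in> L2 (-2) 2" and T: "finite T" "T \<subseteq> {-1..1}"
    and vp: "AE x in leb (-2) 2. v x = pw (-2) c d g T A B x"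
  shows "AE x in leb (-1) 1. w x \<le> v x"
proof -
  have two: "(-2::real) < 2" by simp
  have T2: "T \<subseteq> {-2<..<2}" using T(2) by auto
  note pw = two g T(1) T2 vp
  show ?thesis
    by (rule above_obstacle_imp_AE[OF continuous_pw[OF pw] T(1) T2 pw_AE_step[OF pw]])
       (use v in \<open>simp add: admissible_def\<close>)
qed

section \<open>Compactness of the nodes\<close>

lemma finite_bounded_subseq:
  fixes x :: "'i \<Rightarrow> nat \<Rightarrow> real"
  assumes "finite I" "\<And>i. i \<in> I \<Longrightarrow> Bseq (x i)"
  shows "\<exists>r::nat \<Rightarrow> nat. strict_mono r \<and> (\<forall>i\<in>I. convergent (\<lambda>n. x i (r n)))"
  using assms
proof (induction I rule: finite_induct)
  case empty
  then show ?case by (auto intro: strict_mono_id)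
next
  case (insert i I)
  then obtain r :: "nat \<Rightarrow> nat" where r: "strict_mono r" "\<And>j. j \<in> I \<Longrightarrow> convergent (\<lambda>n. x j (r n))"
    by auto
  have "bounded (range (\<lambda>n. x i (r n)))"
    by (rule bounded_subset[of "range (x i)"]) (use insert.prems[of i] in \<open>auto simp: Bseq_eq_bounded\<close>)
  then obtain l s where s: "strict_mono s" "((\<lambda>n. x i (r n)) \<circ> s) \<longlonglongrightarrow> l"
    using bounded_imp_convergent_subsequence by blast
  have "convergent (\<lambda>n. x j (r (s n)))" if "j \<in> insert i I" for j
  proof (cases "j = i")
    case True
    then show ?thesis using s(2) by (auto simp: convergent_def comp_def)
  next
    case False
    then have "convergent ((\<lambda>n. x j (r n)) \<circ> s)"
      using r(2)[of j] that s(1) by (intro convergent_subseq_convergent) auto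
    then show ?thesis by (simp add: comp_def)
  qed
  moreover have "strict_mono (\<lambda>n. r (s n))" using r(1) s(1) by (simp add: strict_mono_def)
  ultimately show ?case by blast
qed

text \<open>Expressed by midpoint value and slope, the integral is a sum of two nonnegative terms,
  so a bound on it controls both coefficients.\<close>

lemma affine_square_integral:
  fixes p q :: real
  assumes "x < y"
  shows "((\<lambda>\<xi>. (p + q * (\<xi> - x))\<^sup>2) has_integral
     ((y - x) * (p + q * (y - x) / 2)\<^sup>2 + q\<^sup>2 * (y - x) ^ 3 / 12)) {x..y}"
proof -
  define F where "F \<xi> = p\<^sup>2 * (\<xi> - x) + p * q * (\<xi> - x)\<^sup>2 + (q\<^sup>2 / 3) * (\<xi> - x) ^ 3" for \<xi>
  have "((\<lambda>\<xi>. (p + q * (\<xi> - x))\<^sup>2) has_integral (F y - F x)) {x..y}"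
  proof (rule fundamental_theorem_of_calculus)
    fix \<xi>
    have "(F has_real_derivative (p + q * (\<xi> - x))\<^sup>2) (at \<xi> within {x..y})"
      unfolding F_def
      by (rule derivative_eq_intros refl)+ (simp add: power2_eq_square, simp add: algebra_simps)
    then show "(F has_vector_derivative (p + q * (\<xi> - x))\<^sup>2) (at \<xi> within {x..y})"
      by (simp add: has_real_derivative_iff_has_vector_derivative)
  qed (use assms in auto)
  moreover have "F y - F x = (y - x) * (p + q * (y - x) / 2)\<^sup>2 + q\<^sup>2 * (y - x) ^ 3 / 12"
    by (simp add: F_def power2_eq_square power3_eq_cube field_simps)
  ultimately show ?thesis by simp
qed

lemma affine_Bseq:
  fixes p q :: "nat \<Rightarrow> real"
  assumes "x < y" and ev: "\<forall>\<^sub>F n in sequentially. integral {x..y} (\<lambda>\<xi>. (p n + q n * (\<xi> - x))\<^sup>2) \<le> C"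
  shows "Bseq p" "Bseq q"
proof -
  define L where "L = y - x"
  have L: "L > 0" using assms by (simp add: L_def)
  define Q where "Q = sqrt (12 * C / L ^ 3)"
  have b: "\<forall>\<^sub>F n in sequentially. \<bar>q n\<bar> \<le> Q \<and> \<bar>p n\<bar> \<le> sqrt (C / L) + Q * L / 2"
    using ev
  proof eventually_elim
    case (elim n)
    have le: "L * (p n + q n * L / 2)\<^sup>2 + (q n)\<^sup>2 * L ^ 3 / 12 \<le> C"
      using elim integral_unique[OF affine_square_integral[OF assms(1), of "p n" "q n"]] by (simp add: L_def)
    have "0 \<le> L * (p n + q n * L / 2)\<^sup>2" "0 \<le> (q n)\<^sup>2 * L ^ 3 / 12" using L by auto
    then have 1: "(q n)\<^sup>2 * L ^ 3 / 12 \<le> C" "L * (p n + q n * L / 2)\<^sup>2 \<le> C" using le by linarith+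
    then have "(q n)\<^sup>2 \<le> 12 * C / L ^ 3" "(p n + q n * L / 2)\<^sup>2 \<le> C / L" using L by (auto simp: field_simps)
    then have 2: "\<bar>q n\<bar> \<le> Q" "\<bar>p n + q n * L / 2\<bar> \<le> sqrt (C / L)" unfolding Q_def
      by (auto intro: real_le_rsqrt)
    have "\<bar>q n * L / 2\<bar> \<le> Q * L / 2" using 2(1) L by (simp add: abs_mult)
    then show ?case using 2 by linarith
  qed
  then show "Bseq p" by (intro BfunI[where K = "sqrt (C / L) + Q * L / 2"]) (auto elim: eventually_mono)
  show "Bseq q" using b by (intro BfunI[where K = Q]) (auto elim: eventually_mono)
qed

lemma Bseq_plus:
  fixes f g :: "nat \<Rightarrow> real"
  shows "Bseq f \<Longrightarrow> Bseq g \<Longrightarrow> Bseq (\<lambda>n. f n + g n)"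
  unfolding Bseq_eq_bounded by (rule bounded_plus_comp)

lemma Bseq_mult_const: "Bseq f \<Longrightarrow> Bseq (\<lambda>n. f n * c)" for f :: "nat \<Rightarrow> real"
  by (rule Bseq_mult[OF _ convergent_imp_Bseq[OF convergent_const]])

text \<open>A single term is the difference of two consecutive prefix sums. Prefixes are what the
  gap behind \<sigma> reveals: there the function is the sum of all ramps that start up to
  \<sigma>.\<close>

lemma prefix_Bseq:
  fixes X :: "nat \<Rightarrow> real \<Rightarrow> real"
  assumes T: "finite T" and pre: "\<And>\<sigma>. \<sigma> \<in> T \<Longrightarrow> Bseq (\<lambda>n. \<Sum>s\<in>{s \<in> T. s \<le> \<sigma>}. X n s)" and \<sigma>: "\<sigma> \<in> T"
  shows "Bseq (\<lambda>n. X n \<sigma>)"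
proof -
  have "Bseq (\<lambda>n. \<Sum>s\<in>{s \<in> T. s < \<sigma>}. X n s)"
  proof (cases "{s \<in> T. s < \<sigma>} = {}")
    case True
    then show ?thesis unfolding True by simp
  next
    case False
    define \<rho> where "\<rho> = Max {s \<in> T. s < \<sigma>}"
    have "\<rho> \<in> {s \<in> T. s < \<sigma>}" unfolding \<rho>_def using T False by (intro Max_in) auto
    moreover have "{s \<in> T. s < \<sigma>} = {s \<in> T. s \<le> \<rho>}"
    proof -
      have "s \<le> \<rho>" if "s \<in> T" "s < \<sigma>" for s unfolding \<rho>_def using T that by (intro Max_ge) auto
      then show ?thesis using \<open>\<rho> \<in> _\<close> by auto
    qed
    ultimately show ?thesis using pre[of \<rho>] by simp
  qed
  then have "Bseq (\<lambda>n. (\<Sum>s\<in>{s \<in> T. s \<le> \<sigma>}. X n s) - (\<Sum>s\<in>{s \<in> T. s < \<sigma>}. X n s))"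
    using Bseq_plus[OF pre[OF \<sigma>], of "\<lambda>n. - (\<Sum>s\<in>{s \<in> T. s < \<sigma>}. X n s)"] by (simp add: Bseq_minus_iff)
  moreover have "(\<Sum>s\<in>{s \<in> T. s \<le> \<sigma>}. X n s) - (\<Sum>s\<in>{s \<in> T. s < \<sigma>}. X n s) = X n \<sigma>" for n
  proof -
    have "{s \<in> T. s \<le> \<sigma>} = insert \<sigma> {s \<in> T. s < \<sigma>}" using \<sigma> by auto
    then show ?thesis using T by simp
  qed
  ultimately show ?thesis by simp
qed

text \<open>The single jumps \<open>a n i\<close>, \<open>b n i\<close> may be unbounded; only their sums over the nodes with a common
  limit are controlled, through the slopes and values on the gaps between limit points.\<close>

lemma nodes_compact:
  fixes t a b :: "nat \<Rightarrow> nat \<Rightarrow> real" and \<tau> :: "nat \<Rightarrow> real" and p :: "nat \<Rightarrow> real \<Rightarrow> real"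
  assumes t: "\<And>n i. i < k \<Longrightarrow> t n i \<in> {-1..1}" and lim: "\<And>i. i < k \<Longrightarrow> (\<lambda>n. t n i) \<longlonglongrightarrow> \<tau> i"
    and S: "\<And>n i. i < k \<Longrightarrow> i \<notin> S \<Longrightarrow> a n i = 0"
    and p: "\<And>n x. p n x = (\<Sum>i<k. if t n i < x then a n i + b n i * (x - t n i) else 0)"
    and bound: "\<And>n x y. -2 < x \<Longrightarrow> x < y \<Longrightarrow> y < 2 \<Longrightarrow> integral {x..y} (\<lambda>\<xi>. (p n \<xi>)\<^sup>2) \<le> C"
    and \<beta>: "0 < \<beta>" "\<beta> \<le> \<alpha>" "\<alpha> \<le> 2 * \<beta>"
  shows "\<exists>r A B. strict_mono r \<and>
    (\<forall>x. x \<notin> \<tau> ` {..<k} \<longrightarrow>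
      (\<lambda>n. p (r n) x) \<longlonglongrightarrow> (\<Sum>s\<in>\<tau> ` {..<k}. if s < x then A s + B s * (x - s) else 0)) \<and>
    (\<Sum>s\<in>\<tau> ` {..<k}. node_cost \<alpha> \<beta> (A s) (B s)) \<le> (\<Sum>i<k. if i \<in> S then \<alpha> else \<beta>)"
proof -
  define T where "T = \<tau> ` {..<k}"
  have T: "finite T" by (simp add: T_def)
  have \<tau>: "\<tau> i \<in> {-1..1}" if "i < k" for i
    using closed_sequentially[OF closed_atLeastAtMost _ lim[OF that]] t[OF that] by blast
  then have T1: "T \<subseteq> {-1..1}" by (auto simp: T_def)
  define I where "I s = {i \<in> {..<k}. \<tau> i = s}" for s
  \<comment> \<open>The ramps of a cluster, re-expanded around their common limit s: their joint
    value and joint slope there.\<close>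
  define An where "An n s = (\<Sum>i\<in>I s. a n i + b n i * (s - t n i))" for n s
  define Bn where "Bn n s = (\<Sum>i\<in>I s. b n i)" for n s
  have group: "(\<Sum>s\<in>T. \<Sum>i\<in>I s. h i) = (\<Sum>i<k. h i)" for h :: "nat \<Rightarrow> real"
    unfolding T_def I_def by (rule sum.image_gen[symmetric]) simp
  have cluster: "(\<Sum>i\<in>I s. a n i + b n i * (\<xi> - t n i)) = An n s + Bn n s * (\<xi> - s)" for n s \<xi>
    unfolding An_def Bn_def sum_distrib_right sum.distrib[symmetric]
    by (rule sum.cong) (auto simp: algebra_simps)
  \<comment> \<open>On an interval free of limit points every node eventually stays on its own side,
    so there p is exactly affine and not merely close to affine.\<close>
  have ev: "\<forall>\<^sub>F n in sequentially. \<forall>\<xi>\<in>{x..y}. p n \<xi> = (\<Sum>s\<in>T. if s < x then An n s + Bn n s * (\<xi> - s) else 0)"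
    if xy: "x \<le> y" "T \<inter> {x..y} = {}" for x y
  proof -
    have "\<forall>\<^sub>F n in sequentially. \<forall>i\<in>{..<k}. if \<tau> i < x then t n i < x else y < t n i"
    proof (rule eventually_ball_finite, simp, intro ballI)
      fix i assume "i \<in> {..<k}"
      then have "\<tau> i \<in> T" "(\<lambda>n. t n i) \<longlonglongrightarrow> \<tau> i" using lim by (auto simp: T_def)
      moreover from this have "\<tau> i < x \<or> y < \<tau> i" using xy by force
      ultimately show "\<forall>\<^sub>F n in sequentially. if \<tau> i < x then t n i < x else y < t n i"
        using order_tendstoD by (cases "\<tau> i < x") auto
    qed
    then show ?thesis
    proof eventually_elim
      case (elim n)
      show ?case
      proof
        fix \<xi> assume \<xi>: "\<xi> \<in> {x..y}"
        have "p n \<xi> = (\<Sum>i<k. if \<tau> i < x then a n i + b n i * (\<xi> - t n i) else 0)"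
          unfolding p
        proof (rule sum.cong[OF refl])
          fix i assume "i \<in> {..<k}"
          then have "if \<tau> i < x then t n i < x else y < t n i" using elim by blast
          then show "(if t n i < \<xi> then a n i + b n i * (\<xi> - t n i) else 0)
              = (if \<tau> i < x then a n i + b n i * (\<xi> - t n i) else 0)"
            using \<xi> by (auto split: if_splits)
        qed
        also have "\<dots> = (\<Sum>s\<in>T. \<Sum>i\<in>I s. if \<tau> i < x then a n i + b n i * (\<xi> - t n i) else 0)"
          by (rule group[symmetric])
        also have "\<dots> = (\<Sum>s\<in>T. if s < x then An n s + Bn n s * (\<xi> - s) else 0)"
        proof (rule sum.cong[OF refl])
          fix s
          have "(\<Sum>i\<in>I s. if \<tau> i < x then a n i + b n i * (\<xi> - t n i) else 0)
              = (\<Sum>i\<in>I s. if s < x then a n i + b n i * (\<xi> - t n i) else 0)"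
            by (rule sum.cong) (auto simp: I_def)
          also have "\<dots> = (if s < x then An n s + Bn n s * (\<xi> - s) else 0)"
            using cluster[of n \<xi> s] by simp
          finally show "(\<Sum>i\<in>I s. if \<tau> i < x then a n i + b n i * (\<xi> - t n i) else 0)
              = (if s < x then An n s + Bn n s * (\<xi> - s) else 0)" .
        qed
        finally show "p n \<xi> = (\<Sum>s\<in>T. if s < x then An n s + Bn n s * (\<xi> - s) else 0)" .
      qed
    qed
  qed
  have pre: "Bseq (\<lambda>n. \<Sum>s\<in>{s \<in> T. s \<le> \<sigma>}. Bn n s) \<and> Bseq (\<lambda>n. \<Sum>s\<in>{s \<in> T. s \<le> \<sigma>}. An n s - Bn n s * s)"
    if \<sigma>: "\<sigma> \<in> T" for \<sigma>
  proof -
    \<comment> \<open>The next limit point to the right, or 2 after the last one; since the limit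
      points lie in [-1,1], a gap of positive length follows each of them.\<close>
    define \<rho> where "\<rho> = Min (insert 2 {s \<in> T. \<sigma> < s})"
    have fin: "finite (insert 2 {s \<in> T. \<sigma> < s})" using T by simp
    have "\<rho> \<in> insert 2 {s \<in> T. \<sigma> < s}" unfolding \<rho>_def using fin by (intro Min_in) auto
    then have \<rho>: "\<sigma> < \<rho>" "\<rho> \<le> 2" using \<sigma> T1 Min_le[OF fin, of 2] by (auto simp: \<rho>_def)
    \<comment> \<open>The middle third keeps a distance from both ends of the gap, near which nodes
      may still lie for large n.\<close>
    define x y where "x = (2 * \<sigma> + \<rho>) / 3" and "y = (\<sigma> + 2 * \<rho>) / 3"
    have xy: "\<sigma> < x" "x < y" "y < \<rho>" using \<rho> by (auto simp: x_def y_def)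
    have "-1 \<le> \<sigma>" using \<sigma> T1 by auto
    have gap: "s \<le> \<sigma> \<or> \<rho> \<le> s" if "s \<in> T" for s
    proof (cases "\<sigma> < s")
      case True
      then show ?thesis unfolding \<rho>_def using that by (intro disjI2 Min_le[OF fin]) simp
    qed simp
    have empty: "T \<inter> {x..y} = {}" using gap xy by force
    have eqT: "{s \<in> T. s \<le> \<sigma>} = {s \<in> T. s < x}" using gap xy by force
    let ?F = "\<lambda>n. \<Sum>s\<in>{s \<in> T. s \<le> \<sigma>}. Bn n s" and ?G = "\<lambda>n. \<Sum>s\<in>{s \<in> T. s \<le> \<sigma>}. An n s - Bn n s * s"
    have "\<forall>\<^sub>F n in sequentially. integral {x..y} (\<lambda>\<xi>. ((?G n + ?F n * x) + ?F n * (\<xi> - x))\<^sup>2) \<le> C"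
      using ev[OF less_imp_le[OF xy(2)] empty]
    proof eventually_elim
      case (elim n)
      have "p n \<xi> = (?G n + ?F n * x) + ?F n * (\<xi> - x)" if "\<xi> \<in> {x..y}" for \<xi>
      proof -
        have "p n \<xi> = (\<Sum>s\<in>T. if s < x then An n s + Bn n s * (\<xi> - s) else 0)" using elim that by blast
        also have "\<dots> = (\<Sum>s\<in>{s \<in> T. s \<le> \<sigma>}. An n s + Bn n s * (\<xi> - s))"
          unfolding eqT using T by (simp add: sum.inter_filter)
        also have "\<dots> = (\<Sum>s\<in>{s \<in> T. s \<le> \<sigma>}. (An n s - Bn n s * s) + Bn n s * \<xi>)"
          by (rule sum.cong) (auto simp: algebra_simps)
        also have "\<dots> = ?G n + ?F n * \<xi>" by (simp add: sum.distrib sum_distrib_right)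
        finally show ?thesis by (simp add: algebra_simps)
      qed
      then have "integral {x..y} (\<lambda>\<xi>. ((?G n + ?F n * x) + ?F n * (\<xi> - x))\<^sup>2) = integral {x..y} (\<lambda>\<xi>. (p n \<xi>)\<^sup>2)"
        by (intro HK_integral_cong) simp
      then show ?case using bound[of x y n] xy \<rho> \<open>-1 \<le> \<sigma>\<close> by simp
    qed
    from affine_Bseq[OF xy(2) this]
    have G: "Bseq (\<lambda>n. ?G n + ?F n * x)" and F: "Bseq ?F" by auto
    have "Bseq (\<lambda>n. (?G n + ?F n * x) + ?F n * (- x))"
      by (rule Bseq_plus[OF G Bseq_mult_const[OF F]])
    then show ?thesis using F by simp
  qed
  have BB: "Bseq (\<lambda>n. Bn n s)" if "s \<in> T" for s
    using prefix_Bseq[OF T, of Bn s] pre that by blast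
  have AA: "Bseq (\<lambda>n. An n s)" if "s \<in> T" for s
  proof -
    have "Bseq (\<lambda>n. An n s - Bn n s * s)"
      using prefix_Bseq[OF T, of "\<lambda>n s. An n s - Bn n s * s" s] pre that by blast
    then have "Bseq (\<lambda>n. (An n s - Bn n s * s) + Bn n s * s)"
      by (rule Bseq_plus[OF _ Bseq_mult_const[OF BB[OF that]]])
    then show ?thesis by simp
  qed
  \<comment> \<open>Indexing by a point and a flag lets one extraction serve both coefficient
    families.\<close>
  define Y where "Y = (\<lambda>(s, c) n. if c then An n s else Bn n s)"
  have "Bseq (Y i)" if "i \<in> T \<times> UNIV" for i
    using AA BB that by (cases i; cases "snd i") (auto simp: Y_def)
  moreover have "finite (T \<times> (UNIV :: bool set))" using T by simp
  ultimately obtain r :: "nat \<Rightarrow> nat" where r: "strict_mono r" "\<forall>i\<in>T \<times> UNIV. convergent (\<lambda>n. Y i (r n))"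
    using finite_bounded_subseq[of "T \<times> UNIV" Y] by blast
  define A B where "A s = lim (\<lambda>n. An (r n) s)" and "B s = lim (\<lambda>n. Bn (r n) s)" for s
  have A: "(\<lambda>n. An (r n) s) \<longlonglongrightarrow> A s" if "s \<in> T" for s
    using bspec[OF r(2), of "(s, True)"] that by (simp add: A_def Y_def convergent_LIMSEQ_iff)
  have B: "(\<lambda>n. Bn (r n) s) \<longlonglongrightarrow> B s" if "s \<in> T" for s
    using bspec[OF r(2), of "(s, False)"] that by (simp add: B_def Y_def convergent_LIMSEQ_iff)
  have conv: "(\<lambda>n. p (r n) x) \<longlonglongrightarrow> (\<Sum>s\<in>T. if s < x then A s + B s * (x - s) else 0)" if "x \<notin> T" for x
  proof -
    have "(\<lambda>n. \<Sum>s\<in>T. if s < x then An (r n) s + Bn (r n) s * (x - s) else 0)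
        \<longlonglongrightarrow> (\<Sum>s\<in>T. if s < x then A s + B s * (x - s) else 0)"
    proof (rule tendsto_sum)
      fix s assume "s \<in> T"
      then show "(\<lambda>n. if s < x then An (r n) s + Bn (r n) s * (x - s) else 0)
        \<longlonglongrightarrow> (if s < x then A s + B s * (x - s) else 0)"
        by (cases "s < x") (auto intro!: tendsto_intros A B)
    qed
    moreover have "\<forall>\<^sub>F n in sequentially. p n x = (\<Sum>s\<in>T. if s < x then An n s + Bn n s * (x - s) else 0)"
    proof -
      have "T \<inter> {x..x} = {}" using that by simp
      from ev[OF order_refl this] show ?thesis by eventually_elim simp
    qed
    then have "\<forall>\<^sub>F n in sequentially. p (r n) x = (\<Sum>s\<in>T. if s < x then An (r n) s + Bn (r n) s * (x - s) else 0)"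
      by (rule eventually_subseq[OF r(1)])
    ultimately show ?thesis
      by (rule Lim_transform_eventually[OF _ eventually_mono]) simp
  qed
  have "node_cost \<alpha> \<beta> (A s) (B s) \<le> (\<Sum>i\<in>I s. if i \<in> S then \<alpha> else \<beta>)" if s: "s \<in> T" for s
  proof -
    have fin: "finite (I s)" by (simp add: I_def)
    obtain i where i: "i \<in> I s" using s by (auto simp: T_def I_def)
    have k\<alpha>: "node_cost \<alpha> \<beta> (A s) (B s) \<le> \<alpha>" using \<beta> by (simp add: node_cost_def)
    have nonneg: "0 \<le> (\<Sum>i\<in>J. if i \<in> S then \<alpha> else \<beta>)" for J using \<beta> by (intro sum_nonneg) auto
    show ?thesis
    proof (cases "\<exists>i\<in>I s. i \<in> S")
      case True
      \<comment> \<open>A cluster with a value jump pays at least \<alpha>, the highest cost that a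
        limit node can have.\<close>
      then obtain i where "i \<in> I s" "i \<in> S" by blast
      then have "(\<Sum>i\<in>I s. if i \<in> S then \<alpha> else \<beta>) = \<alpha> + (\<Sum>i\<in>I s - {i}. if i \<in> S then \<alpha> else \<beta>)"
        using fin by (simp add: sum.remove)
      then show ?thesis using k\<alpha> nonneg[of "I s - {i}"] by simp
    next
      case False
      show ?thesis
      proof (cases "\<exists>j\<in>I s. j \<noteq> i")
        case True
        then obtain j where j: "j \<in> I s" "j \<noteq> i" by blast
        \<comment> \<open>Two slope-only nodes pay 2 \<beta>, which covers \<alpha> even if they
          merge into a value jump.\<close>
        have "(\<Sum>i\<in>{i, j}. if i \<in> S then \<alpha> else \<beta>) \<le> (\<Sum>i\<in>I s. if i \<in> S then \<alpha> else \<beta>)"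
          using fin i j \<beta> by (intro sum_mono2) auto
        moreover have "(\<Sum>i\<in>{i, j}. if i \<in> S then \<alpha> else \<beta>) = 2 * \<beta>"
          using i j False by auto
        ultimately show ?thesis using k\<alpha> \<beta> by linarith
      next
        case single: False
        then have Is: "I s = {i}" using i by blast
        have ik: "i < k" "\<tau> i = s" "i \<notin> S" using i False by (auto simp: I_def)
        \<comment> \<open>A lone slope-only node contributes at s its slope times the signed
          distance to s. The slopes converge and the distance tends to 0, so no value jump survives
          and \<beta> is enough.\<close>
        have "An n s = Bn n s * (s - t n i)" for n
          using S[OF ik(1,3)] by (simp add: An_def Bn_def Is)
        then have "(\<lambda>n. Bn (r n) s * (s - t (r n) i)) \<longlonglongrightarrow> A s" using A[OF s] by simp
        moreover have "(\<lambda>n. Bn (r n) s * (s - t (r n) i)) \<longlonglongrightarrow> B s * (s - \<tau> i)"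
          using LIMSEQ_subseq_LIMSEQ[OF lim[OF ik(1)] r(1)] by (intro tendsto_intros B s) (simp add: comp_def)
        ultimately have "A s = 0" using LIMSEQ_unique ik(2) by fastforce
        then show ?thesis using \<beta> ik(3) by (simp add: Is node_cost_def)
      qed
    qed
  qed
  then have "(\<Sum>s\<in>T. node_cost \<alpha> \<beta> (A s) (B s)) \<le> (\<Sum>s\<in>T. \<Sum>i\<in>I s. if i \<in> S then \<alpha> else \<beta>)"
    by (rule sum_mono)
  then show ?thesis using r(1) conv unfolding T_def[symmetric] group by blast
qed

section \<open>Convex combinations in the space of square-integrable functions\<close>

text \<open>Fatou with a convergent sequence of upper bounds. It also yields integrability of the
  limit, which is how limits are seen to be square-integrable.\<close>

lemma fatou_real:
  fixes f :: "nat \<Rightarrow> 'a \<Rightarrow> real"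
  assumes int: "\<And>n. integrable M (f n)" and nonneg: "\<And>n x. 0 \<le> f n x"
    and lim: "AE x in M. (\<lambda>n. f n x) \<longlonglongrightarrow> F x" and F: "F \<in> borel_measurable M" "\<And>x. 0 \<le> F x"
    and le: "\<And>n. (LINT x|M. f n x) \<le> c n" and c: "c \<longlonglongrightarrow> c0"
  shows "integrable M F" "(LINT x|M. F x) \<le> c0"
proof -
  have "0 \<le> c n" for n
    by (rule order_trans[OF Bochner_Integration.integral_nonneg le]) (rule nonneg)
  then have c0: "0 \<le> c0" using LIMSEQ_le_const[OF c] by blast
  have "(\<integral>\<^sup>+x. ennreal (F x) \<partial>M) = (\<integral>\<^sup>+x. liminf (\<lambda>n. ennreal (f n x)) \<partial>M)"
  proof (rule nn_integral_cong_AE)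
    show "AE x in M. ennreal (F x) = liminf (\<lambda>n. ennreal (f n x))"
      using lim
    proof eventually_elim
      case (elim x)
      then have "(\<lambda>n. ennreal (f n x)) \<longlonglongrightarrow> ennreal (F x)" by (rule tendsto_ennrealI)
      then show ?case by (intro lim_imp_Liminf[symmetric]) auto
    qed
  qed
  also have "\<dots> \<le> liminf (\<lambda>n. \<integral>\<^sup>+x. ennreal (f n x) \<partial>M)"
    using int by (intro nn_integral_liminf) auto
  also have "\<dots> \<le> liminf (\<lambda>n. ennreal (c n))"
  proof (rule Liminf_mono, rule always_eventually, rule allI)
    fix n
    have "(\<integral>\<^sup>+x. ennreal (f n x) \<partial>M) = ennreal (LINT x|M. f n x)"
      using int nonneg by (intro nn_integral_eq_integral) auto
    then show "(\<integral>\<^sup>+x. ennreal (f n x) \<partial>M) \<le> ennreal (c n)" using le by (simp add: ennreal_leI)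
  qed
  also have "\<dots> = ennreal c0"
    using tendsto_ennrealI[OF c] by (intro lim_imp_Liminf) auto
  finally have *: "(\<integral>\<^sup>+x. ennreal (F x) \<partial>M) \<le> ennreal c0" .
  show i: "integrable M F"
    using F * by (intro integrableI_bounded) (auto simp: le_less_trans)
  have "ennreal (LINT x|M. F x) \<le> ennreal c0"
    using * i F by (subst nn_integral_eq_integral[symmetric]) auto
  then show "(LINT x|M. F x) \<le> c0" using c0 by simp
qed

definition tail_weights :: "nat \<Rightarrow> nat \<Rightarrow> (nat \<Rightarrow> real) \<Rightarrow> bool" where
  "tail_weights m N l \<longleftrightarrow> (\<forall>n. 0 \<le> l n) \<and> sum l {m..<N} = 1"

text \<open>Padding with zeros. It makes the hulls of the tails decrease with m and puts two
  combinations on a common window.\<close>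

lemma tail_weights_extend:
  assumes "tail_weights m' N l" "m \<le> m'" "N \<le> N'"
  obtains l' where "tail_weights m N' l'" "\<And>f :: nat \<Rightarrow> real. (\<Sum>n\<in>{m..<N'}. l' n * f n) = (\<Sum>n\<in>{m'..<N}. l n * f n)"
proof -
  define l' where "l' n = (if n \<in> {m'..<N} then l n else 0)" for n
  have eq: "(\<Sum>n\<in>{m..<N'}. l' n * f n) = (\<Sum>n\<in>{m'..<N}. l n * f n)" for f :: "nat \<Rightarrow> real"
    using assms(2,3) by (intro sum.mono_neutral_cong_right) (auto simp: l'_def)
  moreover have "tail_weights m N' l'"
    using assms(1) eq[of "\<lambda>_. 1"] by (auto simp: tail_weights_def l'_def)
  ultimately show ?thesis using that by blast
qed

text \<open>A weighted mean of values close to y0 is close to y0, and the windows move to infinity.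
  Pointwise limits therefore survive the passage to tail combinations, however the weights are
  chosen.\<close>

lemma tail_weights_tendsto:
  assumes "\<And>j. tail_weights j (N j) (l j)" and y: "y \<longlonglongrightarrow> y0"
  shows "(\<lambda>j. \<Sum>n\<in>{j..<N j}. l j n * y n) \<longlonglongrightarrow> (y0 :: real)"
proof (rule LIMSEQ_I)
  fix e :: real assume "0 < e"
  then obtain M where M: "\<And>n. n \<ge> M \<Longrightarrow> norm (y n - y0) < e / 2"
    using LIMSEQ_D[OF y, of "e/2"] by auto
  have "norm ((\<Sum>n\<in>{j..<N j}. l j n * y n) - y0) < e" if "j \<ge> M" for j
  proof -
    have l: "\<And>n. 0 \<le> l j n" "sum (l j) {j..<N j} = 1" using assms(1)[of j] by (auto simp: tail_weights_def)
    have "(\<Sum>n\<in>{j..<N j}. l j n * y n) - y0 = (\<Sum>n\<in>{j..<N j}. l j n * y n) - sum (l j) {j..<N j} * y0"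
      using l(2) by simp
    also have "\<dots> = (\<Sum>n\<in>{j..<N j}. l j n * (y n - y0))"
      by (simp add: sum_distrib_right right_diff_distrib sum_subtractf)
    finally have "norm ((\<Sum>n\<in>{j..<N j}. l j n * y n) - y0) \<le> (\<Sum>n\<in>{j..<N j}. norm (l j n * (y n - y0)))"
      by (simp only: sum_abs real_norm_def)
    also have "\<dots> \<le> (\<Sum>n\<in>{j..<N j}. l j n * (e / 2))"
    proof (rule sum_mono)
      fix n assume "n \<in> {j..<N j}"
      then have "\<bar>y n - y0\<bar> \<le> e / 2" using M[of n] that by simp
      then show "norm (l j n * (y n - y0)) \<le> l j n * (e / 2)"
        using mult_left_mono[OF _ l(1)[of n]] l(1)[of n] by (simp only: real_norm_def abs_mult abs_of_nonneg)
    qed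
    also have "\<dots> = e / 2" unfolding sum_distrib_right[symmetric] l(2) by simp
    finally show ?thesis using \<open>0 < e\<close> by simp
  qed
  then show "\<exists>M. \<forall>j\<ge>M. norm ((\<Sum>n\<in>{j..<N j}. l j n * y n) - y0) < e" by blast
qed

text \<open>Jensen's inequality for the square, read off from the nonnegative variance around the
  mean Y.\<close>

lemma tail_weights_square:
  assumes "tail_weights m N l"
  shows "(\<Sum>n\<in>{m..<N}. l n * y n)\<^sup>2 \<le> (\<Sum>n\<in>{m..<N}. l n * (y n)\<^sup>2 :: real)"
proof -
  define Y where "Y = (\<Sum>n\<in>{m..<N}. l n * y n)"
  have l: "\<And>n. 0 \<le> l n" "sum l {m..<N} = 1" using assms by (auto simp: tail_weights_def)
  have "0 \<le> (\<Sum>n\<in>{m..<N}. l n * (y n - Y)\<^sup>2)" using l by (intro sum_nonneg) auto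
  also have "\<dots> = (\<Sum>n\<in>{m..<N}. l n * (y n)\<^sup>2 - 2 * Y * (l n * y n) + Y\<^sup>2 * l n)"
    by (rule sum.cong) (auto simp: power2_diff algebra_simps)
  also have "\<dots> = (\<Sum>n\<in>{m..<N}. l n * (y n)\<^sup>2) - 2 * Y * Y + Y\<^sup>2 * 1"
    unfolding sum.distrib sum_subtractf sum_distrib_left[symmetric] Y_def[symmetric] l(2) ..
  finally show ?thesis unfolding Y_def[symmetric] by (simp add: power2_eq_square)
qed

text \<open>Near-minimizers of the norm over the convex hulls of the tails are Cauchy by the parallelogram
  identity; this replaces weak compactness.\<close>

lemma komlos:
  assumes g: "\<And>n. g n \<in> L2 a b" and C: "\<And>n. (LINT x|leb a b. (g n x)\<^sup>2) \<le> C"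
  shows "\<exists>N l h. (\<forall>j. tail_weights j (N j) (l j)) \<and> h \<in> L2 a b \<and>
    (AE x in leb a b. (\<lambda>j. \<Sum>n\<in>{j..<N j}. l j n * g n x) \<longlonglongrightarrow> h x) \<and>
    (\<lambda>j. LINT x|leb a b. \<bar>(\<Sum>n\<in>{j..<N j}. l j n * g n x) - h x\<bar>) \<longlonglongrightarrow> 0"
proof -
  define K where "K m = {u. \<exists>N l. tail_weights m N l \<and> u = (\<lambda>x. \<Sum>n\<in>{m..<N}. l n * g n x)}" for m
  define J where "J u = (LINT x|leb a b. (u x)\<^sup>2)" for u :: "real \<Rightarrow> real"
  have KL2: "u \<in> L2 a b" if "u \<in> K m" for u m
    using that by (auto simp: K_def intro!: L2_sum L2_cmult g)
  have J0: "0 \<le> J u" for u unfolding J_def by (rule Bochner_Integration.integral_nonneg) simp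
  \<comment> \<open>On the one-point window \<open>{m..<Suc m}\<close> the constant weight 1 is a
    convex weight.\<close>
  have gK: "g m \<in> K m" for m
    unfolding K_def by (intro CollectI exI[of _ "Suc m"] exI[of _ "\<lambda>_. 1"]) (auto simp: tail_weights_def)
  have antimono: "K m' \<subseteq> K m" if le: "m \<le> m'" for m m'
  proof
    fix u assume "u \<in> K m'"
    then obtain N l where u: "tail_weights m' N l" "u = (\<lambda>x. \<Sum>n\<in>{m'..<N}. l n * g n x)" by (auto simp: K_def)
    obtain l' where l': "tail_weights m N l'" "\<And>f. (\<Sum>n\<in>{m..<N}. l' n * f n) = (\<Sum>n\<in>{m'..<N}. l n * f n :: real)"
      using tail_weights_extend[OF u(1) le order_refl] by blast
    then show "u \<in> K m" unfolding K_def u(2) by (intro CollectI exI[of _ N] exI[of _ l']) simp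
  qed
  have mid: "(\<lambda>x. (u x + v x) / 2) \<in> K m" if u: "u \<in> K m" and v: "v \<in> K m" for u v m
  proof -
    obtain N l where 1: "tail_weights m N l" "u = (\<lambda>x. \<Sum>n\<in>{m..<N}. l n * g n x)" using u by (auto simp: K_def)
    obtain N' l' where 2: "tail_weights m N' l'" "v = (\<lambda>x. \<Sum>n\<in>{m..<N'}. l' n * g n x)" using v by (auto simp: K_def)
    obtain k where k: "tail_weights m (max N N') k" "\<And>f. (\<Sum>n\<in>{m..<max N N'}. k n * f n) = (\<Sum>n\<in>{m..<N}. l n * f n :: real)"
      using tail_weights_extend[OF 1(1) order_refl, of "max N N'"] by auto
    obtain k' where k': "tail_weights m (max N N') k'" "\<And>f. (\<Sum>n\<in>{m..<max N N'}. k' n * f n) = (\<Sum>n\<in>{m..<N'}. l' n * f n :: real)"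
      using tail_weights_extend[OF 2(1) order_refl, of "max N N'"] by auto
    have "tail_weights m (max N N') (\<lambda>n. (k n + k' n) / 2)"
      using k(1) k'(1) by (auto simp: tail_weights_def sum.distrib simp flip: sum_divide_distrib)
    moreover have "(\<lambda>x. (u x + v x) / 2) = (\<lambda>x. \<Sum>n\<in>{m..<max N N'}. (k n + k' n) / 2 * g n x)"
      unfolding 1(2) 2(2) k(2)[symmetric] k'(2)[symmetric] sum.distrib[symmetric] sum_divide_distrib
      by (intro ext sum.cong) (auto simp: algebra_simps add_divide_distrib)
    ultimately show ?thesis unfolding K_def by blast
  qed
  \<comment> \<open>The squared distance of 0 from the hull of the m-th tail: increasing in m
    because the hulls shrink, and bounded by C.\<close>
  define d where "d m = Inf (J ` K m)" for m
  have bdd: "bdd_below (J ` K m)" for m by (rule bdd_belowI[of _ 0]) (use J0 in auto)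
  have d_le: "d m \<le> J u" if "u \<in> K m" for m u
    unfolding d_def using bdd that by (intro cInf_lower) auto
  have "incseq d"
    unfolding incseq_def d_def
  proof (intro allI impI cInf_superset_mono bdd)
    fix m n :: nat assume "m \<le> n"
    then show "J ` K n \<subseteq> J ` K m" by (intro image_mono antimono)
    show "J ` K n \<noteq> {}" using gK by blast
  qed
  moreover have "d m \<le> C" for m using d_le[OF gK[of m]] C[of m] by (simp add: J_def)
  ultimately obtain D where D: "d \<longlonglongrightarrow> D" "\<And>m. d m \<le> D"
    using incseq_convergent[of d C] by blast
  have "\<exists>u\<in>K m. J u < d m + 1 / (real m + 1)" for m
  proof -
    have "Inf (J ` K m) < d m + 1 / (real m + 1)" by (simp add: d_def add_pos_pos)
    then show ?thesis using cInf_lessD[of "J ` K m"] gK[of m] by blast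
  qed
  then obtain u where u: "\<And>m. u m \<in> K m" "\<And>m. J (u m) < d m + 1 / (real m + 1)" by metis
  \<comment> \<open>The parallelogram identity gives 2 J (u n) + 2 J (u m) minus 4 times J of the
    midpoint. The midpoint lies in the n-th hull and costs at least d n, while the near-minimizers
    add up to at most 2 d n + 2 D + 4/(n+1).\<close>
  define \<epsilon> where "\<epsilon> n = 2 * (D - d n) + 4 / (real n + 1)" for n
  have cauchy: "J (\<lambda>x. u m x - u n x) \<le> \<epsilon> n" if "n \<le> m" for m n
  proof -
    have L: "u n \<in> L2 a b" "u m \<in> L2 a b" using u(1) KL2 by auto
    then have i: "integrable (leb a b) (\<lambda>x. (u n x)\<^sup>2)" "integrable (leb a b) (\<lambda>x. (u m x)\<^sup>2)"
      "integrable (leb a b) (\<lambda>x. ((u n x + u m x) / 2)\<^sup>2)"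
      using L2_cmult[OF L2_add[OF L], of "1/2"] by (auto simp: L2_iff)
    have "J (\<lambda>x. u m x - u n x) = (LINT x|leb a b. 2 * (u n x)\<^sup>2 + 2 * (u m x)\<^sup>2 - 4 * ((u n x + u m x) / 2)\<^sup>2)"
      unfolding J_def by (rule LINT_cong) (auto simp: power2_eq_square field_simps)
    also have "\<dots> = 2 * J (u n) + 2 * J (u m) - 4 * J (\<lambda>x. (u n x + u m x) / 2)"
      unfolding J_def using i by simp
    finally have "J (\<lambda>x. u m x - u n x) = 2 * J (u n) + 2 * J (u m) - 4 * J (\<lambda>x. (u n x + u m x) / 2)" .
    moreover have "d n \<le> J (\<lambda>x. (u n x + u m x) / 2)"
      using u(1)[of n] u(1)[of m] antimono[OF that] by (intro d_le mid) auto
    moreover have "1 / (real m + 1) \<le> 1 / (real n + 1)" using that by (simp add: field_simps)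
    moreover have "\<epsilon> n = 2 * D - 2 * d n + 4 * (1 / (real n + 1))" by (simp add: \<epsilon>_def)
    ultimately show ?thesis using u(2)[of n] u(2)[of m] D(2)[of m] by linarith
  qed
  have "\<epsilon> \<longlonglongrightarrow> 2 * (D - D) + 0"
    unfolding \<epsilon>_def
  proof (intro tendsto_intros D(1))
    have "(\<lambda>n. 4 * inverse (real (Suc n))) \<longlonglongrightarrow> 4 * 0" by (intro tendsto_intros LIMSEQ_inverse_real_of_nat)
    then show "(\<lambda>n. 4 / (real n + 1)) \<longlonglongrightarrow> 0" by (simp add: divide_inverse add.commute)
  qed
  then have \<epsilon>0: "\<epsilon> \<longlonglongrightarrow> 0" by simp
  \<comment> \<open>A fast subsequence: increments of squared norm at most 4^-j have summable L1
    norms, so that the telescoping series converges absolutely almost everywhere.\<close>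
  have "\<exists>n0. \<forall>n\<ge>n0. \<epsilon> n \<le> (1/4) ^ j" for j
    using LIMSEQ_D[OF \<epsilon>0, of "(1/4)^j"] by fastforce
  then obtain n0 where n0: "\<And>j n. n \<ge> n0 j \<Longrightarrow> \<epsilon> n \<le> (1/4) ^ j" by metis
  define q where "q = rec_nat (n0 0) (\<lambda>j qj. max (Suc qj) (n0 (Suc j)))"
  have q: "strict_mono q" by (auto simp: strict_mono_Suc_iff q_def)
  have qn: "n0 j \<le> q j" for j by (cases j) (auto simp: q_def)
  define f where "f j x = u (q (Suc j)) x - u (q j) x" for j x
  have L2u: "u m \<in> L2 a b" for m using u(1) KL2 by blast
  have f2: "f j \<in> L2 a b" for j unfolding f_def using L2_diff[OF L2u L2u] .
  have fJ: "J (f j) \<le> (1/4) ^ j" for j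
    using cauchy[of "q j" "q (Suc j)"] strict_monoD[OF q, of j "Suc j"] n0[OF qn[of j]] by (simp add: f_def[abs_def])
  define L where "L = (LINT x|leb a b. (1::real))"
  \<comment> \<open>From \<bar>f\<bar> \<le> \<delta>/2 + f^2/(2 \<delta>) with \<delta> = 2^-j: as
    J (f j) is at most 4^-j, both terms are of order 2^-j.\<close>
  have f1: "(LINT x|leb a b. \<bar>f j x\<bar>) \<le> (L + 1) / 2 * (1/2) ^ j" for j
  proof -
    have "(LINT x|leb a b. \<bar>f j x\<bar>) \<le> (LINT x|leb a b. (1/2)^j / 2 * 1 + 2^j / 2 * (f j x)\<^sup>2)"
    proof (rule integral_mono)
      show "integrable (leb a b) (\<lambda>x. \<bar>f j x\<bar>)" using L2_integrable[OF f2] by simp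
      show "integrable (leb a b) (\<lambda>x. (1/2)^j / 2 * 1 + 2^j / 2 * (f j x)\<^sup>2)"
        using f2[of j] by (auto simp: L2_iff)
      fix x
      define \<delta> :: real where "\<delta> = (1/2) ^ j"
      have \<delta>: "0 < \<delta>" "2 ^ j = 1 / \<delta>" by (auto simp: \<delta>_def power_one_over)
      have "0 \<le> (\<bar>f j x\<bar> - \<delta>)\<^sup>2" by simp
      then have "2 * \<bar>f j x\<bar> * \<delta> \<le> (f j x)\<^sup>2 + \<delta>\<^sup>2" by (simp add: power2_diff)
      then have "\<bar>f j x\<bar> \<le> \<delta> / 2 * 1 + (1 / \<delta>) / 2 * (f j x)\<^sup>2"
        using \<delta>(1) by (simp add: field_simps power2_eq_square)
      then show "\<bar>f j x\<bar> \<le> (1/2)^j / 2 * 1 + 2^j / 2 * (f j x)\<^sup>2" unfolding \<delta>(2) by (simp add: \<delta>_def)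
    qed
    also have "\<dots> = (1/2)^j / 2 * L + 2^j / 2 * J (f j)"
      unfolding L_def J_def using f2[of j] by (subst Bochner_Integration.integral_add) (auto simp: L2_iff)
    also have "\<dots> \<le> (1/2)^j / 2 * L + 2^j / 2 * (1/4)^j"
      using fJ[of j] by (intro add_left_mono mult_left_mono) auto
    also have "(2::real)^j / 2 * (1/4)^j = (1/2)^j / 2"
      by (simp flip: power_mult_distrib)
    finally show ?thesis by (simp add: algebra_simps add_divide_distrib)
  qed
  have sumf: "summable (\<lambda>j. LINT x|leb a b. \<bar>f j x\<bar>)"
  proof (rule summable_comparison_test'[where N = 0])
    show "summable (\<lambda>j. (L + 1) / 2 * (1/2) ^ j)" by (intro summable_mult summable_geometric) simp
    show "norm (LINT x|leb a b. \<bar>f j x\<bar>) \<le> (L + 1) / 2 * (1/2) ^ j" for j using f1[of j] by simp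
  qed
  have fi: "integrable (leb a b) (\<lambda>x. \<bar>f j x\<bar>)" for j using L2_integrable[OF f2] by simp
  have aesum: "AE x in leb a b. summable (\<lambda>j. \<bar>f j x\<bar>)"
  proof -
    have "(\<integral>\<^sup>+x. (\<Sum>j. ennreal \<bar>f j x\<bar>) \<partial>leb a b) = (\<Sum>j. \<integral>\<^sup>+x. ennreal \<bar>f j x\<bar> \<partial>leb a b)"
      using borel_measurable_integrable[OF fi] by (intro nn_integral_suminf) auto
    also have "\<dots> = (\<Sum>j. ennreal (LINT x|leb a b. \<bar>f j x\<bar>))"
      using fi by (subst nn_integral_eq_integral) auto
    also have "\<dots> < \<infinity>"
      using sumf by (subst suminf_ennreal2) (auto intro: Bochner_Integration.integral_nonneg)
    finally have "AE x in leb a b. (\<Sum>j. ennreal \<bar>f j x\<bar>) \<noteq> \<infinity>"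
      using borel_measurable_integrable[OF fi]
      by (intro nn_integral_PInf_AE) (auto intro!: borel_measurable_suminf_order measurable_compose[OF _ measurable_ennreal])
    then show ?thesis
      by eventually_elim (auto intro!: summable_suminf_not_top)
  qed
  define h where "h x = u (q 0) x + (\<Sum>j. f j x)" for x
  \<comment> \<open>W dominates h and all its partial sums almost everywhere, so 2 W serves as the
    bound in dominated convergence.\<close>
  define W where "W x = \<bar>u (q 0) x\<bar> + (\<Sum>j. \<bar>f j x\<bar>)" for x
  have tele: "u (q j) x = u (q 0) x + (\<Sum>i<j. f i x)" for j x
    unfolding f_def using sum_lessThan_telescope[of "\<lambda>i. u (q i) x" j] by simp
  have hi: "integrable (leb a b) h"
    unfolding h_def using aesum sumf L2_integrable[OF f2] L2_integrable[OF L2u]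
    by (intro Bochner_Integration.integrable_add integrable_suminf) auto
  have Wi: "integrable (leb a b) W"
    unfolding W_def using aesum sumf L2_integrable[OF f2] L2_integrable[OF L2u]
    by (intro Bochner_Integration.integrable_add integrable_suminf Bochner_Integration.integrable_abs) auto
  have aelim: "AE x in leb a b. (\<lambda>j. u (q j) x) \<longlonglongrightarrow> h x"
    using aesum
  proof eventually_elim
    case (elim x)
    then have "summable (\<lambda>j. f j x)" by (rule summable_rabs_cancel)
    then have "(\<lambda>j. u (q 0) x + (\<Sum>i<j. f i x)) \<longlonglongrightarrow> h x"
      unfolding h_def by (intro tendsto_add tendsto_const summable_LIMSEQ)
    moreover have "(\<lambda>j. u (q j) x) = (\<lambda>j. u (q 0) x + (\<Sum>i<j. f i x))" by (rule ext) (rule tele)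
    ultimately show ?case by (simp only:)
  qed
  have "(\<lambda>j. LINT x|leb a b. \<bar>u (q j) x - h x\<bar>) \<longlonglongrightarrow> (LINT x|leb a b. 0)"
  proof (rule integral_dominated_convergence[where w = "\<lambda>x. 2 * W x"])
    show "AE x in leb a b. (\<lambda>j. \<bar>u (q j) x - h x\<bar>) \<longlonglongrightarrow> 0"
      using aelim by eventually_elim (auto intro: tendsto_rabs_zero LIM_zero)
    show "AE x in leb a b. norm \<bar>u (q j) x - h x\<bar> \<le> 2 * W x" for j
      using aesum
    proof eventually_elim
      case (elim x)
      have 1: "\<bar>\<Sum>i<j. f i x\<bar> \<le> (\<Sum>i. \<bar>f i x\<bar>)"
      proof -
        have "\<bar>\<Sum>i<j. f i x\<bar> \<le> (\<Sum>i<j. \<bar>f i x\<bar>)" by (rule sum_abs)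
        also have "\<dots> \<le> (\<Sum>i. \<bar>f i x\<bar>)" using elim by (intro sum_le_suminf) auto
        finally show ?thesis .
      qed
      have 2: "\<bar>\<Sum>i. f i x\<bar> \<le> (\<Sum>i. \<bar>f i x\<bar>)" using elim by (rule summable_rabs)
      show ?case using 1 2 unfolding tele[of j x] h_def W_def by (simp add: abs_if split: if_splits)
    qed
  qed (use hi Wi L2_integrable[OF L2u] in auto)
  then have lim1: "(\<lambda>j. LINT x|leb a b. \<bar>u (q j) x - h x\<bar>) \<longlonglongrightarrow> 0" by simp
  have h2: "h \<in> L2 a b"
    unfolding L2_iff
  proof
    show "h \<in> borel_measurable (leb a b)" using hi by simp
    show "integrable (leb a b) (\<lambda>x. (h x)\<^sup>2)"
    proof (rule fatou_real(1)[where f = "\<lambda>j x. (u (q j) x)\<^sup>2" and c = "\<lambda>_. D + 1"])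
      show "integrable (leb a b) (\<lambda>x. (u (q j) x)\<^sup>2)" for j using L2u by (auto simp: L2_iff)
      show "AE x in leb a b. (\<lambda>j. (u (q j) x)\<^sup>2) \<longlonglongrightarrow> (h x)\<^sup>2"
        using aelim by eventually_elim (rule tendsto_power)
      show "(LINT x|leb a b. (u (q j) x)\<^sup>2) \<le> D + 1" for j
      proof -
        have "1 / (real (q j) + 1) \<le> 1" by simp
        then show ?thesis using u(2)[of "q j"] D(2)[of "q j"] unfolding J_def by linarith
      qed
    qed (use hi in auto)
  qed
  \<comment> \<open>Since j \<le> q j, the subsequence still consists of combinations from the j-th
    tail.\<close>
  have "u (q j) \<in> K j" for j using u(1)[of "q j"] antimono[OF seq_suble[OF q]] by blast
  then have "\<forall>j. \<exists>N l. tail_weights j N l \<and> u (q j) = (\<lambda>x. \<Sum>n\<in>{j..<N}. l n * g n x)"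
    unfolding K_def by blast
  then obtain N l where "\<And>j. tail_weights j (N j) (l j)" "\<And>j. u (q j) = (\<lambda>x. \<Sum>n\<in>{j..<N j}. l j n * g n x)"
    by metis
  then show ?thesis using h2 aelim lim1 by (intro exI[of _ N] exI[of _ l] exI[of _ h]) simp
qed

section \<open>Existence of a minimizer\<close>

lemma prim_sum:
  assumes "finite I" "\<And>i. i \<in> I \<Longrightarrow> integrable (leb a b) (g i)" "x \<le> b"
  shows "prim a (\<lambda>y. \<Sum>i\<in>I. l i * g i y) x = (\<Sum>i\<in>I. l i * prim a (g i) x)"
proof -
  have "(g i) integrable_on {a..x}" if "i \<in> I" for i
    using leb_integrable_on[OF assms(2)[OF that], of a x] assms(3) by simp
  then show ?thesis
    unfolding prim_def using assms(1)
    by (subst Henstock_Kurzweil_Integration.integral_sum) (auto intro: integrable_on_mult_right)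
qed

lemma prim2_sum:
  assumes "finite I" "\<And>i. i \<in> I \<Longrightarrow> integrable (leb a b) (g i)" "x \<le> b"
  shows "prim a (prim a (\<lambda>y. \<Sum>i\<in>I. l i * g i y)) x = (\<Sum>i\<in>I. l i * prim a (prim a (g i)) x)"
proof -
  have "prim a (prim a (\<lambda>y. \<Sum>i\<in>I. l i * g i y)) x = prim a (\<lambda>y. \<Sum>i\<in>I. l i * prim a (g i) y) x"
    unfolding prim_def[of a "prim a (\<lambda>y. \<Sum>i\<in>I. l i * g i y)"] prim_def[of a "\<lambda>y. \<Sum>i\<in>I. l i * prim a (g i) y"]
    by (rule HK_integral_cong) (use prim_sum[OF assms(1,2)] assms(3) in auto)
  also have "\<dots> = (\<Sum>i\<in>I. l i * prim a (prim a (g i)) x)"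
    by (rule prim_sum[OF assms(1) integrable_prim[OF assms(2)] assms(3)])
  finally show ?thesis .
qed

lemma leb_LINT_const: "a \<le> b \<Longrightarrow> (LINT x|leb a b. c) = (b - a) * (c::real)"
  unfolding leb_LINT[OF leb_integrable_const] by simp

lemma prim2_bound:
  assumes g: "integrable (leb a b) g" and x: "x \<in> {a..b}"
  shows "\<bar>prim a (prim a g) x\<bar> \<le> (b - a) * (LINT y|leb a b. \<bar>g y\<bar>)"
proof -
  have "\<bar>prim a (prim a g) x\<bar> \<le> (LINT y|leb a b. \<bar>prim a g y\<bar>)"
    by (rule prim_bound[OF integrable_prim[OF g] x])
  also have "\<dots> \<le> (LINT y|leb a b. (LINT y|leb a b. \<bar>g y\<bar>))"
    by (rule integral_mono) (use integrable_prim[OF g] prim_bound[OF g] in auto)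
  also have "\<dots> = (b - a) * (LINT y|leb a b. \<bar>g y\<bar>)"
    using x by (subst leb_LINT_const) auto
  finally show ?thesis .
qed

lemma prim2_diff_bound:
  assumes g: "integrable (leb a b) g" "integrable (leb a b) h" and x: "x \<in> {a..b}"
  shows "\<bar>prim a (prim a g) x - prim a (prim a h) x\<bar> \<le> (b - a) * (LINT y|leb a b. \<bar>g y - h y\<bar>)"
proof -
  \<comment> \<open>The difference is written as a sum over the booleans with coefficients 1 and -1,
    so that linearity is an instance of \<open>prim2_sum\<close>.\<close>
  have "prim a (prim a (\<lambda>y. \<Sum>i\<in>{True, False}. (if i then 1 else -1) * (if i then g else h) y)) x
    = (\<Sum>i\<in>{True, False}. (if i then 1 else -1) * prim a (prim a (if i then g else h)) x)"
    by (rule prim2_sum[where b = b]) (use g x in auto)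
  then have "prim a (prim a (\<lambda>y. g y - h y)) x = prim a (prim a g) x - prim a (prim a h) x"
    by simp
  then show ?thesis using prim2_bound[of a b "\<lambda>y. g y - h y" x] g x by simp
qed

lemma LINT_abs_le_square:
  assumes "g \<in> L2 a b" "a \<le> b"
  shows "(LINT x|leb a b. \<bar>g x\<bar>) \<le> (b - a) + (LINT x|leb a b. (g x)\<^sup>2)"
proof -
  have "(LINT x|leb a b. \<bar>g x\<bar>) \<le> (LINT x|leb a b. 1 + (g x)\<^sup>2)"
  proof (rule integral_mono)
    fix x
    have "0 \<le> (\<bar>g x\<bar> - 1)\<^sup>2" by simp
    then have "2 * \<bar>g x\<bar> \<le> 1 + (g x)\<^sup>2" by (simp add: power2_diff)
    then show "\<bar>g x\<bar> \<le> 1 + (g x)\<^sup>2" by simp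
  qed (use assms(1) L2_integrable[OF assms(1)] in \<open>auto simp: L2_iff\<close>)
  also have "\<dots> = (b - a) + (LINT x|leb a b. (g x)\<^sup>2)"
    using assms leb_LINT_const[of a b 1] by (simp add: L2_iff)
  finally show ?thesis .
qed

lemma ramp_L2: "(\<lambda>x. if t < x then p + q * (x - t) else 0) \<in> L2 a b"
proof (rule L2_bounded)
  have "(\<lambda>x. if t < x then p + q * (x - t) else 0) \<in> borel_measurable borel" by measurable
  then show "(\<lambda>x. if t < x then p + q * (x - t) else 0) \<in> borel_measurable (leb a b)"
    by (intro measurable_restrict_space1 measurable_completion) simp
  fix x assume "x \<in> {a<..<b}"
  then have "\<bar>x - t\<bar> \<le> \<bar>a\<bar> + \<bar>b\<bar> + \<bar>t\<bar>" by auto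
  then have "\<bar>q * (x - t)\<bar> \<le> \<bar>q\<bar> * (\<bar>a\<bar> + \<bar>b\<bar> + \<bar>t\<bar>)" by (simp add: abs_mult mult_left_mono)
  moreover have "\<bar>p + q * (x - t)\<bar> \<le> \<bar>p\<bar> + \<bar>q * (x - t)\<bar>" by (rule abs_triangle_ineq)
  moreover have "0 \<le> \<bar>p\<bar> + \<bar>q\<bar> * (\<bar>a\<bar> + \<bar>b\<bar> + \<bar>t\<bar>)" by simp
  ultimately have "\<bar>p + q * (x - t)\<bar> \<le> \<bar>p\<bar> + \<bar>q\<bar> * (\<bar>a\<bar> + \<bar>b\<bar> + \<bar>t\<bar>)" by linarith
  then show "\<bar>if t < x then p + q * (x - t) else 0\<bar> \<le> \<bar>p\<bar> + \<bar>q\<bar> * (\<bar>a\<bar> + \<bar>b\<bar> + \<bar>t\<bar>)" by simp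
qed

lemma LINT_indicator_subinterval:
  fixes f :: "real \<Rightarrow> real"
  assumes "a \<le> p" "q \<le> b"
  shows "(LINT x|leb a b. indicator {p<..<q} x * f x) = (LINT x|leb p q. f x)"
    "integrable (leb p q) f \<Longrightarrow> integrable (leb a b) (\<lambda>x. indicator {p<..<q} x * f x)"
proof -
  have eq: "(\<lambda>x. indicator {a<..<b} x * (indicator {p<..<q} x * f x)) = (\<lambda>x. indicator {p<..<q} x * f x)"
    using assms by (auto intro!: ext split: split_indicator)
  show "(LINT x|leb a b. indicator {p<..<q} x * f x) = (LINT x|leb p q. f x)"
    unfolding leb_LINT_UNIV eq ..
  show "integrable (leb a b) (\<lambda>x. indicator {p<..<q} x * f x)" if "integrable (leb p q) f"
    using that unfolding leb_integrable_iff_UNIV eq .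
qed

text \<open>The nodes enter already indexed by a fixed range and convergent, with a fixed set S of
  possible value jumps. The cost to compare with is thus one constant for the whole sequence, and
  \<open>e\<close> bounds the quadratic part alone; z is a general target that can absorb the linear
  term.\<close>

lemma pw_limit:
  fixes t a b :: "nat \<Rightarrow> nat \<Rightarrow> real" and \<tau> e :: "nat \<Rightarrow> real" and V p g :: "nat \<Rightarrow> real \<Rightarrow> real"
  assumes w: "continuous_on {-2..2} w" and z: "z \<in> L2 (-1) 1"
    and g: "\<And>n. g n \<in> L2 (-2) 2" "\<And>n. (LINT x|leb (-2) 2. (g n x)\<^sup>2) \<le> C1"
    and t: "\<And>n i. i < k \<Longrightarrow> t n i \<in> {-1..1}" "\<And>i. i < k \<Longrightarrow> (\<lambda>n. t n i) \<longlonglongrightarrow> \<tau> i"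
    and S: "\<And>n i. i < k \<Longrightarrow> i \<notin> S \<Longrightarrow> a n i = 0"
    and p: "\<And>n x. p n x = (\<Sum>i<k. if t n i < x then a n i + b n i * (x - t n i) else 0)"
    and V: "\<And>n x. V n x = c + d * (x - (-2)) + prim (-2) (prim (-2) (g n)) x + p n x"
    and out: "\<And>n. AE x in leb (-2) (-1). V n x = w x" "\<And>n. AE x in leb 1 2. V n x = w x"
    and ob: "\<And>n. AE x in leb (-1) 1. w x \<le> V n x"
    and en: "\<And>n. (LINT x|leb (-1) 1. \<eta> * (g n x)\<^sup>2 + \<mu> * (V n x - z x)\<^sup>2) \<le> e n" "e \<longlonglongrightarrow> e0"
    and pos: "0 < \<eta>" "0 < \<mu>" and \<beta>: "0 < \<beta>" "\<beta> \<le> \<alpha>" "\<alpha> \<le> 2 * \<beta>"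
  obtains h A B where "h \<in> L2 (-2) 2"
    "(\<Sum>s\<in>\<tau> ` {..<k}. node_cost \<alpha> \<beta> (A s) (B s)) \<le> (\<Sum>i<k. if i \<in> S then \<alpha> else \<beta>)"
    "AE x in leb (-2) (-1). pw (-2) c d h (\<tau> ` {..<k}) A B x = w x"
    "AE x in leb 1 2. pw (-2) c d h (\<tau> ` {..<k}) A B x = w x"
    "AE x in leb (-1) 1. w x \<le> pw (-2) c d h (\<tau> ` {..<k}) A B x"
    "(LINT x|leb (-1) 1. \<eta> * (h x)\<^sup>2 + \<mu> * (pw (-2) c d h (\<tau> ` {..<k}) A B x - z x)\<^sup>2) \<le> e0"
proof -
  define T where "T = \<tau> ` {..<k}"
  have gi: "integrable (leb (-2) 2) (g n)" for n using g(1) by (rule L2_integrable)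
  define H where "H n x = c + d * (x - (-2)) + prim (-2) (prim (-2) (g n)) x" for n x
  have Hc: "continuous_on {-2..2} (H n)" for n
    unfolding H_def by (intro continuous_intros continuous_prim integrable_prim gi)
  have pL: "p n \<in> L2 (-2) 2" for n unfolding p by (intro L2_sum ramp_L2)
  have VH: "V n = (\<lambda>x. H n x + p n x)" for n by (rule ext) (simp add: V H_def)
  have VL: "V n \<in> L2 (-2) 2" for n unfolding VH by (intro L2_add L2_continuous Hc pL)
  have VL1: "V n \<in> L2 (-1) 1" for n by (rule L2_subset[OF VL]) auto
  have gL1: "g n \<in> L2 (-1) 1" for n by (rule L2_subset[OF g(1)]) auto
  obtain E where E: "\<And>n. e n \<le> E"
    using convergent_imp_Bseq[OF convergentI[OF en(2)]] by (auto simp: Bseq_def abs_le_iff)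
  \<comment> \<open>A pointwise bound for the part without jumps: x + 2 \<le> 4 on the interval, and
    the twofold primitive is at most 4 times the L1 norm of g, itself at most 4 + C1.\<close>
  define M where "M = \<bar>c\<bar> + 4 * \<bar>d\<bar> + 4 * (4 + C1)"
  have HM: "\<bar>H n x\<bar> \<le> M" if x: "x \<in> {-2..2}" for n x
  proof -
    have "\<bar>prim (-2) (prim (-2) (g n)) x\<bar> \<le> (2 - (-2)) * (LINT y|leb (-2) 2. \<bar>g n y\<bar>)"
      by (rule prim2_bound[OF gi x])
    also have "\<dots> \<le> 4 * (4 + C1)" using LINT_abs_le_square[OF g(1), of n] g(2)[of n] by simp
    finally have 1: "\<bar>prim (-2) (prim (-2) (g n)) x\<bar> \<le> 4 * (4 + C1)" .
    have "\<bar>d * (x - (-2))\<bar> \<le> \<bar>d\<bar> * 4" using x unfolding abs_mult by (intro mult_left_mono) auto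
    then show ?thesis using 1 unfolding H_def M_def by linarith
  qed
  \<comment> \<open>Since p = V - H, the bound (r - s)^2 \<le> 2 r^2 + 2 s^2 is used once for V - H
    and, on (-1,1), once more for V = (V - z) + z; outside, V is w. The energy bounds the squared
    norm of V - z by E / \<mu>.\<close>
  define C where "C = (LINT x|leb (-2) 2. 2 * (w x)\<^sup>2 + indicator {-1<..<1} x * (4 * (z x)\<^sup>2) + 2 * M\<^sup>2) + 4 * (E / \<mu>)"
  have bound: "integral {x..y} (\<lambda>\<xi>. (p n \<xi>)\<^sup>2) \<le> C" if "-2 < x" "x < y" "y < 2" for n x y
  proof -
    have pi: "integrable (leb (-2) 2) (\<lambda>\<xi>. (p n \<xi>)\<^sup>2)" using pL by (simp add: L2_iff)
    have "integral {x..y} (\<lambda>\<xi>. (p n \<xi>)\<^sup>2) \<le> integral {-2..2} (\<lambda>\<xi>. (p n \<xi>)\<^sup>2)"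
      using that by (intro integral_subset_le leb_integrable_on[OF pi]) auto
    also have "\<dots> = (LINT \<xi>|leb (-2) 2. (p n \<xi>)\<^sup>2)" by (rule leb_LINT[OF pi, symmetric])
    also have "\<dots> \<le> (LINT \<xi>|leb (-2) 2. (2 * (w \<xi>)\<^sup>2 + indicator {-1<..<1} \<xi> * (4 * (z \<xi>)\<^sup>2) + 2 * M\<^sup>2)
        + indicator {-1<..<1} \<xi> * (4 * (V n \<xi> - z \<xi>)\<^sup>2))"
    proof (rule integral_mono_AE[OF pi])
      have "AE \<xi> in leb (-2) 2. \<xi> \<notin> {-1, 1}" by (rule AE_leb_finite) simp
      then show "AE \<xi> in leb (-2) 2. (p n \<xi>)\<^sup>2 \<le> (2 * (w \<xi>)\<^sup>2 + indicator {-1<..<1} \<xi> * (4 * (z \<xi>)\<^sup>2) + 2 * M\<^sup>2)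
        + indicator {-1<..<1} \<xi> * (4 * (V n \<xi> - z \<xi>)\<^sup>2)"
        using out(1)[of n] out(2)[of n] unfolding AE_leb
      proof eventually_elim
        case (elim \<xi>)
        show ?case
        proof
          assume \<xi>: "\<xi> \<in> {-2<..<2}"
          have sq: "(r - s)\<^sup>2 \<le> 2 * r\<^sup>2 + 2 * s\<^sup>2" for r s :: real
            using sum_squares_bound[of r "-s"] by (simp add: power2_diff)
          have "(p n \<xi>)\<^sup>2 = (V n \<xi> - H n \<xi>)\<^sup>2" by (simp add: VH)
          also have "\<dots> \<le> 2 * (V n \<xi>)\<^sup>2 + 2 * (H n \<xi>)\<^sup>2" by (rule sq)
          also have "(H n \<xi>)\<^sup>2 \<le> M\<^sup>2" using HM[of \<xi> n] \<xi> power_mono[of "\<bar>H n \<xi>\<bar>" M 2] by auto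
          finally have 1: "(p n \<xi>)\<^sup>2 \<le> 2 * (V n \<xi>)\<^sup>2 + 2 * M\<^sup>2" by simp
          show "(p n \<xi>)\<^sup>2 \<le> (2 * (w \<xi>)\<^sup>2 + indicator {-1<..<1} \<xi> * (4 * (z \<xi>)\<^sup>2) + 2 * M\<^sup>2)
            + indicator {-1<..<1} \<xi> * (4 * (V n \<xi> - z \<xi>)\<^sup>2)"
          proof (cases "\<xi> \<in> {-1<..<1}")
            case True
            have "(V n \<xi>)\<^sup>2 \<le> 2 * (V n \<xi> - z \<xi>)\<^sup>2 + 2 * (z \<xi>)\<^sup>2"
              using sq[of "V n \<xi> - z \<xi>" "- z \<xi>"] by simp
            moreover have "indicat_real {-1<..<1} \<xi> = 1" using True by simp
            moreover have "0 \<le> (w \<xi>)\<^sup>2" by simp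
            ultimately show ?thesis using 1 by (simp only: mult_1)
          next
            case False
            then have "V n \<xi> = w \<xi>" using elim \<xi> by auto
            then show ?thesis using 1 False by simp
          qed
        qed
      qed
      show "integrable (leb (-2) 2) (\<lambda>\<xi>. (2 * (w \<xi>)\<^sup>2 + indicator {-1<..<1} \<xi> * (4 * (z \<xi>)\<^sup>2) + 2 * M\<^sup>2)
        + indicator {-1<..<1} \<xi> * (4 * (V n \<xi> - z \<xi>)\<^sup>2))"
        using L2_continuous[OF w] z L2_diff[OF VL1 z]
        by (intro Bochner_Integration.integrable_add LINT_indicator_subinterval(2)) (auto simp: L2_iff)
    qed
    also have "\<dots> = (LINT \<xi>|leb (-2) 2. 2 * (w \<xi>)\<^sup>2 + indicator {-1<..<1} \<xi> * (4 * (z \<xi>)\<^sup>2) + 2 * M\<^sup>2)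
        + (LINT \<xi>|leb (-2) 2. indicator {-1<..<1} \<xi> * (4 * (V n \<xi> - z \<xi>)\<^sup>2))"
      using L2_continuous[OF w] z L2_diff[OF VL1 z]
      by (intro Bochner_Integration.integral_add Bochner_Integration.integrable_add LINT_indicator_subinterval(2))
         (auto simp: L2_iff)
    also have "(LINT \<xi>|leb (-2) 2. indicator {-1<..<1} \<xi> * (4 * (V n \<xi> - z \<xi>)\<^sup>2)) = 4 * (LINT \<xi>|leb (-1) 1. (V n \<xi> - z \<xi>)\<^sup>2)"
      by (subst LINT_indicator_subinterval(1)) auto
    also have "(LINT \<xi>|leb (-1) 1. (V n \<xi> - z \<xi>)\<^sup>2) \<le> E / \<mu>"
    proof -
      have "\<mu> * (LINT \<xi>|leb (-1) 1. (V n \<xi> - z \<xi>)\<^sup>2) = (LINT \<xi>|leb (-1) 1. \<mu> * (V n \<xi> - z \<xi>)\<^sup>2)" by simp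
      also have "\<dots> \<le> (LINT x|leb (-1) 1. \<eta> * (g n x)\<^sup>2 + \<mu> * (V n x - z x)\<^sup>2)"
        using L2_diff[OF VL1 z] gL1 pos by (intro integral_mono) (auto simp: L2_iff)
      also have "\<dots> \<le> E" using en(1)[of n] E[of n] by simp
      finally show ?thesis using pos by (simp add: field_simps)
    qed
    finally show ?thesis by (simp add: C_def)
  qed
  obtain r A B where r: "strict_mono r"
    "\<And>x. x \<notin> T \<Longrightarrow> (\<lambda>n. p (r n) x) \<longlonglongrightarrow> (\<Sum>s\<in>T. if s < x then A s + B s * (x - s) else 0)"
    "(\<Sum>s\<in>T. node_cost \<alpha> \<beta> (A s) (B s)) \<le> (\<Sum>i<k. if i \<in> S then \<alpha> else \<beta>)"
    using nodes_compact[where t = t and \<tau> = \<tau> and S = S and a = a and b = b and p = p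
        and k = k, OF t S p bound \<beta>, folded T_def] by blast
  obtain N l h where nl: "\<And>j. tail_weights j (N j) (l j)" and h: "h \<in> L2 (-2) 2"
    and Gh: "AE x in leb (-2) 2. (\<lambda>j. \<Sum>n\<in>{j..<N j}. l j n * g (r n) x) \<longlonglongrightarrow> h x"
      "(\<lambda>j. LINT x|leb (-2) 2. \<bar>(\<Sum>n\<in>{j..<N j}. l j n * g (r n) x) - h x\<bar>) \<longlonglongrightarrow> 0"
    using komlos[of "\<lambda>n. g (r n)", OF g] by (elim exE conjE) (rule that, erule spec)
  have l: "\<And>j n. 0 \<le> l j n" "\<And>j. sum (l j) {j..<N j} = 1" using nl by (auto simp: tail_weights_def)
  \<comment> \<open>The same weights act on the functions and on their second derivatives, so G j
    belongs to W j as g n belongs to V n.\<close>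
  define G where "G j x = (\<Sum>n\<in>{j..<N j}. l j n * g (r n) x)" for j x
  define W where "W j x = (\<Sum>n\<in>{j..<N j}. l j n * V (r n) x)" for j x
  define v where "v = pw (-2) c d h T A B"
  have hi: "integrable (leb (-2) 2) h" using h by (rule L2_integrable)
  have GL: "G j \<in> L2 (-2) 2" and WL: "W j \<in> L2 (-2) 2" for j
    unfolding G_def W_def by (intro L2_sum L2_cmult g VL)+
  \<comment> \<open>Weights of sum 1 reproduce the initial data c and d.\<close>
  have Weq: "W j x = c + d * (x - (-2)) + prim (-2) (prim (-2) (G j)) x + (\<Sum>n\<in>{j..<N j}. l j n * p (r n) x)"
    if "x \<in> {-2..2}" for j x
  proof -
    have "W j x = (\<Sum>n\<in>{j..<N j}. l j n * (c + d * (x - (-2))) + l j n * prim (-2) (prim (-2) (g (r n))) x + l j n * p (r n) x)"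
      unfolding W_def V by (rule sum.cong) (auto simp: algebra_simps)
    also have "\<dots> = sum (l j) {j..<N j} * (c + d * (x - (-2))) + (\<Sum>n\<in>{j..<N j}. l j n * prim (-2) (prim (-2) (g (r n))) x)
        + (\<Sum>n\<in>{j..<N j}. l j n * p (r n) x)"
      unfolding sum.distrib sum_distrib_right ..
    also have "(\<Sum>n\<in>{j..<N j}. l j n * prim (-2) (prim (-2) (g (r n))) x) = prim (-2) (prim (-2) (G j)) x"
      unfolding G_def using that gi by (intro prim2_sum[symmetric, where b = 2]) auto
    finally show ?thesis using l(2) by simp
  qed
  \<comment> \<open>L1 convergence of G j makes the twofold primitives converge at every point; the
    affine parts converge off T, and tail combinations keep their limits.\<close>
  have Wlim: "(\<lambda>j. W j x) \<longlonglongrightarrow> v x" if x: "x \<in> {-2..2}" "x \<notin> T" for x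
  proof -
    have "(\<lambda>j. prim (-2) (prim (-2) (G j)) x - prim (-2) (prim (-2) h) x) \<longlonglongrightarrow> 0"
    proof (rule Lim_null_comparison)
      show "\<forall>\<^sub>F j in sequentially. norm (prim (-2) (prim (-2) (G j)) x - prim (-2) (prim (-2) h) x)
          \<le> 4 * (LINT y|leb (-2) 2. \<bar>G j y - h y\<bar>)"
        using prim2_diff_bound[OF L2_integrable[OF GL] hi x(1)] by (intro always_eventually allI) simp
      show "(\<lambda>j. 4 * (LINT y|leb (-2) 2. \<bar>G j y - h y\<bar>)) \<longlonglongrightarrow> 0"
        using tendsto_mult_right_zero[OF Gh(2), of 4] by (simp add: G_def)
    qed
    then have "(\<lambda>j. prim (-2) (prim (-2) (G j)) x) \<longlonglongrightarrow> prim (-2) (prim (-2) h) x" by (rule LIM_zero_cancel)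
    then show ?thesis
      unfolding Weq[OF x(1)] v_def pw_def
      by (intro tendsto_add tendsto_const tail_weights_tendsto[OF nl r(2)[OF x(2)]])
  qed
  have Taway: "AE x in leb p' q'. x \<notin> T" for p' q' by (rule AE_leb_finite) (simp add: T_def)
  have v_out: "AE x in leb p' q'. v x = w x"
    if "\<And>n. AE x in leb p' q'. V n x = w x" "-2 \<le> p'" "q' \<le> 2" for p' q'
  proof -
    \<comment> \<open>Countably many null sets merge into one, so the relation can be averaged with
      weights at a fixed point x.\<close>
    have "AE x in leb p' q'. \<forall>n. V n x = w x" using that(1) by (simp add: AE_all_countable)
    then show ?thesis using Taway[of p' q'] unfolding AE_leb
    proof eventually_elim
      case (elim x)
      show ?case
      proof
        assume x: "x \<in> {p'<..<q'}"
        then have "W j x = w x" for j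
          using elim l(2)[of j] unfolding W_def by (simp flip: sum_distrib_right)
        then show "v x = w x" using Wlim[of x] elim x that LIMSEQ_unique[OF tendsto_const] by fastforce
      qed
    qed
  qed
  have v_ob: "AE x in leb (-1) 1. w x \<le> v x"
  proof -
    have "AE x in leb (-1) 1. \<forall>n. w x \<le> V n x" using ob by (simp add: AE_all_countable)
    then show ?thesis using Taway[of "-1" 1] unfolding AE_leb
    proof eventually_elim
      case (elim x)
      show ?case
      proof
        assume x: "x \<in> {-1<..<1}"
        have "w x \<le> W j x" for j
        proof -
          have "w x = (\<Sum>n\<in>{j..<N j}. l j n * w x)" using l(2)[of j] by (simp flip: sum_distrib_right)
          also have "\<dots> \<le> W j x"
            unfolding W_def using elim x l(1) by (intro sum_mono mult_left_mono) auto
          finally show ?thesis .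
        qed
        moreover have "(\<lambda>j. W j x) \<longlonglongrightarrow> v x" using elim x by (intro Wlim) auto
        ultimately show "w x \<le> v x" by (intro LIMSEQ_le_const) auto
      qed
    qed
  qed
  have T2: "finite T" "T \<subseteq> {-2<..<2}"
  proof -
    have "\<tau> i \<in> {-1..1}" if "i < k" for i
      using closed_sequentially[OF closed_atLeastAtMost _ t(2)[OF that]] t(1)[OF that] by blast
    then show "finite T" "T \<subseteq> {-2<..<2}" by (force simp: T_def)+
  qed
  have vL: "v \<in> L2 (-2) 2"
    unfolding v_def by (rule pw_in_L2(3)[OF _ h T2, of _ c d A B]) auto
  have L1: "v \<in> L2 (-1) 1" "h \<in> L2 (-1) 1" "\<And>j. W j \<in> L2 (-1) 1" "\<And>j. G j \<in> L2 (-1) 1"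
    by (rule L2_subset[OF vL] L2_subset[OF h] L2_subset[OF WL] L2_subset[OF GL]; simp)+
  \<comment> \<open>Convexity bounds the energy of W j by the weighted mean of the bounds
    \<open>e (r n)\<close>, which still tends to e0; Fatou then passes to the limit.\<close>
  have energy: "(LINT x|leb (-1) 1. \<eta> * (h x)\<^sup>2 + \<mu> * (v x - z x)\<^sup>2) \<le> e0"
  proof (rule fatou_real(2)[where f = "\<lambda>j x. \<eta> * (G j x)\<^sup>2 + \<mu> * (W j x - z x)\<^sup>2"
        and c = "\<lambda>j. \<Sum>n\<in>{j..<N j}. l j n * e (r n)"])
    show "integrable (leb (-1) 1) (\<lambda>x. \<eta> * (G j x)\<^sup>2 + \<mu> * (W j x - z x)\<^sup>2)" for j
      using L1(4)[of j] L2_diff[OF L1(3)[of j] z] by (auto simp: L2_iff)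
    show "0 \<le> \<eta> * (G j x)\<^sup>2 + \<mu> * (W j x - z x)\<^sup>2" for j x using pos by simp
    show "0 \<le> \<eta> * (h x)\<^sup>2 + \<mu> * (v x - z x)\<^sup>2" for x using pos by simp
    show "(\<lambda>x. \<eta> * (h x)\<^sup>2 + \<mu> * (v x - z x)\<^sup>2) \<in> borel_measurable (leb (-1) 1)"
      using L1(2) L2_diff[OF L1(1) z] by (auto simp: L2_iff)
    have "AE x in leb (-1) 1. (\<lambda>j. G j x) \<longlonglongrightarrow> h x"
      unfolding G_def using Gh(1) by (rule AE_leb_subset) auto
    then show "AE x in leb (-1) 1. (\<lambda>j. \<eta> * (G j x)\<^sup>2 + \<mu> * (W j x - z x)\<^sup>2) \<longlonglongrightarrow> \<eta> * (h x)\<^sup>2 + \<mu> * (v x - z x)\<^sup>2"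
      using Taway[of "-1" 1] unfolding AE_leb
    proof eventually_elim
      case (elim x)
      show ?case
      proof
        assume x: "x \<in> {-1<..<1}"
        have "(\<lambda>j. W j x) \<longlonglongrightarrow> v x" using elim x by (intro Wlim) auto
        then show "(\<lambda>j. \<eta> * (G j x)\<^sup>2 + \<mu> * (W j x - z x)\<^sup>2) \<longlonglongrightarrow> \<eta> * (h x)\<^sup>2 + \<mu> * (v x - z x)\<^sup>2"
          using elim x by (intro tendsto_intros) auto
      qed
    qed
    show "(LINT x|leb (-1) 1. \<eta> * (G j x)\<^sup>2 + \<mu> * (W j x - z x)\<^sup>2) \<le> (\<Sum>n\<in>{j..<N j}. l j n * e (r n))" for j
    proof -
      have ii: "integrable (leb (-1) 1) (\<lambda>x. \<eta> * (g n x)\<^sup>2 + \<mu> * (V n x - z x)\<^sup>2)" for n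
        using gL1[of n] L2_diff[OF VL1[of n] z] by (auto simp: L2_iff)
      have "(LINT x|leb (-1) 1. \<eta> * (G j x)\<^sup>2 + \<mu> * (W j x - z x)\<^sup>2)
        \<le> (LINT x|leb (-1) 1. (\<Sum>n\<in>{j..<N j}. l j n * (\<eta> * (g (r n) x)\<^sup>2 + \<mu> * (V (r n) x - z x)\<^sup>2)))"
      proof (rule integral_mono)
        show "integrable (leb (-1) 1) (\<lambda>x. \<eta> * (G j x)\<^sup>2 + \<mu> * (W j x - z x)\<^sup>2)"
          using L1(4)[of j] L2_diff[OF L1(3)[of j] z] by (auto simp: L2_iff)
        show "integrable (leb (-1) 1) (\<lambda>x. \<Sum>n\<in>{j..<N j}. l j n * (\<eta> * (g (r n) x)\<^sup>2 + \<mu> * (V (r n) x - z x)\<^sup>2))"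
          using ii by auto
        fix x
        have "W j x - z x = (\<Sum>n\<in>{j..<N j}. l j n * (V (r n) x - z x))"
          using l(2)[of j] by (simp add: W_def right_diff_distrib sum_subtractf flip: sum_distrib_right)
        then have "(W j x - z x)\<^sup>2 \<le> (\<Sum>n\<in>{j..<N j}. l j n * (V (r n) x - z x)\<^sup>2)"
          using tail_weights_square[OF nl[of j]] by simp
        moreover have "(G j x)\<^sup>2 \<le> (\<Sum>n\<in>{j..<N j}. l j n * (g (r n) x)\<^sup>2)"
          unfolding G_def by (rule tail_weights_square[OF nl])
        ultimately have "\<eta> * (G j x)\<^sup>2 + \<mu> * (W j x - z x)\<^sup>2
          \<le> \<eta> * (\<Sum>n\<in>{j..<N j}. l j n * (g (r n) x)\<^sup>2) + \<mu> * (\<Sum>n\<in>{j..<N j}. l j n * (V (r n) x - z x)\<^sup>2)"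
          using pos by (intro add_mono mult_left_mono) auto
        also have "\<dots> = (\<Sum>n\<in>{j..<N j}. l j n * (\<eta> * (g (r n) x)\<^sup>2 + \<mu> * (V (r n) x - z x)\<^sup>2))"
          unfolding sum_distrib_left sum.distrib[symmetric] by (rule sum.cong) (auto simp: algebra_simps)
        finally show "\<eta> * (G j x)\<^sup>2 + \<mu> * (W j x - z x)\<^sup>2
          \<le> (\<Sum>n\<in>{j..<N j}. l j n * (\<eta> * (g (r n) x)\<^sup>2 + \<mu> * (V (r n) x - z x)\<^sup>2))" .
      qed
      also have "\<dots> = (\<Sum>n\<in>{j..<N j}. l j n * (LINT x|leb (-1) 1. \<eta> * (g (r n) x)\<^sup>2 + \<mu> * (V (r n) x - z x)\<^sup>2))"
        using ii by (subst Bochner_Integration.integral_sum) auto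
      also have "\<dots> \<le> (\<Sum>n\<in>{j..<N j}. l j n * e (r n))"
        using en(1) l(1) by (intro sum_mono mult_left_mono) auto
      finally show ?thesis .
    qed
    show "(\<lambda>j. \<Sum>n\<in>{j..<N j}. l j n * e (r n)) \<longlonglongrightarrow> e0"
      using LIMSEQ_subseq_LIMSEQ[OF en(2) r(1)] by (intro tail_weights_tendsto[OF nl]) (simp add: comp_def)
  qed
  show ?thesis
    by (rule that[OF h, of A B]) (use r(3) v_out[of "-2" "-1"] v_out[of 1 2] out v_ob energy in \<open>auto simp: v_def T_def\<close>)
qed

text \<open>Expanding, \<mu> (v - w)^2 - f v = \<mu> (v - w - f/(2 \<mu>))^2 - f w - f^2/(4 \<mu>),
  and the last two terms do not depend on v.\<close>

lemma E1_complete_square: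
  assumes g: "g \<in> L2 (-2) 2" and T: "finite T" "T \<subseteq> {-1..1}"
    and v: "AE x in leb (-2) 2. v x = pw (-2) c d g T A B x"
    and f: "f \<in> L2 (-1) 1" and w: "w \<in> L2 (-1) 1" and \<mu>: "0 < \<mu>"
  shows "E1 \<alpha> \<beta> \<eta> \<mu> f w v = ereal ((\<Sum>t\<in>T. node_cost \<alpha> \<beta> (A t) (B t)) +
      (LINT x|leb (-1) 1. \<eta> * (g x)\<^sup>2 + \<mu> * (v x - (w x + f x / (2 * \<mu>)))\<^sup>2) -
      (LINT x|leb (-1) 1. f x * w x + (f x)\<^sup>2 / (4 * \<mu>)))"
proof -
  have T2: "T \<subseteq> {-2<..<2}" using T(2) by auto
  have vL: "v \<in> L2 (-1) 1"
    by (rule L2_subset[OF pw_in_L2(3)[OF _ g T(1) T2 v]]) auto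
  have gL: "g \<in> L2 (-1) 1" by (rule L2_subset[OF g]) auto
  have zL: "(\<lambda>x. v x - (w x + f x / (2 * \<mu>))) \<in> L2 (-1) 1"
    using L2_diff[OF vL L2_add[OF w L2_cmult[OF f, of "1 / (2 * \<mu>)"]]] by simp
  have i: "integrable (leb (-1) 1) (\<lambda>x. \<eta> * (g x)\<^sup>2 - f x * v x)"
    "integrable (leb (-1) 1) (\<lambda>x. \<mu> * (v x - w x)\<^sup>2)"
    "integrable (leb (-1) 1) (\<lambda>x. \<eta> * (g x)\<^sup>2 + \<mu> * (v x - (w x + f x / (2 * \<mu>)))\<^sup>2)"
    "integrable (leb (-1) 1) (\<lambda>x. f x * w x + (f x)\<^sup>2 / (4 * \<mu>))"
    using gL L2_integrable_mult[OF f vL] L2_diff[OF vL w] zL L2_integrable_mult[OF f w] f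
    by (auto simp: L2_iff)
  have "(LINT x|leb (-1) 1. \<eta> * (g x)\<^sup>2 - f x * v x) + \<mu> * (LINT x|leb (-1) 1. (v x - w x)\<^sup>2)
    = (LINT x|leb (-1) 1. (\<eta> * (g x)\<^sup>2 - f x * v x) + \<mu> * (v x - w x)\<^sup>2)"
    by (subst Bochner_Integration.integral_add[OF i(1,2)]) simp
  also have "\<dots> = (LINT x|leb (-1) 1. (\<eta> * (g x)\<^sup>2 + \<mu> * (v x - (w x + f x / (2 * \<mu>)))\<^sup>2)
      - (f x * w x + (f x)\<^sup>2 / (4 * \<mu>)))"
    using \<mu> by (intro LINT_cong) (auto simp: power2_eq_square field_simps)
  also have "\<dots> = (LINT x|leb (-1) 1. \<eta> * (g x)\<^sup>2 + \<mu> * (v x - (w x + f x / (2 * \<mu>)))\<^sup>2)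
      - (LINT x|leb (-1) 1. f x * w x + (f x)\<^sup>2 / (4 * \<mu>))"
    by (rule Bochner_Integration.integral_diff[OF i(3,4)])
  finally show ?thesis unfolding E1_pw[OF g T(1) T2 v f] by simp
qed

theorem theorem3p7:
  fixes w f :: "real \<Rightarrow> real" and \<alpha> \<beta> \<eta> \<mu> :: real
  assumes "C2_on (-2) 2 w"
    and "\<eta> > 0" and "\<mu> > 0"
    and "f \<in> L2 (-1) 1"
    and "0 < \<beta>" and "\<beta> \<le> \<alpha>" and "\<alpha> \<le> 2 * \<beta>"
  shows "\<exists>v\<in>admissible w. \<bar>E1 \<alpha> \<beta> \<eta> \<mu> f w v\<bar> \<noteq> \<infinity> \<and>
           (\<forall>u\<in>admissible w. E1 \<alpha> \<beta> \<eta> \<mu> f w v \<le> E1 \<alpha> \<beta> \<eta> \<mu> f w u)"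
proof -
  obtain w1 w2 where wc: "continuous_on {-2..2} w" "continuous_on {-2..2} w2"
    and "\<forall>p x. -2 \<le> p \<longrightarrow> p \<le> x \<longrightarrow> x \<le> 2 \<longrightarrow> w x = w p + w1 p * (x - p) + prim p (prim p w2) x"
    using C2_on_expansion[OF assms(1)] by (elim exE conjE)
  then have we: "w x = w p + w1 p * (x - p) + prim p (prim p w2) x" if "-2 \<le> p" "p \<le> x" "x \<le> 2" for p x
    using that by blast
  note w = wc we
  \<comment> \<open>Value and slope of w at -2 are common to all admissible functions, so only g, T,
    A and B vary along a sequence.\<close>
  define c d where "c = w (-2)" and "d = w1 (-2)"
  have wL: "w \<in> L2 (-1) 1" by (rule L2_subset[OF L2_continuous[OF w(1)]]) auto
  define z where "z x = w x + f x / (2 * \<mu>)" for x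
  have zL: "z \<in> L2 (-1) 1"
    unfolding z_def using L2_add[OF wL L2_cmult[OF assms(4), of "1 / (2 * \<mu>)"]] by simp
  define c0 where "c0 = (LINT x|leb (-1) 1. f x * w x + (f x)\<^sup>2 / (4 * \<mu>))"
  define Q where "Q g v = (LINT x|leb (-1) 1. \<eta> * (g x)\<^sup>2 + \<mu> * (v x - z x)\<^sup>2)" for g v
  define data where "data g T A B v \<longleftrightarrow> g \<in> L2 (-2) 2 \<and> finite T \<and> T \<subseteq> {-1..1} \<and>
      (\<forall>t\<in>T. A t \<noteq> 0 \<or> B t \<noteq> 0) \<and> (\<forall>x. x < -1 \<or> 1 < x \<longrightarrow> g x = w2 x) \<and>
      (AE x in leb (-2) 2. v x = pw (-2) c d g T A B x)" for g T A B v
  have E1: "E1 \<alpha> \<beta> \<eta> \<mu> f w v = ereal ((\<Sum>t\<in>T. node_cost \<alpha> \<beta> (A t) (B t)) + Q g v - c0)"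
    if "g \<in> L2 (-2) 2" "finite T" "T \<subseteq> {-1..1}" "AE x in leb (-2) 2. v x = pw (-2) c d g T A B x" for g T A B v
    unfolding Q_def z_def c0_def by (rule E1_complete_square[OF that assms(4) wL assms(3)])
  have data_ex: "\<exists>g T A B. data g T A B v" if v: "v \<in> admissible w" for v
    using admissible_imp_pw[OF v w(2,3)] unfolding data_def c_def d_def .
  have Q0: "0 \<le> Q g v" for g v
    unfolding Q_def using assms(2,3) by (intro Bochner_Integration.integral_nonneg) auto
  have kost0: "0 \<le> node_cost \<alpha> \<beta> p q" for p q using assms(5,6) by (simp add: node_cost_def)
  \<comment> \<open>The obstacle itself is a competitor, so the infimum is taken over a nonempty
    set.\<close>
  have "w \<in> admissible w"
  proof (rule pw_admissible)
    show "w2 \<in> L2 (-2) 2" using w(2) by (rule L2_continuous)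
    show "AE x in leb (-2) 2. w x = pw (-2) c d w2 {} w w x"
      unfolding AE_leb c_def d_def
    proof (rule AE_I2, rule impI)
      fix x :: real assume "x \<in> {-2<..<2}"
      then show "w x = pw (-2) (w (-2)) (w1 (-2)) w2 {} w w x" using w(3)[of "-2" x] by (simp add: pw_def)
    qed
  qed (use w(1) in auto)
  \<comment> \<open>The energy of every admissible function is a real number and at least -c0, so
    the infimum is real and the minimum will be finite.\<close>
  define X where "X = {r. \<exists>v\<in>admissible w. E1 \<alpha> \<beta> \<eta> \<mu> f w v = ereal r}"
  have X_of: "\<exists>r\<in>X. E1 \<alpha> \<beta> \<eta> \<mu> f w v = ereal r \<and> - c0 \<le> r" if v: "v \<in> admissible w" for v
  proof -
    obtain g T A B where D: "data g T A B v" using data_ex[OF v] by blast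
    then have eq: "E1 \<alpha> \<beta> \<eta> \<mu> f w v = ereal ((\<Sum>t\<in>T. node_cost \<alpha> \<beta> (A t) (B t)) + Q g v - c0)"
      unfolding data_def by (intro E1) auto
    moreover have "0 \<le> (\<Sum>t\<in>T. node_cost \<alpha> \<beta> (A t) (B t))" by (rule sum_nonneg) (rule kost0)
    ultimately show ?thesis using v Q0[of g v] unfolding X_def by fastforce
  qed
  have bdd: "bdd_below X"
  proof (rule bdd_belowI[of _ "- c0"])
    fix r assume "r \<in> X"
    then obtain v where "v \<in> admissible w" "E1 \<alpha> \<beta> \<eta> \<mu> f w v = ereal r" by (auto simp: X_def)
    then show "- c0 \<le> r" using X_of[of v] by auto
  qed
  have ne: "X \<noteq> {}" using X_of[OF \<open>w \<in> admissible w\<close>] by blast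
  define m where "m = Inf X"
  have "\<exists>v g T A B. v \<in> admissible w \<and> data g T A B v \<and>
      (\<Sum>t\<in>T. node_cost \<alpha> \<beta> (A t) (B t)) + Q g v - c0 < m + inverse (real (Suc n))" for n
  proof -
    have "Inf X < m + inverse (real (Suc n))" by (simp add: m_def)
    then obtain r where r: "r \<in> X" "r < m + inverse (real (Suc n))" using cInf_lessD[OF ne] by blast
    then obtain v where v: "v \<in> admissible w" "E1 \<alpha> \<beta> \<eta> \<mu> f w v = ereal r" by (auto simp: X_def)
    obtain g T A B where D: "data g T A B v" using data_ex[OF v(1)] by blast
    then have "E1 \<alpha> \<beta> \<eta> \<mu> f w v = ereal ((\<Sum>t\<in>T. node_cost \<alpha> \<beta> (A t) (B t)) + Q g v - c0)"
      unfolding data_def by (intro E1) auto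
    then have "(\<Sum>t\<in>T. node_cost \<alpha> \<beta> (A t) (B t)) + Q g v - c0 < m + inverse (real (Suc n))" using v(2) r(2) by simp
    then show ?thesis using v(1) D by blast
  qed
  then have "\<forall>n. \<exists>v g T A B. v \<in> admissible w \<and> data g T A B v \<and>
      (\<Sum>t\<in>T. node_cost \<alpha> \<beta> (A t) (B t)) + Q g v - c0 < m + inverse (real (Suc n))" by (rule allI)
  then obtain v g T A B where "\<forall>n. v n \<in> admissible w \<and> data (g n) (T n) (A n) (B n) (v n) \<and>
      (\<Sum>t\<in>T n. node_cost \<alpha> \<beta> (A n t) (B n t)) + Q (g n) (v n) - c0 < m + inverse (real (Suc n))"
    unfolding choice_iff by (elim exE)
  then have vn: "\<And>n. v n \<in> admissible w" and D: "\<And>n. data (g n) (T n) (A n) (B n) (v n)"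
    and small: "\<And>n. (\<Sum>t\<in>T n. node_cost \<alpha> \<beta> (A n t) (B n t)) + Q (g n) (v n) - c0 < m + inverse (real (Suc n))"
    by simp_all
  have gL: "g n \<in> L2 (-2) 2" and Tfin: "finite (T n)" and T1: "T n \<subseteq> {-1..1}"
    and nz: "\<And>t. t \<in> T n \<Longrightarrow> A n t \<noteq> 0 \<or> B n t \<noteq> 0" and gout: "\<And>x. x < -1 \<or> 1 < x \<Longrightarrow> g n x = w2 x"
    and vpw: "AE x in leb (-2) 2. v n x = pw (-2) c d (g n) (T n) (A n) (B n) x" for n
    using D[of n] unfolding data_def by auto
  have inv1: "inverse (real (Suc n)) \<le> 1" for n by (simp add: inverse_le_1_iff)
  \<comment> \<open>Every node carries a nonzero jump and costs at least \<beta>, while the total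
    cost is at most m + 1 + c0 because the quadratic part is nonnegative.\<close>
  have card_le: "card (T n) \<le> nat \<lceil>(m + 1 + c0) / \<beta>\<rceil>" for n
  proof -
    have "\<beta> * real (card (T n)) \<le> (\<Sum>t\<in>T n. node_cost \<alpha> \<beta> (A n t) (B n t))"
    proof -
      have "(\<Sum>t\<in>T n. \<beta>) \<le> (\<Sum>t\<in>T n. node_cost \<alpha> \<beta> (A n t) (B n t))"
        using nz assms(6) by (intro sum_mono) (auto simp: node_cost_def)
      then show ?thesis by (simp add: mult.commute)
    qed
    also have "\<dots> \<le> m + 1 + c0" using small[of n] Q0[of "g n" "v n"] inv1[of n] by linarith
    finally have "real (card (T n)) \<le> (m + 1 + c0) / \<beta>" using assms(5) by (simp add: field_simps)
    then show ?thesis by linarith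
  qed
  define k0 where "k0 = nat \<lceil>(m + 1 + c0) / \<beta>\<rceil>"
  have "\<exists>\<phi>. bij_betw \<phi> {..<card (T n)} (T n)" for n
    using ex_bij_betw_nat_finite[OF Tfin[of n]] by (simp add: atLeast0LessThan)
  then obtain \<phi> where \<phi>: "\<And>n. bij_betw (\<phi> n) {..<card (T n)} (T n)" by metis
  \<comment> \<open>The number of nodes together with the indices of those with a value jump: only
    finitely many patterns occur, so one of them recurs infinitely often.\<close>
  define type where "type n = (card (T n), {i \<in> {..<card (T n)}. A n (\<phi> n i) \<noteq> 0})" for n
  have "range type \<subseteq> {..k0} \<times> Pow {..<k0}"
    using card_le unfolding type_def k0_def by (auto intro: less_le_trans)
  then have "finite (type ` UNIV)" by (rule finite_subset) simp
  then obtain n0 where inf: "infinite {n \<in> UNIV. type n = type n0}"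
    using pigeonhole_infinite[of UNIV type] by auto
  obtain r1 :: "nat \<Rightarrow> nat" where r1: "strict_mono r1" "\<And>n. type (r1 n) = type n0"
    using infinite_enumerate[OF inf] by auto
  define k where "k = card (T n0)"
  define S where "S = {i \<in> {..<k}. A n0 (\<phi> n0 i) \<noteq> 0}"
  have type_eq: "card (T (r1 n)) = card (T n0)"
    "{i \<in> {..<card (T (r1 n))}. A (r1 n) (\<phi> (r1 n) i) \<noteq> 0} = {i \<in> {..<card (T n0)}. A n0 (\<phi> n0 i) \<noteq> 0}" for n
    using r1(2)[of n] unfolding type_def prod.inject by blast+
  have k: "card (T (r1 n)) = k" for n unfolding k_def by (rule type_eq(1))
  have S: "{i \<in> {..<k}. A (r1 n) (\<phi> (r1 n) i) \<noteq> 0} = S" for n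
    using type_eq(2)[of n] unfolding S_def k_def type_eq(1) .
  have t1: "\<phi> (r1 n) i \<in> T (r1 n)" if "i < k" for n i
    using bij_betwE[OF \<phi>[of "r1 n"]] that k[of n] by auto
  have "\<exists>r::nat \<Rightarrow> nat. strict_mono r \<and> (\<forall>i\<in>{..<k}. convergent (\<lambda>n. \<phi> (r1 (r n)) i))"
  proof (rule finite_bounded_subseq[of "{..<k}" "\<lambda>i n. \<phi> (r1 n) i"])
    fix i assume "i \<in> {..<k}"
    then have "\<bar>\<phi> (r1 n) i\<bar> \<le> 1" for n using t1[of i n] T1[of "r1 n"] by (auto simp: abs_le_iff)
    then show "Bseq (\<lambda>n. \<phi> (r1 n) i)" by (intro BseqI'[of _ 1]) simp
  qed simp
  then obtain r2 :: "nat \<Rightarrow> nat" where r2: "strict_mono r2" "\<And>i. i < k \<Longrightarrow> convergent (\<lambda>n. \<phi> (r1 (r2 n)) i)"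
    by auto
  define s where "s n = r1 (r2 n)" for n
  define t where "t n i = \<phi> (s n) i" for n i
  define \<tau> where "\<tau> i = lim (\<lambda>n. t n i)" for i
  define a b where "a n i = A (s n) (t n i)" and "b n i = B (s n) (t n i)" for n i
  define p where "p n x = (\<Sum>i<k. if t n i < x then a n i + b n i * (x - t n i) else 0)" for n x
  \<comment> \<open>A representative of v (s n) with a formula at every point, since v (s n) itself
    is known only almost everywhere.\<close>
  define V where "V n x = c + d * (x - (-2)) + prim (-2) (prim (-2) (g (s n))) x + p n x" for n x
  have reindex: "(\<Sum>x\<in>T (s n). h x) = (\<Sum>i<k. h (t n i))" for n and h :: "real \<Rightarrow> real"
    using sum.reindex_bij_betw[OF \<phi>[of "s n"], of h] k[of "r2 n"] by (simp add: s_def t_def)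
  have V: "V n = pw (-2) c d (g (s n)) (T (s n)) (A (s n)) (B (s n))" for n
    unfolding V_def pw_def reindex p_def a_def b_def by (rule ext) simp
  have vV: "AE x in leb (-2) 2. v (s n) x = V n x" for n using vpw V by simp
  have cost: "(\<Sum>x\<in>T (s n). node_cost \<alpha> \<beta> (A (s n) x) (B (s n) x)) = (\<Sum>i<k. if i \<in> S then \<alpha> else \<beta>)" for n
    unfolding reindex
  proof (rule sum.cong[OF refl])
    fix i assume "i \<in> {..<k}"
    then have "t n i \<in> T (s n)" "i \<in> S \<longleftrightarrow> A (s n) (t n i) \<noteq> 0"
      using t1[of i "r2 n"] S[of "r2 n"] by (auto simp: t_def s_def)
    then show "node_cost \<alpha> \<beta> (A (s n) (t n i)) (B (s n) (t n i)) = (if i \<in> S then \<alpha> else \<beta>)"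
      using nz[of "t n i" "s n"] by (auto simp: node_cost_def)
  qed
  \<comment> \<open>The pattern of nodes is constant along s, hence so is the cost. Subtracting it
    leaves an upper bound for the quadratic part alone, with limit m + c0 - Kc.\<close>
  define Kc where "Kc = (\<Sum>i<k. if i \<in> S then \<alpha> else \<beta>)"
  have vadm: "AE x in lebesgue. x \<in> {-2<..<-1} \<union> {1<..<2} \<longrightarrow> v n x = w x" for n
    using vn[of n] by (simp add: admissible_def)
  have QV: "Q (g (s n)) (V n) \<le> m + inverse (real (Suc n)) + c0 - Kc" for n
  proof -
    have two: "(-2::real) < 2" by simp
    have T2: "T (s n) \<subseteq> {-2<..<2}" using T1[of "s n"] by auto
    have vL: "v (s n) \<in> L2 (-1) 1"
      by (rule L2_subset[OF pw_in_L2(3)[OF two gL Tfin T2 vpw]]) auto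
    have ae: "AE x in leb (-1) 1. v (s n) x = V n x" using vV by (rule AE_leb_subset) auto
    have "AE x in leb (-1) 1. V n x = v (s n) x" using ae by eventually_elim simp
    then have VL: "V n \<in> L2 (-1) 1" using vL by (rule L2_AE_cong)
    have gL1: "g (s n) \<in> L2 (-1) 1" by (rule L2_subset[OF gL]) auto
    have "Q (g (s n)) (V n) = Q (g (s n)) (v (s n))"
      unfolding Q_def
    proof (rule integral_cong_AE)
      show "AE x in leb (-1) 1. \<eta> * (g (s n) x)\<^sup>2 + \<mu> * (V n x - z x)\<^sup>2 = \<eta> * (g (s n) x)\<^sup>2 + \<mu> * (v (s n) x - z x)\<^sup>2"
        using ae by eventually_elim simp
    qed (use L2_diff[OF VL zL] L2_diff[OF vL zL] gL1 in \<open>auto simp: L2_iff\<close>)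
    moreover have "n \<le> s n"
      using seq_suble[OF r1(1), of "r2 n"] seq_suble[OF r2(1), of n] by (simp add: s_def)
    then have "inverse (real (Suc (s n))) \<le> inverse (real (Suc n))" by simp
    ultimately show ?thesis using small[of "s n", unfolded cost, folded Kc_def] by linarith
  qed
  \<comment> \<open>Outside [-1,1] the second derivative is that of w; inside, its squared norm is
    controlled by the energy divided by \<eta>.\<close>
  define C1 where "C1 = (LINT x|leb (-2) 2. (w2 x)\<^sup>2) + (m + 1 + c0 - Kc) / \<eta>"
  have gC: "(LINT x|leb (-2) 2. (g (s n) x)\<^sup>2) \<le> C1" for n
  proof -
    have gL1: "g (s n) \<in> L2 (-1) 1" by (rule L2_subset[OF gL]) auto
    have VL: "V n \<in> L2 (-1) 1"
    proof (rule L2_subset)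
      show "V n \<in> L2 (-2) 2"
        unfolding V using T1[of "s n"] by (intro pw_in_L2(3)[where c = c and d = d and A = "A (s n)" and B = "B (s n)", OF _ gL Tfin]) auto
    qed auto
    have w2i: "integrable (leb (-2) 2) (\<lambda>x. (w2 x)\<^sup>2)" using L2_continuous[OF w(2)] by (simp add: L2_iff)
    have "(LINT x|leb (-2) 2. (g (s n) x)\<^sup>2) \<le> (LINT x|leb (-2) 2. (w2 x)\<^sup>2 + indicator {-1<..<1} x * (g (s n) x)\<^sup>2)"
    proof (rule integral_mono_AE)
      show "integrable (leb (-2) 2) (\<lambda>x. (g (s n) x)\<^sup>2)" using gL by (simp add: L2_iff)
      show "integrable (leb (-2) 2) (\<lambda>x. (w2 x)\<^sup>2 + indicator {-1<..<1} x * (g (s n) x)\<^sup>2)"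
        using w2i gL1 by (intro Bochner_Integration.integrable_add LINT_indicator_subinterval(2)) (auto simp: L2_iff)
      have "AE x in leb (-2) 2. x \<notin> {-1, 1}" by (rule AE_leb_finite) simp
      then show "AE x in leb (-2) 2. (g (s n) x)\<^sup>2 \<le> (w2 x)\<^sup>2 + indicator {-1<..<1} x * (g (s n) x)\<^sup>2"
      proof eventually_elim
        case (elim x)
        then show ?case using gout[of x "s n"] by (cases "x \<in> {-1<..<1}") auto
      qed
    qed
    also have "\<dots> = (LINT x|leb (-2) 2. (w2 x)\<^sup>2) + (LINT x|leb (-2) 2. indicator {-1<..<1} x * (g (s n) x)\<^sup>2)"
      using w2i gL1 by (intro Bochner_Integration.integral_add LINT_indicator_subinterval(2)) (auto simp: L2_iff)
    also have "(LINT x|leb (-2) 2. indicator {-1<..<1} x * (g (s n) x)\<^sup>2) = (LINT x|leb (-1) 1. (g (s n) x)\<^sup>2)"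
      by (rule LINT_indicator_subinterval(1)) auto
    also have "\<dots> \<le> (m + 1 + c0 - Kc) / \<eta>"
    proof -
      have "\<eta> * (LINT x|leb (-1) 1. (g (s n) x)\<^sup>2) = (LINT x|leb (-1) 1. \<eta> * (g (s n) x)\<^sup>2)" by simp
      also have "\<dots> \<le> Q (g (s n)) (V n)"
        unfolding Q_def using gL1 L2_diff[OF VL zL] assms(3) by (intro integral_mono) (auto simp: L2_iff)
      also have "\<dots> \<le> m + 1 + c0 - Kc" using QV[of n] inv1[of n] by linarith
      finally show ?thesis using assms(2) by (simp add: field_simps)
    qed
    finally show ?thesis by (simp add: C1_def)
  qed
  have t_in: "t n i \<in> {-1..1}" if "i < k" for n i
    using t1[OF that, of "r2 n"] T1[of "s n"] by (auto simp: t_def s_def)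
  have t_lim: "(\<lambda>n. t n i) \<longlonglongrightarrow> \<tau> i" if "i < k" for i
    using r2(2)[OF that] by (simp add: \<tau>_def t_def s_def convergent_LIMSEQ_iff)
  have aS: "a n i = 0" if "i < k" "i \<notin> S" for n i
    using S[of "r2 n"] that by (auto simp: a_def t_def s_def)
  have out: "AE x in leb (-2) (-1). V n x = w x" "AE x in leb 1 2. V n x = w x" for n
    using vadm[of "s n"] vV[of n] unfolding AE_leb by (eventually_elim, auto)+
  have ob: "AE x in leb (-1) 1. w x \<le> V n x" for n
  proof -
    have "AE x in leb (-1) 1. v (s n) x = V n x" using vV by (rule AE_leb_subset) auto
    with admissible_above[OF vn gL Tfin T1 vpw, of "s n"] show ?thesis by eventually_elim simp
  qed
  have elim: "(\<lambda>n. m + inverse (real (Suc n)) + c0 - Kc) \<longlonglongrightarrow> m + 0 + c0 - Kc"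
    by (intro tendsto_intros LIMSEQ_inverse_real_of_nat)
  obtain h A' B' where h: "h \<in> L2 (-2) 2"
    "(\<Sum>s\<in>\<tau> ` {..<k}. node_cost \<alpha> \<beta> (A' s) (B' s)) \<le> (\<Sum>i<k. if i \<in> S then \<alpha> else \<beta>)"
    "AE x in leb (-2) (-1). pw (-2) c d h (\<tau> ` {..<k}) A' B' x = w x"
    "AE x in leb 1 2. pw (-2) c d h (\<tau> ` {..<k}) A' B' x = w x"
    "AE x in leb (-1) 1. w x \<le> pw (-2) c d h (\<tau> ` {..<k}) A' B' x"
    "(LINT x|leb (-1) 1. \<eta> * (h x)\<^sup>2 + \<mu> * (pw (-2) c d h (\<tau> ` {..<k}) A' B' x - z x)\<^sup>2) \<le> m + 0 + c0 - Kc"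
    by (rule pw_limit[where k = k and S = S and t = t and \<tau> = \<tau> and a = a and b = b and p = p and V = V, OF w(1) zL gL gC t_in t_lim aS p_def V_def out ob QV[unfolded Q_def] elim assms(2,3,5-7)])
  define u where "u = pw (-2) c d h (\<tau> ` {..<k}) A' B'"
  have \<tau>1: "\<tau> ` {..<k} \<subseteq> {-1..1}"
    using closed_sequentially[OF closed_atLeastAtMost _ t_lim] t_in by blast
  have u_ae: "AE x in leb (-2) 2. u x = pw (-2) c d h (\<tau> ` {..<k}) A' B' x" by (simp add: u_def)
  have u: "u \<in> admissible w"
    by (rule pw_admissible[OF h(1) _ \<tau>1 u_ae w(1)]) (use h(3-5) in \<open>simp_all add: u_def\<close>)
  have Eu: "E1 \<alpha> \<beta> \<eta> \<mu> f w u = ereal ((\<Sum>s\<in>\<tau> ` {..<k}. node_cost \<alpha> \<beta> (A' s) (B' s)) + Q h u - c0)"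
    by (rule E1[OF h(1) _ \<tau>1 u_ae]) simp
  \<comment> \<open>The limit costs at most Kc and its quadratic part is at most m + c0 - Kc, so the
    constants cancel.\<close>
  have "(\<Sum>s\<in>\<tau> ` {..<k}. node_cost \<alpha> \<beta> (A' s) (B' s)) + Q h u - c0 \<le> m"
    using h(2,6) by (simp add: Q_def u_def Kc_def)
  moreover have "\<exists>r. E1 \<alpha> \<beta> \<eta> \<mu> f w v = ereal r \<and> m \<le> r" if "v \<in> admissible w" for v
    using X_of[OF that] cInf_lower[OF _ bdd] unfolding m_def by blast
  ultimately show ?thesis using u Eu by (intro bexI[of _ u]) fastforce+
qed

end
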